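(* Let $n\ge 1$, let $V_{\mathbb R}$ be a real vector space of dimension $4n$, and let $Compl$ be the period domain of complex tori of complex dimension $2n$. (1) Every twistor sphere $S(I,J)$ is embedded in $Compl$ as a complex submanifold of complex dimension $1$. The degree of (the image of) a twistor sphere in $Gr(2n,4n)=Gr(2n,V_{\mathbb R}\otimes\mathbb C)$ with respect to the Plücker embedding $Gr(2n,4n)\hookrightarrow\mathbb P^{\binom{4n}{2n}-1}$ is $2n$. (2) In each of the two connected components of $Compl$, any two periods can be connected by a generic path of twistor lines.
   Context: $Compl$ is the set of all complex structure operators $I\in End(V_{\mathbb R})$, $I^2=-1$. The map $I\mapsto (\mathbb 1-iI)V_{\mathbb R}\subset V_{\mathbb C}:=V_{\mathbb R}\otimes\mathbb C$ identifies $Compl$ with the open subset of the complex Grassmannian $Gr(2n,V_{\mathbb C})=Gr(2n,4n)$ of $2n$-planes meeting $V_{\mathbb R}$ only in $0$; $Compl$ carries the induced complex manifold structure. It has two connected components $Compl^+$ and $Compl^-$. Elements of $Compl$ are called periods. If $I,J\in Compl$ anticommute and $K=IJ$, the twistor sphere (twistor line) they determine is $S(I,J)=\{aI+bJ+cK\mid a,b,c\in\mathbb R,\ a^2+b^2+c^2=1\}\subset Compl$. Fix a lattice $\Gamma\subset V_{\mathbb R}$ (of rank $4n$). A period $I$ corresponds to the complex torus $(V_{\mathbb R}/\Gamma, I)$. The period $I$ is generic if this torus has trivial Néron–Severi group, i.e. there is no nonzero alternating form $\Omega$ on $V_{\mathbb R}$, taking rational values on $\Gamma\times\Gamma$, with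 $\Omega(I\cdot,I\cdot)=\Omega(\cdot,\cdot)$. A path of twistor lines is an ordered finite sequence $S_1,\dots,S_m$ of twistor spheres with $S_i\cap S_{i+1}\neq\emptyset$ for $1\le i\le m-1$; it connects a period in $S_1$ to a period in $S_m$. It is generic if the periods at which successive lines of the path intersect are generic. *)

theory Defs
  imports "HOL-Analysis.Analysis"
begin

text \<open>
  The real vector space is \<open>real^'m\<close>, its complexification is \<open>complex^'m\<close>, and endomorphisms
  are matrices. The complex linear algebra on \<open>complex^'m\<close> is that of the library interpretation
  \<open>vec\<close> (\<open>vec.subspace\<close>, \<open>vec.dim\<close>, ...), which is taken over the field of the entries.
\<close>

definition complex_structures :: "(real^'m^'m) set" where
  "complex_structures = {I. I ** I = - mat 1}"

definition twistor_sphere :: "real^'m^'m \<Rightarrow> real^'m^'m \<Rightarrow> (real^'m^'m) set" where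
  "twistor_sphere I J =
     {a *\<^sub>R I + b *\<^sub>R J + c *\<^sub>R (I ** J) | a b c. a\<^sup>2 + b\<^sup>2 + c\<^sup>2 = 1}"

definition is_twistor_sphere :: "(real^'m^'m) set \<Rightarrow> bool" where
  "is_twistor_sphere S \<longleftrightarrow>
     (\<exists>I\<in>complex_structures. \<exists>J\<in>complex_structures. I ** J = - (J ** I) \<and> S = twistor_sphere I J)"

definition complexify :: "real^'m \<Rightarrow> complex^'m" where
  "complexify v = (\<chi> j. complex_of_real (v $ j))"

text \<open>The plane \<open>(1 - \<i> I) V\<close> of the complexification, for \<open>V\<close> the real space.\<close>

definition period_plane :: "real^'m^'m \<Rightarrow> (complex^'m) set" where
  "period_plane I = range (\<lambda>v. complexify v - \<i> *s complexify (I *v v))"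


section \<open>Complex submanifolds\<close>

text \<open>The derivative is required to be given by a complex Jacobian matrix, that is, to be
  complex linear.\<close>

definition holomorphic_map_on :: "(complex^'a \<Rightarrow> complex^'b) \<Rightarrow> (complex^'a) set \<Rightarrow> bool" where
  "holomorphic_map_on f U \<longleftrightarrow>
     (\<forall>z\<in>U. \<exists>A::complex^'a^'b. (f has_derivative (\<lambda>x. A *v x)) (at z))"

text \<open>Embedded (not necessarily closed) complex submanifolds of complex dimension \<open>d\<close>: near each
  of its points \<open>S\<close> is a \<open>d\<close>-dimensional linear slice in a local biholomorphic coordinate system.\<close>

definition complex_submanifold :: "nat \<Rightarrow> (complex^'a) set \<Rightarrow> bool" where
  "complex_submanifold d S \<longleftrightarrow>
     (\<forall>z\<in>S. \<exists>(U :: (complex^'a) set) (V :: (complex^'a) set) F G L. open U \<and> open V \<and> z \<in> U \<and> homeomorphism U V F G \<and>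
        holomorphic_map_on F U \<and> holomorphic_map_on G V \<and>
        vec.subspace L \<and> vec.dim L = d \<and> F ` (S \<inter> U) = L \<inter> V)"

definition grassmannian :: "nat \<Rightarrow> (complex^'m) set set" where
  "grassmannian k = {W. vec.subspace W \<and> vec.dim W = k}"

text \<open>
  For complementary subspaces \<open>A\<close> (of dimension \<open>k\<close>) and \<open>B\<close> of \<open>complex^'m\<close>, the standard chart
  of the Grassmannian identifies the planes complementary to \<open>B\<close> with the linear maps from \<open>A\<close>
  to \<open>B\<close>: the plane belonging to \<open>Z\<close> is the graph \<open>{a + Z a | a \<in> A}\<close>. A linear map from
  \<open>A\<close> to \<open>B\<close> is extended by zero on \<open>B\<close> to an endomorphism, whose matrix is
  regarded as a vector indexed by pairs. In this way the chart takes its values in a complex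
  linear subspace of \<open>complex^('m \<times> 'm)\<close>; a subset of a linear subspace is a complex submanifold
  of it if and only if it is one of the ambient space.
\<close>

definition unflatten :: "complex^('m \<times> 'm) \<Rightarrow> complex^'m^'m" where
  "unflatten z = (\<chi> i j. z $ (i, j))"

definition hom_space :: "(complex^'m) set \<Rightarrow> (complex^'m) set \<Rightarrow> (complex^('m \<times> 'm)) set" where
  "hom_space A B =
     {z. (\<forall>a\<in>A. unflatten z *v a \<in> B) \<and> (\<forall>b\<in>B. unflatten z *v b = 0)}"

definition graph_plane :: "(complex^'m) set \<Rightarrow> complex^('m \<times> 'm) \<Rightarrow> (complex^'m) set" where
  "graph_plane A z = (\<lambda>a. a + unflatten z *v a) ` A"

definition complementary :: "(complex^'m) set \<Rightarrow> (complex^'m) set \<Rightarrow> bool" where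
  "complementary A B \<longleftrightarrow> vec.subspace A \<and> vec.subspace B \<and> A \<inter> B = {0} \<and>
     (\<forall>v. \<exists>a\<in>A. \<exists>b\<in>B. v = a + b)"

definition grassmannian_submanifold :: "nat \<Rightarrow> nat \<Rightarrow> (complex^'m) set set \<Rightarrow> bool" where
  "grassmannian_submanifold k d S \<longleftrightarrow> S \<subseteq> grassmannian k \<and>
     (\<forall>A B. A \<in> grassmannian k \<longrightarrow> complementary A B \<longrightarrow>
        complex_submanifold d {z \<in> hom_space A B. graph_plane A z \<in> S})"

text \<open>The set of complex structures carries the complex manifold structure of an open subset of the
  Grassmannian of half-dimensional planes, via \<^const>\<open>period_plane\<close>.\<close>

definition period_submanifold :: "nat \<Rightarrow> (real^'m^'m) set \<Rightarrow> bool" where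
  "period_submanifold d T \<longleftrightarrow> T \<subseteq> complex_structures \<and>
     grassmannian_submanifold (CARD('m) div 2) d (period_plane ` T)"


section \<open>Projective space, degree and the Pluecker embedding\<close>

text \<open>Homogeneous coordinates are indexed by a finite set \<open>X\<close>; vectors vanish outside \<open>X\<close>, and a
  point is the set of all its vectors of homogeneous coordinates.\<close>

definition proj_point :: "('i \<Rightarrow> complex) \<Rightarrow> ('i \<Rightarrow> complex) set" where
  "proj_point v = {\<lambda>i. c * v i | c. c \<noteq> 0}"

definition proj_space :: "'i set \<Rightarrow> ('i \<Rightarrow> complex) set set" where
  "proj_space X = {proj_point v | v. (\<forall>i. i \<notin> X \<longrightarrow> v i = 0) \<and> (\<exists>i\<in>X. v i \<noteq> 0)}"

definition hyperplane :: "'i set \<Rightarrow> ('i \<Rightarrow> complex) \<Rightarrow> ('i \<Rightarrow> complex) set set" where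
  "hyperplane X h = {p \<in> proj_space X. \<forall>v\<in>p. (\<Sum>i\<in>X. h i * v i) = 0}"

inductive_set polynomial_maps :: "'i set \<Rightarrow> (('i \<Rightarrow> complex) \<Rightarrow> complex) set" for X where
  const: "(\<lambda>_. c) \<in> polynomial_maps X"
| coord: "i \<in> X \<Longrightarrow> (\<lambda>h. h i) \<in> polynomial_maps X"
| add: "f \<in> polynomial_maps X \<Longrightarrow> g \<in> polynomial_maps X \<Longrightarrow> (\<lambda>h. f h + g h) \<in> polynomial_maps X"
| mult: "f \<in> polynomial_maps X \<Longrightarrow> g \<in> polynomial_maps X \<Longrightarrow> (\<lambda>h. f h * g h) \<in> polynomial_maps X"

text \<open>A projective curve has degree \<open>d\<close> if a general hyperplane meets it in exactly \<open>d\<close> points;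
  general means: outside the zero set of some nonzero polynomial in the coefficients of the
  hyperplane. Homogeneity of the polynomial need not be required, as the condition on the
  hyperplane is invariant under rescaling of its coefficients.\<close>

definition has_degree :: "'i set \<Rightarrow> ('i \<Rightarrow> complex) set set \<Rightarrow> nat \<Rightarrow> bool" where
  "has_degree X C d \<longleftrightarrow> C \<subseteq> proj_space X \<and>
     (\<exists>q\<in>polynomial_maps X. (\<exists>h. q h \<noteq> 0) \<and>
        (\<forall>h. (\<exists>i\<in>X. h i \<noteq> 0) \<and> q h \<noteq> 0 \<longrightarrow>
           finite (C \<inter> hyperplane X h) \<and> card (C \<inter> hyperplane X h) = d))"

definition is_basis_of :: "nat \<Rightarrow> (nat \<Rightarrow> complex^'m) \<Rightarrow> (complex^'m) set \<Rightarrow> bool" where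
  "is_basis_of k w W \<longleftrightarrow> inj_on w {..<k} \<and> vec.independent (w ` {..<k}) \<and>
     vec.span (w ` {..<k}) = W"

text \<open>The elements of \<open>S\<close> in increasing order with respect to the fixed embedding \<^const>\<open>to_nat\<close>
  of the index type into the natural numbers.\<close>

definition index_list :: "'m::finite set \<Rightarrow> 'm list" where
  "index_list S = map from_nat (sorted_list_of_set (to_nat ` S))"

text \<open>The coordinate at a \<open>k\<close>-element set \<open>S\<close> is the \<open>k \<times> k\<close> minor with rows \<open>S\<close> of the
  matrix with columns \<open>w 0, ..., w (k - 1)\<close>.\<close>

definition pluecker_indices :: "nat \<Rightarrow> 'm::finite set set" where
  "pluecker_indices k = {S. card S = k}"

definition pluecker_coords :: "nat \<Rightarrow> (nat \<Rightarrow> complex^'m) \<Rightarrow> 'm set \<Rightarrow> complex" where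
  "pluecker_coords k w S =
     (if S \<in> pluecker_indices k
      then \<Sum>p | p permutes {..<k}. of_int (sign p) * (\<Prod>i<k. w (p i) $ (index_list S ! i))
      else 0)"

definition pluecker :: "nat \<Rightarrow> (complex^'m) set \<Rightarrow> ('m set \<Rightarrow> complex) set" where
  "pluecker k W = proj_point (pluecker_coords k (SOME w. is_basis_of k w W))"


section \<open>Generic periods and paths of twistor lines\<close>

definition full_lattice :: "(real^'m) set \<Rightarrow> bool" where
  "full_lattice \<Gamma> \<longleftrightarrow> (\<exists>B. independent B \<and> span B = UNIV \<and>
     \<Gamma> = range (\<lambda>c::real^'m \<Rightarrow> int. \<Sum>b\<in>B. of_int (c b) *\<^sub>R b))"

definition generic_period :: "(real^'m) set \<Rightarrow> real^'m^'m \<Rightarrow> bool" where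
  "generic_period \<Gamma> I \<longleftrightarrow> I \<in> complex_structures \<and>
     \<not> (\<exists>\<Omega> :: real^'m \<Rightarrow> real^'m \<Rightarrow> real.
          bilinear \<Omega> \<and> (\<forall>x. \<Omega> x x = 0) \<and> (\<exists>x y. \<Omega> x y \<noteq> 0) \<and>
          (\<forall>x\<in>\<Gamma>. \<forall>y\<in>\<Gamma>. \<Omega> x y \<in> \<rat>) \<and> (\<forall>x y. \<Omega> (I *v x) (I *v y) = \<Omega> x y))"

definition twistor_path :: "(real^'m^'m) set list \<Rightarrow> bool" where
  "twistor_path Ss \<longleftrightarrow> Ss \<noteq> [] \<and> (\<forall>S\<in>set Ss. is_twistor_sphere S) \<and>
     (\<forall>i. Suc i < length Ss \<longrightarrow> Ss ! i \<inter> Ss ! Suc i \<noteq> {})"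

definition path_connects :: "(real^'m^'m) set list \<Rightarrow> real^'m^'m \<Rightarrow> real^'m^'m \<Rightarrow> bool" where
  "path_connects Ss P Q \<longleftrightarrow> P \<in> hd Ss \<and> Q \<in> last Ss"

definition generic_path :: "(real^'m) set \<Rightarrow> (real^'m^'m) set list \<Rightarrow> bool" where
  "generic_path \<Gamma> Ss \<longleftrightarrow> twistor_path Ss \<and>
     (\<forall>i. Suc i < length Ss \<longrightarrow> (\<forall>P \<in> Ss ! i \<inter> Ss ! Suc i. generic_period \<Gamma> P))"

end

theory Submission
  imports Defs "HOL-Computational_Algebra.Fundamental_Theorem_Algebra"
begin

text \<open>
  Submanifold and degree: \<open>V\<^sub>\<complex>\<close> is the sum of the plane \<open>W\<close> of \<open>I\<close> and of \<open>J W\<close>, and the planes of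
  the points of \<open>S(I,J)\<close> are \<open>J W\<close> and the graphs \<open>(1 + t J) W\<close>, \<open>t \<in> \<complex>\<close>. In the chart centred at
  \<open>W\<close> they form a complex line, and charts are related by rational maps. The Pluecker coordinates of
  \<open>(1 + t J) W\<close> span all polynomials in \<open>t\<close> of degree at most \<open>2 n\<close>, so the sphere is a rational
  normal curve of degree \<open>2 n\<close>, and general hyperplanes are those for which a discriminant does not
  vanish.

  Paths: if \<open>P\<close> and \<open>J\<close> nearly anticommute, normalising the commutator \<open>P J - J P\<close> yields a complex
  structure anticommuting with both. Hence periods \<open>P\<close>, \<open>Q\<close> near \<open>X\<close> are joined through any period
  \<open>J'\<close> near some \<open>J\<close> anticommuting with \<open>X\<close>: first \<open>P - M - J'\<close>, then \<open>J' - M' - Q\<close>, where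
  \<open>M = M(P,J')\<close> and \<open>M' = M(Q,J')\<close> depend equivariantly on \<open>J'\<close>. For each of the countably many
  rational forms the condition that \<open>J'\<close>, \<open>M\<close> or \<open>M'\<close> preserves it is closed and, by conjugating
  with the centraliser of \<open>P\<close> or \<open>Q\<close>, nowhere dense; Baire's theorem gives a \<open>J'\<close> for which all
  three joints are generic. Distinct twistor spheres share at most one pair \<open>\<plusminus> P\<close>, so
  genericity of one common point suffices. Connectedness of the component globalises this.
\<close>

section \<open>Generic paths of twistor lines\<close>

text \<open>The endpoints of a path are arbitrary, and the joints are not independent:
  \<open>M\<close> and \<open>M'\<close> are functions of \<open>J'\<close>. Genericity of all three
  is thus one condition on \<open>J'\<close>, and the obstacle is to see that the preimages of a bad
  locus under these functions have no interior, although it is not known that the functions are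
  open. Equivariance replaces openness: conjugation by the centraliser of \<open>P\<close> fixes
  \<open>P\<close>, moves \<open>J'\<close> inside the period domain and carries \<open>M\<close>
  along. Invariance of a form under a complex structure amounts to skewness and so becomes a
  quadratic condition along an affine line in the centraliser; one violation anywhere on the line,
  even at a singular matrix, yields violations arbitrarily near the identity. The normalising square
  root is built as a unique fixed point because commutation, continuity and equivariance then all
  follow from the contraction. The submanifold condition is imposed in every chart, not only in the
  one centred at \<open>W\<close>; hence an arbitrary chart is moved by a linear map that carries
  the splitting \<open>W\<close>, \<open>J W\<close> to its own.\<close>

lemma bounded_bilinear_matrix_matrix_mult:
  "bounded_bilinear ((**) :: real^'n^'m \<Rightarrow> real^'p^'n \<Rightarrow> real^'p^'m)"
  unfolding bilinear_conv_bounded_bilinear[symmetric] bilinear_def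
  by (auto intro!: linearI simp: matrix_matrix_mult_def vec_eq_iff sum.distrib algebra_simps
      sum_distrib_left)

interpretation mm: bounded_bilinear "(**) :: real^'n^'m \<Rightarrow> real^'p^'n \<Rightarrow> real^'p^'m"
  by (rule bounded_bilinear_matrix_matrix_mult)

text \<open>Normal form: sums of right-associated words. A rule rewriting a product of two letters
  therefore also comes in a version with a trailing factor \<open>X\<close>.\<close>

lemmas matrix_ring_simps = matrix_mul_assoc[symmetric] mm.add_left mm.add_right mm.diff_left
  mm.diff_right mm.minus_left mm.minus_right mm.scaleR_left mm.scaleR_right mm.zero_left
  mm.zero_right scaleR_add_right scaleR_diff_right scaleR_minus_right

section \<open>Quaternion algebra on twistor spheres\<close>

lemma complex_structures_sq:
  assumes "P \<in> complex_structures"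
  shows "P ** P = - mat 1" "P ** (P ** X) = - X"
proof -
  show *: "P ** P = - mat 1" using assms by (simp add: complex_structures_def)
  show "P ** (P ** X) = - X" by (simp add: matrix_mul_assoc * mm.minus_left)
qed

lemma anticommute_left:
  assumes "I ** J = - (J ** (I::real^'m^'m))"
  shows "J ** I = - (I ** J)" "J ** (I ** X) = - (I ** (J ** X))"
proof -
  show *: "J ** I = - (I ** J)" using assms by simp
  show "J ** (I ** X) = - (I ** (J ** X))" by (simp add: matrix_mul_assoc * mm.minus_left)
qed

lemma mat_1_neq_0: "(mat 1 :: real^'m^'m) \<noteq> 0"
proof
  assume "(mat 1 :: real^'m^'m) = 0"
  then have "(mat 1 :: real^'m^'m) $ undefined $ undefined = 0" by simp
  then show False by (simp add: mat_def)
qed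

text \<open>As for imaginary quaternions, the product is minus the scalar product of the coordinate
  vectors plus their cross product; hence anticommuting means orthogonal.\<close>

lemma quaternion_mult:
  fixes I J :: "real^'m^'m"
  assumes "I \<in> complex_structures" "J \<in> complex_structures" "I ** J = - (J ** I)"
  shows "(a *\<^sub>R I + b *\<^sub>R J + c *\<^sub>R (I ** J)) ** (a' *\<^sub>R I + b' *\<^sub>R J + c' *\<^sub>R (I ** J)) =
     - (a * a' + b * b' + c * c') *\<^sub>R mat 1 +
     ((b * c' - c * b') *\<^sub>R I + (c * a' - a * c') *\<^sub>R J + (a * b' - b * a') *\<^sub>R (I ** J))"
  by (simp add: matrix_ring_simps complex_structures_sq assms(1,2) anticommute_left[OF assms(3)])
     (simp add: algebra_simps)

lemma twistor_sphere_subset_complex_structures: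
  fixes I J :: "real^'m^'m"
  assumes "I \<in> complex_structures" "J \<in> complex_structures" "I ** J = - (J ** I)"
  shows "twistor_sphere I J \<subseteq> complex_structures"
proof
  fix X assume "X \<in> twistor_sphere I J"
  then obtain a b c where X: "X = a *\<^sub>R I + b *\<^sub>R J + c *\<^sub>R (I ** J)" "a * a + b * b + c * c = 1"
    by (auto simp: twistor_sphere_def power2_eq_square)
  show "X \<in> complex_structures"
    unfolding X(1) complex_structures_def mem_Collect_eq quaternion_mult[OF assms] X(2)
    by (simp add: mult.commute)
qed

lemma twistor_sphereI:
  "a\<^sup>2 + b\<^sup>2 + c\<^sup>2 = 1 \<Longrightarrow> a *\<^sub>R I + b *\<^sub>R J + c *\<^sub>R (I ** J) \<in> twistor_sphere I J"
  unfolding twistor_sphere_def by blast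

lemma is_twistor_sphere_subset:
  "is_twistor_sphere S \<Longrightarrow> S \<subseteq> complex_structures"
  unfolding is_twistor_sphere_def using twistor_sphere_subset_complex_structures by blast

text \<open>The vectors \<open>t\<close>, \<open>u\<close> and their cross product \<open>w\<close>
  form an orthonormal basis of three-space, \<open>p\<close>, \<open>q\<close>, \<open>r\<close> are
  the coordinates of \<open>s\<close> in it, and the last equation is Parseval's.\<close>

lemma orthonormal_frame_expansion:
  fixes t1 t2 t3 u1 u2 u3 s1 s2 s3 :: real
  assumes "t1\<^sup>2 + t2\<^sup>2 + t3\<^sup>2 = 1" "u1\<^sup>2 + u2\<^sup>2 + u3\<^sup>2 = 1" "t1 * u1 + t2 * u2 + t3 * u3 = 0"
  defines "w1 \<equiv> t2 * u3 - t3 * u2" and "w2 \<equiv> t3 * u1 - t1 * u3" and "w3 \<equiv> t1 * u2 - t2 * u1"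
  defines "p \<equiv> s1 * t1 + s2 * t2 + s3 * t3" and "q \<equiv> s1 * u1 + s2 * u2 + s3 * u3"
    and "r \<equiv> s1 * w1 + s2 * w2 + s3 * w3"
  shows "s1 = p * t1 + q * u1 + r * w1" "s2 = p * t2 + q * u2 + r * w2"
    "s3 = p * t3 + q * u3 + r * w3" "p\<^sup>2 + q\<^sup>2 + r\<^sup>2 = s1\<^sup>2 + s2\<^sup>2 + s3\<^sup>2"
proof -
  show 1: "s1 = p * t1 + q * u1 + r * w1" and 2: "s2 = p * t2 + q * u2 + r * w2"
    and 3: "s3 = p * t3 + q * u3 + r * w3"
    unfolding p_def q_def r_def w1_def w2_def w3_def using assms(1-3) by algebra+
  have "p\<^sup>2 + q\<^sup>2 + r\<^sup>2 = p * (s1 * t1 + s2 * t2 + s3 * t3) + q * (s1 * u1 + s2 * u2 + s3 * u3)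
     + r * (s1 * w1 + s2 * w2 + s3 * w3)"
    by (simp add: p_def q_def r_def power2_eq_square)
  also have "\<dots> = s1 * (p * t1 + q * u1 + r * w1) + s2 * (p * t2 + q * u2 + r * w2)
     + s3 * (p * t3 + q * u3 + r * w3)" by (simp add: algebra_simps)
  finally show "p\<^sup>2 + q\<^sup>2 + r\<^sup>2 = s1\<^sup>2 + s2\<^sup>2 + s3\<^sup>2"
    using 1 2 3 by (simp add: power2_eq_square)
qed

lemma cross_norm:
  fixes t1 t2 t3 u1 u2 u3 :: real
  assumes "t1\<^sup>2 + t2\<^sup>2 + t3\<^sup>2 = 1" "u1\<^sup>2 + u2\<^sup>2 + u3\<^sup>2 = 1" "t1 * u1 + t2 * u2 + t3 * u3 = 0"
  shows "(x * t1 + y * u1 + z * (t2 * u3 - t3 * u2))\<^sup>2 + (x * t2 + y * u2 + z * (t3 * u1 - t1 * u3))\<^sup>2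
    + (x * t3 + y * u3 + z * (t1 * u2 - t2 * u1))\<^sup>2 = x\<^sup>2 + y\<^sup>2 + z\<^sup>2"
  using assms by algebra

text \<open>Anticommuting points are orthogonal unit vectors and their product is their cross
  product, so \<open>T\<close>, \<open>U\<close>, \<open>T ** U\<close> is another orthonormal frame
  of the same three-space.\<close>

lemma twistor_sphere_eq:
  fixes I J :: "real^'m^'m"
  assumes IJ: "I \<in> complex_structures" "J \<in> complex_structures" "I ** J = - (J ** I)"
    and T: "T \<in> twistor_sphere I J" and U: "U \<in> twistor_sphere I J" and TU: "T ** U = - (U ** T)"
  shows "twistor_sphere T U = twistor_sphere I J"
proof -
  obtain t1 t2 t3 where t: "T = t1 *\<^sub>R I + t2 *\<^sub>R J + t3 *\<^sub>R (I ** J)" "t1\<^sup>2 + t2\<^sup>2 + t3\<^sup>2 = 1"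
    using T by (auto simp: twistor_sphere_def)
  obtain u1 u2 u3 where u: "U = u1 *\<^sub>R I + u2 *\<^sub>R J + u3 *\<^sub>R (I ** J)" "u1\<^sup>2 + u2\<^sup>2 + u3\<^sup>2 = 1"
    using U by (auto simp: twistor_sphere_def)
  have "T ** U + U ** T = (- 2 * (t1 * u1 + t2 * u2 + t3 * u3)) *\<^sub>R mat 1"
    unfolding t u quaternion_mult[OF IJ] by (simp add: vec_eq_iff algebra_simps)
  then have tu: "t1 * u1 + t2 * u2 + t3 * u3 = 0"
    using TU mat_1_neq_0 by auto
  have W: "T ** U = (t2 * u3 - t3 * u2) *\<^sub>R I + (t3 * u1 - t1 * u3) *\<^sub>R J + (t1 * u2 - t2 * u1) *\<^sub>R (I ** J)"
    unfolding t u quaternion_mult[OF IJ] tu by simp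
  have comb: "x *\<^sub>R T + y *\<^sub>R U + z *\<^sub>R (T ** U) =
      (x * t1 + y * u1 + z * (t2 * u3 - t3 * u2)) *\<^sub>R I + (x * t2 + y * u2 + z * (t3 * u1 - t1 * u3)) *\<^sub>R J
      + (x * t3 + y * u3 + z * (t1 * u2 - t2 * u1)) *\<^sub>R (I ** J)" for x y z
    unfolding W by (simp add: t(1) u(1) algebra_simps)
  show ?thesis
  proof (intro equalityI subsetI)
    fix s assume "s \<in> twistor_sphere T U"
    then obtain x y z where "s = x *\<^sub>R T + y *\<^sub>R U + z *\<^sub>R (T ** U)" "x\<^sup>2 + y\<^sup>2 + z\<^sup>2 = 1"
      by (auto simp: twistor_sphere_def)
    then show "s \<in> twistor_sphere I J"
      using cross_norm[OF t(2) u(2) tu, of x y z] by (simp add: comb twistor_sphereI)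
  next
    fix s assume "s \<in> twistor_sphere I J"
    then obtain s1 s2 s3 where s: "s = s1 *\<^sub>R I + s2 *\<^sub>R J + s3 *\<^sub>R (I ** J)" "s1\<^sup>2 + s2\<^sup>2 + s3\<^sup>2 = 1"
      by (auto simp: twistor_sphere_def)
    note e = orthonormal_frame_expansion[OF t(2) u(2) tu, where ?s1.0 = s1 and ?s2.0 = s2 and ?s3.0 = s3]
    let ?p = "s1 * t1 + s2 * t2 + s3 * t3" and ?q = "s1 * u1 + s2 * u2 + s3 * u3"
    let ?r = "s1 * (t2 * u3 - t3 * u2) + s2 * (t3 * u1 - t1 * u3) + s3 * (t1 * u2 - t2 * u1)"
    have "s = ?p *\<^sub>R T + ?q *\<^sub>R U + ?r *\<^sub>R (T ** U)"
      unfolding comb s(1) e(1-3)[symmetric] by (rule refl)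
    moreover have "?p\<^sup>2 + ?q\<^sup>2 + ?r\<^sup>2 = 1" using e(4) s(2) by simp
    ultimately show "s \<in> twistor_sphere T U" unfolding twistor_sphere_def by blast
  qed
qed

text \<open>Gram-Schmidt: two points that are neither equal nor opposite yield an anticommuting
  pair, which determines the sphere. Their scalar product \<open>r\<close> can be read off the
  anticommutator, so the orthonormalised second vector does not depend on the sphere.\<close>

lemma twistor_spheres_meet:
  assumes "is_twistor_sphere S" "is_twistor_sphere S'" and "S \<noteq> S'"
    and T: "T \<in> S" "T \<in> S'" and U: "U \<in> S" "U \<in> S'"
  shows "U = T \<or> U = - T"
proof (rule ccontr)
  assume neq: "\<not> (U = T \<or> U = - T)"
  have key: "\<exists>r. T ** U + U ** T = (- 2 * r) *\<^sub>R mat 1 \<and> r\<^sup>2 < 1 \<and>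
       S = twistor_sphere T ((U - r *\<^sub>R T) /\<^sub>R sqrt (1 - r\<^sup>2))"
    if S: "is_twistor_sphere S" "T \<in> S" "U \<in> S" for S
  proof -
    obtain I J where IJ: "I \<in> complex_structures" "J \<in> complex_structures" "I ** J = - (J ** I)"
      and SIJ: "S = twistor_sphere I J"
      using S(1) by (auto simp: is_twistor_sphere_def)
    obtain t1 t2 t3 where t: "T = t1 *\<^sub>R I + t2 *\<^sub>R J + t3 *\<^sub>R (I ** J)" "t1\<^sup>2 + t2\<^sup>2 + t3\<^sup>2 = 1"
      using S by (auto simp: twistor_sphere_def SIJ)
    obtain u1 u2 u3 where u: "U = u1 *\<^sub>R I + u2 *\<^sub>R J + u3 *\<^sub>R (I ** J)" "u1\<^sup>2 + u2\<^sup>2 + u3\<^sup>2 = 1"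
      using S by (auto simp: twistor_sphere_def SIJ)
    define r where "r = t1 * u1 + t2 * u2 + t3 * u3"
    define d where "d = sqrt (1 - r\<^sup>2)"
    have TU: "T ** U + U ** T = (- 2 * r) *\<^sub>R mat 1"
      unfolding t u quaternion_mult[OF IJ] by (simp add: vec_eq_iff algebra_simps r_def)
    have sq: "1 - r\<^sup>2 = (u1 - r * t1)\<^sup>2 + (u2 - r * t2)\<^sup>2 + (u3 - r * t3)\<^sup>2"
      using t(2) u(2) unfolding r_def by algebra
    have "1 - r\<^sup>2 \<noteq> 0"
    proof
      assume "1 - r\<^sup>2 = 0"
      then have u': "u1 = r * t1" "u2 = r * t2" "u3 = r * t3"
        using sq by (smt (verit) zero_le_power2 power2_eq_iff zero_eq_power2)+
      have "U = r *\<^sub>R T" by (simp add: t u u' algebra_simps)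
      moreover have "r = 1 \<or> r = -1" using \<open>1 - r\<^sup>2 = 0\<close> by (simp add: power2_eq_1_iff)
      ultimately show False using neq by auto
    qed
    moreover have "1 - r\<^sup>2 \<ge> 0" unfolding sq by simp
    ultimately have r1: "r\<^sup>2 < 1" by simp
    then have d: "d > 0" "d\<^sup>2 = 1 - r\<^sup>2" by (simp_all add: d_def)
    define V where "V = (U - r *\<^sub>R T) /\<^sub>R d"
    have V: "V = ((u1 - r * t1) / d) *\<^sub>R I + ((u2 - r * t2) / d) *\<^sub>R J + ((u3 - r * t3) / d) *\<^sub>R (I ** J)"
      using d by (simp add: V_def t u algebra_simps divide_inverse)
    have "((u1 - r * t1) / d)\<^sup>2 + ((u2 - r * t2) / d)\<^sup>2 + ((u3 - r * t3) / d)\<^sup>2 = 1"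
      using d(1) by (simp add: power_divide add_divide_distrib[symmetric] sq[symmetric] d(2)[symmetric])
    then have "V \<in> twistor_sphere I J" unfolding twistor_sphere_def V by blast
    moreover have "T ** V = - (V ** T)"
    proof -
      have TT: "T ** T = - mat 1"
        using S(2) is_twistor_sphere_subset[OF S(1)] complex_structures_sq by blast
      have "T ** V + V ** T = (T ** U + U ** T - (2 * r) *\<^sub>R (T ** T)) /\<^sub>R d"
        by (simp add: V_def matrix_ring_simps) (simp add: vec_eq_iff algebra_simps)
      also have "\<dots> = 0" by (simp add: TU TT)
      finally show ?thesis by (simp add: eq_neg_iff_add_eq_0)
    qed
    ultimately have "twistor_sphere T V = twistor_sphere I J"
      using twistor_sphere_eq[OF IJ _ _ ] S SIJ by blast
    then show ?thesis using TU r1 unfolding V_def d_def SIJ by blast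
  qed
  obtain r where r: "T ** U + U ** T = (- 2 * r) *\<^sub>R mat 1"
    "S = twistor_sphere T ((U - r *\<^sub>R T) /\<^sub>R sqrt (1 - r\<^sup>2))" using key[OF assms(1)] T U by blast
  obtain r' where r': "T ** U + U ** T = (- 2 * r') *\<^sub>R mat 1"
    "S' = twistor_sphere T ((U - r' *\<^sub>R T) /\<^sub>R sqrt (1 - r'\<^sup>2))" using key[OF assms(2)] T U by blast
  have "r = r'" using r(1) r'(1) mat_1_neq_0 by auto
  then show False using r r' \<open>S \<noteq> S'\<close> by simp
qed

section \<open>Chains of twistor spheres with generic joints\<close>

definition linked :: "real^'m^'m \<Rightarrow> real^'m^'m \<Rightarrow> bool" where
  "linked P Q \<longleftrightarrow> (\<exists>S. is_twistor_sphere S \<and> P \<in> S \<and> Q \<in> S)"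

lemma linked_anticommute:
  assumes "P \<in> complex_structures" "M \<in> complex_structures" "P ** M = - (M ** P)"
  shows "linked P M" "linked M P"
proof -
  have "is_twistor_sphere (twistor_sphere P M)" using assms by (auto simp: is_twistor_sphere_def)
  moreover have "P \<in> twistor_sphere P M" using twistor_sphereI[of 1 0 0 P M] by simp
  moreover have "M \<in> twistor_sphere P M" using twistor_sphereI[of 0 1 0 P M] by simp
  ultimately show "linked P M" "linked M P" unfolding linked_def by blast+
qed

lemma matrix_minus_vector_mult: "(- A) *v x = - (A *v (x::real^'m))"
  by (simp add: matrix_vector_mult_def vec_eq_iff sum_negf)

lemma generic_period_uminus:
  assumes "generic_period \<Gamma> P"
  shows "generic_period \<Gamma> (- P)"
proof -
  have "\<Omega> (- P *v x) (- P *v y) = \<Omega> (P *v x) (P *v y)" if "bilinear \<Omega>" for \<Omega> :: "_ \<Rightarrow> _ \<Rightarrow> real" and x y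
    using that by (simp add: matrix_minus_vector_mult bilinear_lneg bilinear_rneg)
  moreover have "- P \<in> complex_structures" using assms
    by (simp add: generic_period_def complex_structures_def matrix_ring_simps)
  ultimately show ?thesis using assms unfolding generic_period_def by metis
qed

text \<open>Only the inner joints \<open>T\<close> must be generic, neither \<open>P\<close> nor
  \<open>Q\<close>; for this reason composing two chains requires a generic middle point.\<close>

inductive reach :: "(real^'m) set \<Rightarrow> real^'m^'m \<Rightarrow> real^'m^'m \<Rightarrow> bool" for \<Gamma> P where
  reach_linked: "linked P Q \<Longrightarrow> reach \<Gamma> P Q"
| reach_step: "reach \<Gamma> P T \<Longrightarrow> generic_period \<Gamma> T \<Longrightarrow> linked T Q \<Longrightarrow> reach \<Gamma> P Q"

lemma reach_trans:
  assumes "reach \<Gamma> P T" "generic_period \<Gamma> T" "reach \<Gamma> T Q"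
  shows "reach \<Gamma> P Q"
  using assms(3,1,2) by induction (auto intro: reach.intros)

lemma generic_path_snoc:
  assumes Ss: "generic_path \<Gamma> Ss" and T: "T \<in> last Ss" "T \<in> S" "generic_period \<Gamma> T"
    and S: "is_twistor_sphere S" "S \<noteq> last Ss"
  shows "generic_path \<Gamma> (Ss @ [S])"
proof -
  have ne: "Ss \<noteq> []" and sph: "\<forall>S\<in>set Ss. is_twistor_sphere S"
    using Ss by (auto simp: generic_path_def twistor_path_def)
  have 1: "generic_period \<Gamma> U" if "U \<in> last Ss" "U \<in> S" for U
    using twistor_spheres_meet[of "last Ss" S T U] that T S ne sph generic_period_uminus by auto
  have 2: "(Ss @ [S]) ! i \<inter> (Ss @ [S]) ! Suc i \<noteq> {} \<and>
      (\<forall>U \<in> (Ss @ [S]) ! i \<inter> (Ss @ [S]) ! Suc i. generic_period \<Gamma> U)"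
    if "Suc i < length (Ss @ [S])" for i
  proof (cases "Suc i < length Ss")
    case True
    then show ?thesis using Ss by (simp add: nth_append generic_path_def twistor_path_def)
  next
    case False
    with that have i: "Suc i = length Ss" by simp
    then have "i = length Ss - 1" "i < length Ss" by auto
    then have "(Ss @ [S]) ! i = last Ss" "(Ss @ [S]) ! Suc i = S"
      using ne i by (simp_all add: nth_append last_conv_nth)
    then show ?thesis using T 1 by auto
  qed
  show ?thesis unfolding generic_path_def twistor_path_def using 2 ne sph S by auto
qed

lemma reach_generic_path:
  assumes "reach \<Gamma> P Q"
  shows "\<exists>Ss. generic_path \<Gamma> Ss \<and> path_connects Ss P Q"
  using assms
proof induction
  case (reach_linked Q)
  then obtain S where "is_twistor_sphere S" "P \<in> S" "Q \<in> S" by (auto simp: linked_def)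
  then have "generic_path \<Gamma> [S] \<and> path_connects [S] P Q"
    by (auto simp: generic_path_def twistor_path_def path_connects_def)
  then show ?case by blast
next
  case (reach_step T Q)
  then obtain Ss S where Ss: "generic_path \<Gamma> Ss" "path_connects Ss P T"
    and S: "is_twistor_sphere S" "T \<in> S" "Q \<in> S" by (auto simp: linked_def)
  have ne: "Ss \<noteq> []" using Ss by (auto simp: generic_path_def twistor_path_def)
  show ?case
  proof (cases "S = last Ss")
    \<comment> \<open>A repeated sphere must not be appended: the intersection would be the whole
      sphere, all of whose points would have to be generic.\<close>
    case True
    then show ?thesis using Ss S by (auto simp: path_connects_def)
  next
    case False
    have "generic_path \<Gamma> (Ss @ [S])"
      using generic_path_snoc[OF Ss(1) _ S(2) \<open>generic_period \<Gamma> T\<close> S(1) False] Ss(2)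
      by (simp add: path_connects_def)
    moreover have "path_connects (Ss @ [S]) P Q"
      using Ss(2) S ne by (simp add: path_connects_def hd_append)
    ultimately show ?thesis by blast
  qed
qed

section \<open>Inverse square roots near the identity\<close>

lemma matrix_inverse_sqrt:
  obtains e r :: real and s :: "real^'m^'m \<Rightarrow> real^'m^'m" where
    "e > 0" "r > 0"
    "\<And>E. norm E < e \<Longrightarrow> norm (s E) < r"
    "\<And>E. norm E < e \<Longrightarrow> (mat 1 + s E) ** (mat 1 + s E) ** (mat 1 - E) = mat 1"
    "\<And>E X. norm E < e \<Longrightarrow> X ** E = E ** X \<Longrightarrow> X ** s E = s E ** X"
    "\<And>E z. norm E < e \<Longrightarrow> norm z \<le> r \<Longrightarrow> (mat 1 + z) ** (mat 1 + z) ** (mat 1 - E) = mat 1 \<Longrightarrow> z = s E"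
    "continuous_on (ball 0 e) s"
proof -
  \<comment> \<open>Expanding \<open>(1 + z)^2 (1 - E) = 1\<close> and solving for the linear term
    \<open>2 z\<close> gives this fixed point equation.\<close>
  define T where "T = (\<lambda>E z :: real^'m^'m. (1/2) *\<^sub>R (E + 2 *\<^sub>R (z ** E) + z ** z ** E - z ** z))"
  have T_iff: "T E z = z \<longleftrightarrow> (mat 1 + z) ** (mat 1 + z) ** (mat 1 - E) = mat 1" for E z
  proof -
    have "T E z = z \<longleftrightarrow> E + 2 *\<^sub>R (z ** E) + z ** z ** E - z ** z - 2 *\<^sub>R z = 0"
      unfolding T_def by (simp add: vec_eq_iff) (auto simp: field_simps)
    also have "E + 2 *\<^sub>R (z ** E) + z ** z ** E - z ** z - 2 *\<^sub>R z =
        mat 1 - (mat 1 + z) ** (mat 1 + z) ** (mat 1 - E)"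
      by (simp only: matrix_ring_simps matrix_mul_lid matrix_mul_rid) (simp add: vec_eq_iff)
    finally show ?thesis by (metis eq_iff_diff_eq_0)
  qed
  obtain K where K: "K > 0" and nK: "norm (A ** B) \<le> norm A * norm B * K" for A B :: "real^'m^'m"
    using mm.pos_bounded by blast
  \<comment> \<open>Since \<open>K\<close> bounds the matrix product, these radii make
    \<open>T E\<close> a contraction with factor \<open>1/2\<close> of the ball of radius
    \<open>r\<close> into itself.\<close>
  define r where "r = 1 / (8 * K)"
  define e where "e = 1 / (16 * K)"
  have r: "r > 0" "K * r = 1/8" and e: "e > 0" "K * e = 1/16" "e < r"
    using K by (simp_all add: r_def e_def field_simps)
  have K': "a * e * K = a / 16" "a * r * K = a / 8" "r * a * K = a / 8" for a
    using K by (simp_all add: r_def e_def)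
  have nrm: "norm (A ** B) \<le> a * b * K" if "norm A \<le> a" "norm B \<le> b" for A B :: "real^'m^'m" and a b
  proof -
    have "norm A * norm B \<le> a * b" using that by (intro mult_mono) (auto intro: order_trans[OF norm_ge_zero])
    then have "norm A * norm B * K \<le> a * b * K" using K by simp
    then show ?thesis using nK[of A B] by linarith
  qed
  have lip: "norm (T E z - T E z') \<le> 1/2 * norm (z - z')"
    if "norm E \<le> e" "norm z \<le> r" "norm z' \<le> r" for E z z'
  proof -
    define d where "d = norm (z - z')"
    have 1: "norm ((z - z') ** E) \<le> d / 16"
      using nrm[of "z - z'" d E e] that(1) by (simp add: d_def K')
    define Y where "Y = z ** (z - z') + (z - z') ** z'"
    have "norm (z ** (z - z')) \<le> d / 8" "norm ((z - z') ** z') \<le> d / 8"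
      using nrm[of z r "z - z'" d] nrm[of "z - z'" d z' r] that(2,3) by (simp_all add: d_def K')
    then have 2: "norm Y \<le> d / 4" unfolding Y_def by norm
    have 3: "norm (Y ** E) \<le> d / 64"
      using nrm[OF 2 that(1)] by (simp add: K')
    have "T E z - T E z' = (1/2) *\<^sub>R (2 *\<^sub>R ((z - z') ** E) + Y ** E - Y)"
      by (simp add: T_def Y_def matrix_ring_simps algebra_simps)
    then have "norm (T E z - T E z') = 1/2 * norm (2 *\<^sub>R ((z - z') ** E) + Y ** E - Y)" by simp
    also have "norm (2 *\<^sub>R ((z - z') ** E) + Y ** E - Y) \<le> 2 * norm ((z - z') ** E) + norm (Y ** E) + norm Y"
      by norm
    also have "\<dots> \<le> d" using 1 2 3 norm_ge_zero[of "z - z'"] unfolding d_def[symmetric] by linarith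
    finally show ?thesis by (simp add: d_def)
  qed
  have T0: "T E 0 = (1/2) *\<^sub>R E" for E by (simp add: T_def mm.zero_left)
  have small: "norm (T E z) < r" if "norm E < e" "norm z \<le> r" for E z
  proof -
    have "norm (T E z) \<le> norm (T E z - T E 0) + norm (T E 0)" by norm
    also have "\<dots> \<le> 1/2 * norm z + 1/2 * norm E" using lip[of E z 0] that r by (simp add: T0)
    also have "\<dots> < r" using that e by linarith
    finally show ?thesis .
  qed
  have ex: "\<exists>z. norm z < r \<and> T E z = z \<and> (\<forall>X. X ** E = E ** X \<longrightarrow> X ** z = z ** X)" if E: "norm E < e" for E
  proof -
    \<comment> \<open>The ball is cut down to the matrices commuting with the whole centraliser of
      \<open>E\<close>. This closed set is again stable under \<open>T E\<close>, so the fixed point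
      inherits the commutation.\<close>
    define A where "A = cball 0 r \<inter> (\<Inter>X\<in>{X. X ** E = E ** X}. {z. X ** z = z ** X})"
    have "closed A" unfolding A_def
      by (intro closed_Int closed_INT ballI closed_cball closed_Collect_eq continuous_intros
          mm.continuous_on)
    then have "complete A" by (simp add: complete_eq_closed)
    moreover have "A \<noteq> {}"
    proof -
      have "0 \<in> A" unfolding A_def using r by (simp add: mm.zero_left mm.zero_right)
      then show ?thesis by blast
    qed
    moreover have "T E ` A \<subseteq> A"
    proof (rule image_subsetI)
      fix z assume "z \<in> A"
      then have z: "norm z \<le> r" "\<forall>X. X ** E = E ** X \<longrightarrow> X ** z = z ** X"
        by (auto simp: A_def)
      have "X ** T E z = T E z ** X" if X: "X ** E = E ** X" for X
      proof -
        have "X ** z = z ** X" using z X by blast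
        then have z1: "X ** (z ** Y) = z ** (X ** Y)" for Y by (metis matrix_mul_assoc)
        have E1: "X ** (E ** Y) = E ** (X ** Y)" for Y using X by (metis matrix_mul_assoc)
        show ?thesis unfolding T_def by (simp add: matrix_ring_simps X \<open>X ** z = z ** X\<close> z1 E1)
      qed
      then show "T E z \<in> A"
        using small[OF E z(1)] by (auto simp: A_def)
    qed
    moreover have "dist (T E x) (T E y) \<le> 1/2 * dist x y" if "x \<in> A" "y \<in> A" for x y
      using lip[of E x y] that E by (simp add: A_def dist_norm)
    ultimately have "\<exists>!z\<in>A. T E z = z"
      by (intro Banach_fix[where c = "1/2"]) auto
    then obtain z where z: "z \<in> A" "T E z = z" by blast
    moreover have "norm z < r" using small[OF E, of z] z by (simp add: A_def)
    ultimately show ?thesis unfolding A_def by blast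
  qed
  define s where "s = (\<lambda>E. SOME z. norm z < r \<and> T E z = z \<and> (\<forall>X. X ** E = E ** X \<longrightarrow> X ** z = z ** X))"
  have s: "norm (s E) < r \<and> T E (s E) = s E \<and> (\<forall>X. X ** E = E ** X \<longrightarrow> X ** s E = s E ** X)"
    if "norm E < e" for E
    unfolding s_def using someI_ex[OF ex[OF that]] .
  have uniq: "z = s E" if "norm E < e" "norm z \<le> r" "T E z = z" for E z
  proof -
    have "norm (z - s E) \<le> 1/2 * norm (z - s E)"
      using lip[of E z "s E"] that s[of E] by simp
    then show ?thesis by simp
  qed
  \<comment> \<open>Perturbation of fixed points: half of the distance is absorbed by the
    contraction, the rest is the change of \<open>T\<close> at the fixed point
    \<open>z = s E'\<close>.\<close>
  have lipE: "norm (s E - s E') \<le> 2 * norm (E - E')" if "norm E < e" "norm E' < e" for E E'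
  proof -
    define z where "z = s E'"
    define d where "d = norm (E - E')"
    have z: "norm z \<le> r" using s[OF that(2)] by (simp add: z_def)
    have 1: "norm (z ** (E - E')) \<le> d / 8"
      using nrm[of z r "E - E'" d] z by (simp add: d_def K')
    have 2: "norm (z ** (z ** (E - E'))) \<le> d / 64"
      using nrm[OF z 1] by (simp add: K')
    have "T E z - T E' z = (1/2) *\<^sub>R (E - E' + 2 *\<^sub>R (z ** (E - E')) + z ** (z ** (E - E')))"
      by (simp add: T_def matrix_ring_simps algebra_simps)
    then have "norm (T E z - T E' z) = 1/2 * norm (E - E' + 2 *\<^sub>R (z ** (E - E')) + z ** (z ** (E - E')))"
      by simp
    also have "norm (E - E' + 2 *\<^sub>R (z ** (E - E')) + z ** (z ** (E - E'))) \<le>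
       norm (E - E') + 2 * norm (z ** (E - E')) + norm (z ** (z ** (E - E')))" by norm
    also have "\<dots> \<le> 2 * d" using 1 2 norm_ge_zero[of "E - E'"] unfolding d_def[symmetric] by linarith
    finally have 3: "norm (T E z - T E' z) \<le> d" by simp
    have 4: "norm (T E (s E) - T E z) \<le> 1/2 * norm (s E - z)"
      using lip[of E "s E" z] s[OF that(1)] z that by simp
    have "s E - s E' = (T E (s E) - T E z) + (T E z - T E' z)"
      using s[OF that(1)] s[OF that(2)] by (simp add: z_def)
    then have "norm (s E - s E') \<le> norm (T E (s E) - T E z) + norm (T E z - T E' z)"
      by (metis norm_triangle_ineq)
    then show ?thesis using 3 4 unfolding z_def d_def by linarith
  qed
  have "2-lipschitz_on (ball 0 e) s" using lipE by (intro lipschitz_onI) (auto simp: dist_norm)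
  then have "continuous_on (ball 0 e) s" by (rule lipschitz_on_continuous_on)
  then show ?thesis
    using that[of e r s] e(1) r(1) s uniq unfolding T_iff by blast
qed

subsection \<open>Connecting nearly anticommuting structures\<close>

definition anticommutator_defect :: "real^'m^'m \<Rightarrow> real^'m^'m \<Rightarrow> real^'m^'m" where
  "anticommutator_defect P J = (1/4) *\<^sub>R ((P ** J + J ** P) ** (P ** J + J ** P))"

text \<open>The commutator \<open>D = P J - J P\<close> anticommutes with \<open>P\<close> and \<open>J\<close>, and
  \<open>D\<^sup>2 = - 4 (1 - E)\<close> for the anticommutator defect \<open>E\<close>; so \<open>1 + z\<close>, an inverse
  square root of \<open>1 - E\<close>, normalises it.\<close>

lemma connector_structure:
  fixes P J z :: "real^'m^'m"
  assumes P: "P \<in> complex_structures" and J: "J \<in> complex_structures"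
  defines "E \<equiv> anticommutator_defect P J"
  assumes z: "(mat 1 + z) ** (mat 1 + z) ** (mat 1 - E) = mat 1"
    and comm: "\<And>X. X ** E = E ** X \<Longrightarrow> X ** z = z ** X"
  defines "M \<equiv> (1/2) *\<^sub>R ((P ** J - J ** P) ** (mat 1 + z))"
  shows "M \<in> complex_structures" "P ** M = - (M ** P)" "J ** M = - (M ** J)"
proof -
  note PJ = complex_structures_sq[OF P] complex_structures_sq[OF J]
  define D where "D = P ** J - J ** P"
  \<comment> \<open>\<open>P J + J P\<close> commutes with \<open>P\<close> and \<open>J\<close>:
    multiplying it by \<open>P\<close> on either side gives \<open>P J P - J\<close>, and
    symmetrically for \<open>J\<close>.\<close>
  have PE: "P ** E = E ** P" and JE: "J ** E = E ** J" and DE: "D ** E = E ** D"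
    unfolding E_def D_def anticommutator_defect_def by (simp_all add: matrix_ring_simps PJ)
  have DD: "D ** D = (- 4) *\<^sub>R (mat 1 - E)"
    unfolding E_def D_def anticommutator_defect_def
    by (simp add: matrix_ring_simps PJ) (simp add: vec_eq_iff)
  have PD: "P ** D = - (D ** P)" and JD: "J ** D = - (D ** J)"
    unfolding D_def by (simp_all add: matrix_ring_simps PJ)
  define N where "N = mat 1 + z"
  have N: "X ** N = N ** X" if "X ** E = E ** X" for X
    using comm[OF that] by (simp add: N_def matrix_ring_simps)
  have M: "M = (1/2) *\<^sub>R (D ** N)" by (simp add: M_def D_def N_def)
  have NE: "E ** N = N ** E" by (rule N) simp
  have "(D ** N) ** (D ** N) = D ** D ** (N ** N)"
    by (metis N[OF DE] matrix_mul_assoc)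
  also have "\<dots> = (- 4) *\<^sub>R ((mat 1 - E) ** (N ** N))" by (simp add: DD matrix_ring_simps)
  also have "(mat 1 - E) ** (N ** N) = N ** N ** (mat 1 - E)"
    by (simp add: matrix_ring_simps) (metis NE matrix_mul_assoc)
  also have "\<dots> = mat 1" using z by (simp add: N_def)
  finally have "M ** M = - mat 1" by (simp add: M matrix_ring_simps)
  then show "M \<in> complex_structures" by (simp add: complex_structures_def)
  have "P ** (D ** N) = - (D ** N ** P)"
    by (metis N[OF PE] PD matrix_mul_assoc mm.minus_left)
  then show "P ** M = - (M ** P)" by (simp add: M matrix_ring_simps)
  have "J ** (D ** N) = - (D ** N ** J)"
    by (metis N[OF JE] JD matrix_mul_assoc mm.minus_left)
  then show "J ** M = - (M ** J)" by (simp add: M matrix_ring_simps)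
qed

lemma tendsto_matrix_mult [tendsto_intros]:
  "(f \<longlongrightarrow> a) F \<Longrightarrow> (g \<longlongrightarrow> b) F \<Longrightarrow> ((\<lambda>x. f x ** g x) \<longlongrightarrow> a ** (b :: real^'m^'m)) F"
  by (rule mm.tendsto)

lemma continuous_on_matrix_mult [continuous_intros]:
  "continuous_on S f \<Longrightarrow> continuous_on S g \<Longrightarrow> continuous_on S (\<lambda>x. f x ** (g x :: real^'m^'m))"
  by (rule mm.continuous_on)

lemma conjugate_mult:
  fixes g h A B :: "real^'m^'m"
  assumes "h ** g = mat 1"
  shows "(g ** A ** h) ** (g ** B ** h) = g ** (A ** B) ** h"
proof -
  have "h ** (g ** X) = X" for X :: "real^'m^'m" by (simp add: matrix_mul_assoc assms)
  then show ?thesis by (simp add: matrix_mul_assoc[symmetric])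
qed

lemma conjugate_complex_structure:
  fixes g h :: "real^'m^'m"
  assumes "P \<in> complex_structures" "h ** g = mat 1"
  shows "g ** P ** h \<in> complex_structures"
proof -
  have "g ** h = mat 1" using assms(2) matrix_left_right_inverse by blast
  then show ?thesis using assms(1)
    by (simp add: complex_structures_def conjugate_mult[OF assms(2)] mm.minus_right mm.minus_left)
qed

text \<open>A germ at 0 of a curve in the centraliser of \<open>Q\<close>, with inverse
  \<open>h\<close>, tending to the identity. Conjugation by it gives small deformations that leave
  \<open>Q\<close> fixed.\<close>

definition near_identity :: "real^'m^'m \<Rightarrow> (real \<Rightarrow> real^'m^'m) \<Rightarrow> (real \<Rightarrow> real^'m^'m) \<Rightarrow> bool" where
  "near_identity Q g h \<longleftrightarrow> (g \<longlongrightarrow> mat 1) (at 0) \<and> (h \<longlongrightarrow> mat 1) (at 0) \<and>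
     (\<forall>\<^sub>F t in at 0. g t ** h t = mat 1 \<and> h t ** g t = mat 1 \<and> g t ** Q = Q ** g t)"

text \<open>The last clause is equivariance under the centraliser of \<open>P\<close>. It is
  asserted for small \<open>t\<close> only, because the norm is not invariant under conjugation and
  a conjugated inverse square root is recognised by uniqueness inside a fixed ball.\<close>

lemma connector_exists:
  obtains e :: real and conn :: "real^'m^'m \<Rightarrow> real^'m^'m \<Rightarrow> real^'m^'m" where
    "e > 0"
    "\<And>P J. \<lbrakk>P \<in> complex_structures; J \<in> complex_structures; norm (anticommutator_defect P J) < e\<rbrakk>
       \<Longrightarrow> conn P J \<in> complex_structures \<and> P ** conn P J = - (conn P J ** P) \<and> J ** conn P J = - (conn P J ** J)"
    "\<And>P. continuous_on {J. norm (anticommutator_defect P J) < e} (conn P)"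
    "\<And>P J g h. \<lbrakk>norm (anticommutator_defect P J) < e; near_identity P g h\<rbrakk>
       \<Longrightarrow> \<forall>\<^sub>F t in at 0. conn P (g t ** J ** h t) = g t ** conn P J ** h t"
proof -
  obtain e r :: real and s :: "real^'m^'m \<Rightarrow> real^'m^'m" where e: "e > 0" and r: "r > 0"
    and s1: "\<And>E. norm E < e \<Longrightarrow> norm (s E) < r"
    and s2: "\<And>E. norm E < e \<Longrightarrow> (mat 1 + s E) ** (mat 1 + s E) ** (mat 1 - E) = mat 1"
    and s3: "\<And>E X. norm E < e \<Longrightarrow> X ** E = E ** X \<Longrightarrow> X ** s E = s E ** X"
    and s4: "\<And>E z. norm E < e \<Longrightarrow> norm z \<le> r \<Longrightarrow> (mat 1 + z) ** (mat 1 + z) ** (mat 1 - E) = mat 1 \<Longrightarrow> z = s E"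
    and s5: "continuous_on (ball 0 e) s"
    by (rule matrix_inverse_sqrt) (rule that; assumption)
  define conn where "conn = (\<lambda>P J. (1/2) *\<^sub>R ((P ** J - J ** P) ** (mat 1 + s (anticommutator_defect P J))))"
  show thesis
  proof (rule that[of e conn])
    show "e > 0" by fact
  next
    fix P J :: "real^'m^'m"
    assume "P \<in> complex_structures" "J \<in> complex_structures" "norm (anticommutator_defect P J) < e"
    then show "conn P J \<in> complex_structures \<and> P ** conn P J = - (conn P J ** P) \<and> J ** conn P J = - (conn P J ** J)"
      using connector_structure[of P J "s (anticommutator_defect P J)"] s2 s3 unfolding conn_def by blast
  next
    fix P :: "real^'m^'m"
    have c: "continuous_on {J. norm (anticommutator_defect P J) < e} (anticommutator_defect P)"
      unfolding anticommutator_defect_def by (intro continuous_intros)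
    have "continuous_on {J. norm (anticommutator_defect P J) < e} (\<lambda>J. s (anticommutator_defect P J))"
      by (rule continuous_on_compose2[OF s5 c]) auto
    then show "continuous_on {J. norm (anticommutator_defect P J) < e} (conn P)"
      unfolding conn_def by (intro continuous_intros)
  next
    fix P J :: "real^'m^'m" and g h :: "real \<Rightarrow> real^'m^'m"
    define E where "E = anticommutator_defect P J"
    assume "norm (anticommutator_defect P J) < e" and gh: "near_identity P g h"
    then have E: "norm E < e" by (simp add: E_def)
    have lim: "((\<lambda>t. g t ** X ** h t) \<longlongrightarrow> X) (at 0)" for X
    proof -
      have "((\<lambda>t. g t ** X ** h t) \<longlongrightarrow> mat 1 ** X ** mat 1) (at 0)"
        using gh by (intro tendsto_intros) (auto simp: near_identity_def)
      then show ?thesis by simp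
    qed
    have "\<forall>\<^sub>F t in at 0. norm (g t ** E ** h t) < e"
      using order_tendstoD(2)[OF tendsto_norm[OF lim] E] .
    moreover have "\<forall>\<^sub>F t in at 0. norm (g t ** s E ** h t) < r"
      using order_tendstoD(2)[OF tendsto_norm[OF lim] s1[OF E]] .
    moreover have "\<forall>\<^sub>F t in at 0. g t ** h t = mat 1 \<and> h t ** g t = mat 1 \<and> g t ** P = P ** g t"
      using gh by (simp add: near_identity_def)
    ultimately show "\<forall>\<^sub>F t in at 0. conn P (g t ** J ** h t) = g t ** conn P J ** h t"
    proof eventually_elim
      case (elim t)
      define G H where "G = g t" and "H = h t"
      have GH: "G ** H = mat 1" "H ** G = mat 1" "G ** P = P ** G"
        and nE: "norm (G ** E ** H) < e" and nr: "norm (G ** s E ** H) \<le> r"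
        using elim by (simp_all add: G_def H_def)
      note cm = conjugate_mult[OF GH(2)]
      have PP: "G ** P ** H = P"
        using GH by (simp add: matrix_mul_assoc[symmetric])
      have PJ: "P ** (G ** J ** H) = G ** (P ** J) ** H" "(G ** J ** H) ** P = G ** (J ** P) ** H"
        using cm[of P J] cm[of J P] PP by auto
      have E': "anticommutator_defect P (G ** J ** H) = G ** E ** H"
        unfolding anticommutator_defect_def E_def PJ
        by (simp add: mm.add_left[symmetric] mm.add_right[symmetric] cm mm.scaleR_left mm.scaleR_right)
      have cadd: "mat 1 + G ** X ** H = G ** (mat 1 + X) ** H" "mat 1 - G ** X ** H = G ** (mat 1 - X) ** H" for X
        using GH by (simp_all add: mm.add_left mm.add_right mm.diff_left mm.diff_right)
      have "(mat 1 + G ** s E ** H) ** (mat 1 + G ** s E ** H) ** (mat 1 - G ** E ** H) = mat 1"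
        unfolding cadd cm s2[OF E] using GH by simp
      then have "s (G ** E ** H) = G ** s E ** H" using s4[OF nE nr] by simp
      then have "conn P (G ** J ** H) = (1/2) *\<^sub>R ((G ** (P ** J) ** H - G ** (J ** P) ** H) ** (mat 1 + G ** s E ** H))"
        unfolding conn_def E' PJ by simp
      also have "\<dots> = G ** conn P J ** H"
        unfolding cadd mm.diff_left[symmetric] mm.diff_right[symmetric] cm
        by (simp add: conn_def E_def mm.scaleR_left mm.scaleR_right)
      finally show ?case by (simp add: G_def H_def)
    qed
  qed
qed

text \<open>Squaring the inverse square root of \<open>1 - E\<close> gives its inverse, with
  continuous dependence on \<open>E\<close>.\<close>

lemma matrix_inverse_near_identity:
  obtains e :: real and v :: "real^'m^'m \<Rightarrow> real^'m^'m" where "e > 0"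
    "\<And>E. norm E < e \<Longrightarrow> (mat 1 - E) ** v E = mat 1 \<and> v E ** (mat 1 - E) = mat 1"
    "continuous_on (ball 0 e) v"
proof -
  obtain e r :: real and s :: "real^'m^'m \<Rightarrow> real^'m^'m" where e: "e > 0"
    and s2: "\<And>E. norm E < e \<Longrightarrow> (mat 1 + s E) ** (mat 1 + s E) ** (mat 1 - E) = mat 1"
    and s5: "continuous_on (ball 0 e) s"
    by (rule matrix_inverse_sqrt) (rule that; assumption)
  show thesis
  proof (rule that[of e "\<lambda>E. (mat 1 + s E) ** (mat 1 + s E)"])
    show "continuous_on (ball 0 e) (\<lambda>E. (mat 1 + s E) ** (mat 1 + s E))"
      by (intro continuous_intros s5)
  qed (use e s2 matrix_left_right_inverse in blast)+
qed

lemma near_identity_affine: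
  fixes A Q :: "real^'m^'m"
  assumes "A ** Q = Q ** A"
  obtains h where "near_identity Q (\<lambda>t. mat 1 + t *\<^sub>R A) h"
proof -
  obtain e :: real and v :: "real^'m^'m \<Rightarrow> real^'m^'m" where e: "e > 0"
    and v: "\<And>E. norm E < e \<Longrightarrow> (mat 1 - E) ** v E = mat 1 \<and> v E ** (mat 1 - E) = mat 1"
    and cv: "continuous_on (ball 0 e) v"
    by (rule matrix_inverse_near_identity) (rule that; assumption)
  define h where "h = (\<lambda>t. v (- t *\<^sub>R A))"
  have l: "((\<lambda>t. - t *\<^sub>R A) \<longlongrightarrow> 0) (at 0)"
    using tendsto_scaleR[OF tendsto_minus[OF tendsto_ident_at[of 0 UNIV]] tendsto_const[of A]] by simp
  have "isCont v 0" using cv e by (simp add: continuous_on_eq_continuous_at)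
  then have "(h \<longlongrightarrow> v 0) (at 0)" unfolding h_def using isCont_tendsto_compose l by blast
  moreover have "v 0 = mat 1" using v[of 0] e by simp
  moreover have "((\<lambda>t. mat 1 + t *\<^sub>R A) \<longlongrightarrow> mat 1) (at 0)"
    using tendsto_diff[OF tendsto_const[of "mat 1"] l] by simp
  moreover have "\<forall>\<^sub>F t in at 0. norm (- t *\<^sub>R A) < e"
    using order_tendstoD(2)[OF tendsto_norm[OF l], of e] e by simp
  then have "\<forall>\<^sub>F t in at 0. (mat 1 + t *\<^sub>R A) ** h t = mat 1 \<and> h t ** (mat 1 + t *\<^sub>R A) = mat 1
       \<and> (mat 1 + t *\<^sub>R A) ** Q = Q ** (mat 1 + t *\<^sub>R A)"
  proof eventually_elim
    case (elim t)
    then show ?case using v[of "- t *\<^sub>R A"] assms by (simp add: h_def matrix_ring_simps)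
  qed
  ultimately have "near_identity Q (\<lambda>t. mat 1 + t *\<^sub>R A) h" by (simp add: near_identity_def)
  then show ?thesis by (rule that)
qed

subsection \<open>Invariant forms\<close>

definition alternating_form :: "(real^'m \<Rightarrow> real^'m \<Rightarrow> real) \<Rightarrow> bool" where
  "alternating_form \<Omega> \<longleftrightarrow> bilinear \<Omega> \<and> (\<forall>x. \<Omega> x x = 0) \<and> (\<exists>x y. \<Omega> x y \<noteq> 0)"

definition preserves :: "real^'m^'m \<Rightarrow> (real^'m \<Rightarrow> real^'m \<Rightarrow> real) \<Rightarrow> bool" where
  "preserves M \<Omega> \<longleftrightarrow> (\<forall>x y. \<Omega> (M *v x) (M *v y) = \<Omega> x y)"

lemma bilinear_skew:
  fixes \<Omega> :: "real^'m \<Rightarrow> real^'m \<Rightarrow> real"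
  assumes "bilinear \<Omega>" "\<forall>x. \<Omega> x x = 0"
  shows "\<Omega> y x = - \<Omega> x y"
proof -
  have "\<Omega> (x + y) (x + y) = \<Omega> x x + \<Omega> x y + \<Omega> y x + \<Omega> y y"
    by (simp add: bilinear_ladd[OF assms(1)] bilinear_radd[OF assms(1)])
  then show ?thesis using assms(2) by simp
qed

lemma complex_structure_vector:
  "P \<in> complex_structures \<Longrightarrow> P *v (P *v x) = - x"
  by (metis complex_structures_sq(1) matrix_minus_vector_mult matrix_vector_mul_assoc matrix_vector_mul_lid)

text \<open>Replacing \<open>y\<close> by \<open>M y\<close> turns invariance into skewness, which
  is linear in \<open>M\<close>. A conjugation of \<open>M\<close> can then be moved onto the form
  without an inverse matrix appearing.\<close>

lemma preserves_iff:
  fixes \<Omega> :: "real^'m \<Rightarrow> real^'m \<Rightarrow> real"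
  assumes "bilinear \<Omega>" "M \<in> complex_structures"
  shows "preserves M \<Omega> \<longleftrightarrow> (\<forall>x y. \<Omega> (M *v x) y + \<Omega> x (M *v y) = 0)"
proof
  assume p: "preserves M \<Omega>"
  show "\<forall>x y. \<Omega> (M *v x) y + \<Omega> x (M *v y) = 0"
  proof (intro allI)
    fix x y
    have "\<Omega> (M *v x) (M *v (M *v y)) = \<Omega> x (M *v y)" using p by (simp add: preserves_def)
    then show "\<Omega> (M *v x) y + \<Omega> x (M *v y) = 0"
      using assms by (simp add: complex_structure_vector bilinear_rneg)
  qed
next
  assume p: "\<forall>x y. \<Omega> (M *v x) y + \<Omega> x (M *v y) = 0"
  show "preserves M \<Omega>" unfolding preserves_def
  proof (intro allI)
    fix x y
    show "\<Omega> (M *v x) (M *v y) = \<Omega> x y"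
      using p[rule_format, of x "M *v y"] assms by (simp add: complex_structure_vector bilinear_rneg)
  qed
qed

lemma linear_matrix_vector [simp]: "linear ((*v) (A :: real^'m^'m))"
  by (rule matrix_vector_mul_linear)

lemma matrix_with_values:
  fixes B :: "(real^'m) set" and f :: "real^'m \<Rightarrow> real^'m"
  assumes "independent B"
  obtains A :: "real^'m^'m" where "\<And>b. b \<in> B \<Longrightarrow> A *v b = f b"
proof -
  obtain g where "linear g" "\<forall>b\<in>B. g b = f b" using linear_independent_extend[OF assms] by blast
  then show ?thesis using that[of "matrix g"] by (metis matrix_vector_mul(2))
qed

lemma matrix_eq_on_span:
  fixes A C :: "real^'m^'m"
  assumes "\<And>b. b \<in> B \<Longrightarrow> A *v b = C *v b" "x \<in> span B"
  shows "A *v x = C *v x"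
  using linear_eq_on_span[of "(*v) A" "(*v) C" B x] assms by simp

lemma matrix_span_invariant:
  fixes A :: "real^'m^'m"
  assumes "\<And>b. b \<in> B \<Longrightarrow> A *v b \<in> span B'" "x \<in> span B"
  shows "A *v x \<in> span B'"
proof -
  have "A *v x \<in> (*v) A ` span B" using assms(2) by blast
  also have "\<dots> = span ((*v) A ` B)" by (simp add: linear_span_image)
  also have "\<dots> \<subseteq> span B'" using assms(1) by (intro span_minimal) auto
  finally show ?thesis .
qed

text \<open>If \<open>Q v\<close> were \<open>k v\<close> plus an element of the span, applying
  \<open>Q\<close> again would put \<open>(1 + k^2) v\<close> into the span. Bases stable under
  \<open>Q\<close> thus grow by pairs \<open>v\<close>, \<open>Q v\<close>.\<close>

lemma insert_complex_pair:
  fixes Q :: "real^'m^'m"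
  assumes Q: "Q \<in> complex_structures" and B: "independent B" "\<And>b. b \<in> B \<Longrightarrow> Q *v b \<in> span B"
    and v: "v \<notin> span B"
  defines "B' \<equiv> insert (Q *v v) (insert v B)"
  shows "independent B'" "Q *v v \<notin> span (insert v B)" "v \<notin> B" "Q *v v \<noteq> v" "Q *v v \<notin> B"
    "\<And>b. b \<in> B' \<Longrightarrow> Q *v b \<in> span B'"
proof -
  note QQ = complex_structure_vector[OF Q]
  show Qv: "Q *v v \<notin> span (insert v B)"
  proof
    assume "Q *v v \<in> span (insert v B)"
    then obtain k where k: "Q *v v - k *\<^sub>R v \<in> span B" by (auto simp: span_insert)
    have "Q *v (Q *v v - k *\<^sub>R v) \<in> span B" using matrix_span_invariant[OF B(2) k] .
    then have 1: "- v - k *\<^sub>R (Q *v v) \<in> span B"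
      by (simp add: matrix_vector_mult_diff_distrib QQ matrix_vector_mult_scaleR)
    have "- v - k *\<^sub>R (Q *v v) + k *\<^sub>R (Q *v v - k *\<^sub>R v) \<in> span B"
      using 1 k by (intro span_add span_scale)
    also have "- v - k *\<^sub>R (Q *v v) + k *\<^sub>R (Q *v v - k *\<^sub>R v) = (- (1 + k * k)) *\<^sub>R v"
      by (simp add: algebra_simps)
    finally have "inverse (- (1 + k * k)) *\<^sub>R (- (1 + k * k)) *\<^sub>R v \<in> span B" by (rule span_scale)
    moreover have "- (1 + k * k) \<noteq> 0" by (smt (verit) zero_le_square)
    ultimately show False using v by simp
  qed
  show "independent B'"
    unfolding B'_def using Qv v B by (intro independent_insertI)
  show "v \<notin> B" using v span_base by blast
  show "Q *v v \<noteq> v" "Q *v v \<notin> B" using Qv span_base by (metis insertCI)+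
  show "Q *v b \<in> span B'" if bB: "b \<in> B'" for b
  proof -
    consider "b \<in> B" | "b = v" | "b = Q *v v" using bB by (auto simp: B'_def)
    then show ?thesis
    proof cases
      case 1
      have "span B \<subseteq> span B'" by (intro span_mono) (auto simp: B'_def)
      then show ?thesis using B(2)[OF 1] by blast
    next
      case 2
      then show ?thesis by (simp add: B'_def span_base)
    next
      case 3
      then show ?thesis by (simp add: B'_def QQ span_base span_neg)
    qed
  qed
qed

text \<open>With \<open>Q\<close> as imaginary unit, \<open>M\<close> is antilinear with square
  \<open>-1\<close>, so \<open>x\<close> and \<open>M x\<close> are independent over the complex
  numbers and a complex linear map can take any values there.\<close>

lemma exists_commuting_matrix:
  fixes Q M :: "real^'m^'m"
  assumes Q: "Q \<in> complex_structures" and M: "M \<in> complex_structures" and QM: "Q ** M = - (M ** Q)"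
    and x: "x \<noteq> 0"
  obtains g where "g ** Q = Q ** g" "g *v x = u" "g *v (M *v x) = w"
proof -
  note QQ = complex_structure_vector[OF Q] and MM = complex_structure_vector[OF M]
  have MQ: "M *v (Q *v y) = - (Q *v (M *v y))" for y
    by (metis QM matrix_minus_vector_mult matrix_vector_mul_assoc minus_minus)
  define B where "B = {Q *v x, x}"
  note B = insert_complex_pair[OF Q, of "{}" x, folded B_def]
  have B1: "independent B" "\<And>b. b \<in> B \<Longrightarrow> Q *v b \<in> span B" "Q *v x \<noteq> x"
    using B x independent_empty by auto
  have v: "M *v x \<notin> span B"
  proof
    assume "M *v x \<in> span B"
    then obtain a b where ab: "M *v x = b *\<^sub>R x + a *\<^sub>R (Q *v x)"
      unfolding B_def span_insert span_empty by (auto simp: algebra_simps)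
    have "- x = M *v (b *\<^sub>R x + a *\<^sub>R (Q *v x))" by (simp add: ab[symmetric] MM)
    also have "\<dots> = b *\<^sub>R (M *v x) - a *\<^sub>R (Q *v (M *v x))"
      by (simp add: matrix_vector_right_distrib matrix_vector_mult_scaleR MQ)
    also have "\<dots> = (b * b + a * a) *\<^sub>R x"
      by (simp add: ab matrix_vector_right_distrib matrix_vector_mult_scaleR QQ algebra_simps)
    finally have "x + (b * b + a * a) *\<^sub>R x = 0" by (metis add.right_inverse)
    then have "(1 + (b * b + a * a)) *\<^sub>R x = 0" by (simp only: scaleR_add_left scaleR_one)
    moreover have "1 + (b * b + a * a) \<noteq> 0" by (smt (verit) zero_le_square)
    ultimately show False using x by simp
  qed
  define B' where "B' = insert (Q *v (M *v x)) (insert (M *v x) B)"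
  note B' = insert_complex_pair[OF Q B1(1,2) v, folded B'_def]
  define f where "f = (\<lambda>b. if b = x then u else if b = Q *v x then Q *v u else if b = M *v x then w else Q *v w)"
  obtain T :: "real^'m^'m" where T: "\<And>b. b \<in> B' \<Longrightarrow> T *v b = f b"
    using matrix_with_values[OF B'(1)] by blast
  have T1: "T *v x = u" using T[of x] by (simp add: B'_def B_def f_def)
  have T2: "T *v (Q *v x) = Q *v u" using T[of "Q *v x"] B1(3) by (simp add: B'_def B_def f_def)
  have T3: "T *v (M *v x) = w" using T[of "M *v x"] B'(3) by (auto simp: B'_def B_def f_def)
  have T4: "T *v (Q *v (M *v x)) = Q *v w"
    using T[of "Q *v (M *v x)"] B'(4,5) by (auto simp: B'_def B_def f_def)
  \<comment> \<open>The average of \<open>T\<close> and its conjugate by \<open>Q\<close>, whose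
    inverse is \<open>- Q\<close>: the complex linear part of \<open>T\<close>. The prescribed
    values survive because \<open>T\<close> was made compatible with \<open>Q\<close> on
    them.\<close>
  define g where "g = (1/2) *\<^sub>R (T - Q ** T ** Q)"
  have gv: "g *v y = (1/2) *\<^sub>R (T *v y - Q *v (T *v (Q *v y)))" for y
    by (simp add: g_def scaleR_matrix_vector_assoc[symmetric] matrix_vector_mult_diff_rdistrib
        matrix_vector_mul_assoc[symmetric])
  show ?thesis
  proof (rule that)
    show "g ** Q = Q ** g"
      by (simp add: g_def matrix_ring_simps complex_structures_sq[OF Q])
    show "g *v x = u" by (simp add: gv T1 T2 QQ scaleR_2[symmetric])
    show "g *v (M *v x) = w" by (simp add: gv T3 T4 QQ scaleR_2[symmetric])
  qed
qed

text \<open>The expression measures how far \<open>M\<close> is from being skew for the form pulled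
  back by \<open>g\<close>, which may be singular. It is quadratic in \<open>g\<close>; if it
  vanished on the whole centraliser, a linear space, so would its polarisation, and prescribing
  values at \<open>x\<close> and \<open>M x\<close> would force \<Omega> to vanish.\<close>

lemma exists_breaking_matrix:
  fixes Q M :: "real^'m^'m"
  assumes Q: "Q \<in> complex_structures" and M: "M \<in> complex_structures" and QM: "Q ** M = - (M ** Q)"
    and Om: "alternating_form \<Omega>"
  obtains g x y where "g ** Q = Q ** g" "\<Omega> (g *v (M *v x)) (g *v y) + \<Omega> (g *v x) (g *v (M *v y)) \<noteq> 0"
proof (rule ccontr)
  assume neg: "\<not> thesis"
  note breaking = that
  note QQ = complex_structure_vector[OF Q] and MM = complex_structure_vector[OF M]
  have bl: "bilinear \<Omega>" and skew: "\<Omega> y x = - \<Omega> x y" for x y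
    using Om bilinear_skew by (auto simp: alternating_form_def)
  note bs = bilinear_ladd[OF bl] bilinear_radd[OF bl] bilinear_lneg[OF bl] bilinear_rneg[OF bl]
    bilinear_lzero[OF bl] bilinear_rzero[OF bl]
  define b where "b = (\<lambda>g h x y. \<Omega> (g *v (M *v x)) (h *v y) + \<Omega> (g *v x) (h *v (M *v y)))"
  have zero: "b g g x y = 0" if "g ** Q = Q ** g" for g x y
    using neg breaking[of g x y] that unfolding b_def by blast
  have polar: "b g h x y + b h g x y = 0" if "g ** Q = Q ** g" "h ** Q = Q ** h" for g h x y
  proof -
    have "b (g + h) (g + h) x y = b g g x y + b h h x y + (b g h x y + b h g x y)"
      by (simp add: b_def matrix_vector_mult_add_rdistrib bs)
    moreover have "(g + h) ** Q = Q ** (g + h)" using that by (simp add: matrix_ring_simps)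
    ultimately show ?thesis using zero that by simp
  qed
  obtain x :: "real^'m" where x: "x \<noteq> 0" by (metis (full_types) zero_neq_one one_neq_zero)
  have gQ: "g *v (Q *v y) = Q *v (g *v y)" if "g ** Q = Q ** g" for g y
    by (metis that matrix_vector_mul_assoc)
  have MQ: "M *v (Q *v y) = - (Q *v (M *v y))" for y
    by (metis QM matrix_minus_vector_mult matrix_vector_mul_assoc minus_minus)
  have neg_mult: "g *v (- y) = - (g *v y)" for g :: "real^'m^'m" and y
    by (metis linear_neg linear_matrix_vector)
  have "\<Omega> w (Q *v u) = 0" for u w
  proof -
    obtain g where g: "g ** Q = Q ** g" "g *v x = u" "g *v (M *v x) = 0"
      by (rule exists_commuting_matrix[OF Q M QM x, of u 0]) (rule that)
    obtain h where h: "h ** Q = Q ** h" "h *v x = 0" "h *v (M *v x) = w"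
      by (rule exists_commuting_matrix[OF Q M QM x, of 0 w]) (rule that)
    obtain k where k: "k ** Q = Q ** k" "k *v x = w" "k *v (M *v x) = 0"
      by (rule exists_commuting_matrix[OF Q M QM x, of w 0]) (rule that)
    \<comment> \<open>The two evaluations give \<open>\<Omega> w (Q u) = \<Omega> u (Q w)\<close>
      and \<open>\<Omega> w (Q u) = - \<Omega> u (Q w)\<close>.\<close>
    have "- \<Omega> u (Q *v w) + \<Omega> w (Q *v u) = 0"
      using polar[OF g(1) h(1), of x "Q *v x"]
      by (simp add: b_def gQ[OF g(1)] gQ[OF h(1)] g h MQ neg_mult bs)
    moreover have "\<Omega> u (Q *v w) + \<Omega> w (Q *v u) = 0"
      using polar[OF g(1) k(1), of x "Q *v (M *v x)"]
      by (simp add: b_def gQ[OF g(1)] gQ[OF k(1)] g k MQ MM neg_mult bs)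
    ultimately show ?thesis by simp
  qed
  then have "\<Omega> w (Q *v (Q *v u)) = 0" for u w by blast
  then have "\<Omega> w u = 0" for u w by (simp add: QQ bs)
  then show False using Om by (simp add: alternating_form_def)
qed

lemma eventually_quadratic_nonzero:
  fixes a b c :: real
  assumes "a + b + c \<noteq> 0"
  shows "\<forall>\<^sub>F t in at 0. a + b * t + c * t\<^sup>2 \<noteq> 0"
proof -
  define F where "F = {t. poly [:a, b, c:] t = 0}"
  have "[:a, b, c:] \<noteq> 0" using assms by auto
  then have "finite F" unfolding F_def by (rule poly_roots_finite)
  then have "\<forall>\<^sub>F t in at 0. \<forall>s\<in>F. t \<noteq> s"
    by (simp add: eventually_ball_finite eventually_neq_at_within)
  then show ?thesis
    by eventually_elim (auto simp: F_def algebra_simps power2_eq_square)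
qed

text \<open>The curve is the affine line from the identity to the breaking matrix \<open>G\<close>,
  reached at \<open>t = 1\<close>. The obstruction along it is a polynomial of degree at most 2,
  nonzero at 1, hence nonzero for all small \<open>t \<noteq> 0\<close>, where the matrices are also
  invertible.\<close>

lemma eventually_not_preserves:
  fixes Q M :: "real^'m^'m"
  assumes Q: "Q \<in> complex_structures" and M: "M \<in> complex_structures" and QM: "Q ** M = - (M ** Q)"
    and Om: "alternating_form \<Omega>"
  obtains g h where "near_identity Q g h" "\<forall>\<^sub>F t in at 0. \<not> preserves (g t ** M ** h t) \<Omega>"
proof -
  obtain G x y where G: "G ** Q = Q ** G"
    and xy: "\<Omega> (G *v (M *v x)) (G *v y) + \<Omega> (G *v x) (G *v (M *v y)) \<noteq> 0"
    by (rule exists_breaking_matrix[OF Q M QM Om])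
  have bl: "bilinear \<Omega>" using Om by (simp add: alternating_form_def)
  define A where "A = G - mat 1"
  define g where "g = (\<lambda>t. mat 1 + t *\<^sub>R A)"
  have "A ** Q = Q ** A" using G by (simp add: A_def matrix_ring_simps)
  then obtain h where gh: "near_identity Q g h" unfolding g_def by (rule near_identity_affine)
  have gv: "g t *v v = v + t *\<^sub>R (A *v v)" for t v
    by (simp add: g_def matrix_vector_mult_add_rdistrib scaleR_matrix_vector_assoc)
  note bs = bilinear_ladd[OF bl] bilinear_radd[OF bl] bilinear_lmul[OF bl] bilinear_rmul[OF bl]
  define q where "q = (\<lambda>t. \<Omega> (g t *v (M *v x)) (g t *v y) + \<Omega> (g t *v x) (g t *v (M *v y)))"
  define a where "a = \<Omega> (M *v x) y + \<Omega> x (M *v y)"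
  define b where "b = \<Omega> (A *v (M *v x)) y + \<Omega> (M *v x) (A *v y) + \<Omega> (A *v x) (M *v y) + \<Omega> x (A *v (M *v y))"
  define c where "c = \<Omega> (A *v (M *v x)) (A *v y) + \<Omega> (A *v x) (A *v (M *v y))"
  have q: "q t = a + b * t + c * t\<^sup>2" for t
    unfolding q_def gv bs a_def b_def c_def by (simp add: algebra_simps power2_eq_square)
  have "g 1 = G" by (simp add: g_def A_def)
  then have "q 1 \<noteq> 0" using xy by (simp add: q_def)
  then have "\<forall>\<^sub>F t in at 0. q t \<noteq> 0"
    unfolding q by (intro eventually_quadratic_nonzero) simp
  moreover have "\<forall>\<^sub>F t in at 0. g t ** h t = mat 1 \<and> h t ** g t = mat 1 \<and> g t ** Q = Q ** g t"
    using gh by (simp add: near_identity_def)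
  ultimately have "\<forall>\<^sub>F t in at 0. \<not> preserves (g t ** M ** h t) \<Omega>"
  proof eventually_elim
    case (elim t)
    have hg: "h t *v (g t *v v) = v" for v using elim by (simp add: matrix_vector_mul_assoc)
    have "g t ** M ** h t \<in> complex_structures" using conjugate_complex_structure[OF M] elim by blast
    then show ?case using elim(1)
      unfolding preserves_iff[OF bl \<open>g t ** M ** h t \<in> complex_structures\<close>] q_def
      by (metis hg matrix_vector_mul_assoc)
  qed
  with gh show ?thesis by (rule that)
qed

section \<open>Rational forms, Baire's theorem and anticommuting partners\<close>

abbreviation lattice_forms :: "(real^'m) set \<Rightarrow> (real^'m \<Rightarrow> real^'m \<Rightarrow> real) set" where
  "lattice_forms \<Gamma> \<equiv> {\<Omega>. alternating_form \<Omega> \<and> (\<forall>x\<in>\<Gamma>. \<forall>y\<in>\<Gamma>. \<Omega> x y \<in> \<rat>)}"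

text \<open>A bilinear form is determined by its values on pairs of basis vectors; these lie in the
  lattice, so the values are rational.\<close>

lemma alternating_forms_countable:
  assumes "full_lattice \<Gamma>"
  shows "countable (lattice_forms \<Gamma>)" (is "countable ?F")
proof -
  obtain B where B: "independent B" "span B = UNIV"
    and \<Gamma>: "\<Gamma> = range (\<lambda>c::_ \<Rightarrow> int. \<Sum>b\<in>B. of_int (c b) *\<^sub>R b)"
    using assms by (auto simp: full_lattice_def)
  have finB: "finite B" using B(1) independent_imp_finite by blast
  have "b \<in> \<Gamma>" if "b \<in> B" for b
  proof -
    have "(\<Sum>b'\<in>B. of_int (if b' = b then 1 else 0) *\<^sub>R b') = (\<Sum>b'\<in>B. if b' = b then b' else 0)"
      by (intro sum.cong) auto
    also have "\<dots> = b" using that finB by (simp add: sum.delta')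
    finally show ?thesis unfolding \<Gamma>
      by (intro range_eqI[where x = "\<lambda>b'. if b' = b then 1 else 0"]) (rule sym)
  qed
  define f where "f = (\<lambda>\<Omega>::_ \<Rightarrow> _ \<Rightarrow> real. restrict (\<lambda>(b,c). \<Omega> b c) (B \<times> B))"
  have "inj_on f ?F"
  proof (rule inj_onI)
    fix \<Omega> \<Omega>' assume O: "\<Omega> \<in> ?F" "\<Omega>' \<in> ?F" and eq: "f \<Omega> = f \<Omega>'"
    have "\<Omega> b c = \<Omega>' b c" if "b \<in> B" "c \<in> B" for b c
      using fun_cong[OF eq, of "(b, c)"] that by (simp add: f_def)
    then have "\<Omega> x y = \<Omega>' x y" for x y
      using O B by (intro bilinear_eq[of \<Omega> \<Omega>' UNIV B UNIV B x y]) (auto simp: alternating_form_def)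
    then show "\<Omega> = \<Omega>'" by blast
  qed
  moreover have "countable (f ` ?F)"
  proof (rule countable_subset)
    show "f ` ?F \<subseteq> (\<Pi>\<^sub>E _\<in>B \<times> B. \<rat>)"
      using \<open>\<And>b. b \<in> B \<Longrightarrow> b \<in> \<Gamma>\<close> by (auto simp: f_def split: if_splits)
    show "countable (\<Pi>\<^sub>E _\<in>B \<times> B. \<rat> :: real set)"
      using finB by (intro countable_PiE) (auto simp: countable_rat)
  qed
  ultimately show ?thesis by (rule countable_image_inj_on[rotated])
qed

lemma generic_period_iff:
  "generic_period \<Gamma> I \<longleftrightarrow> I \<in> complex_structures \<and>
     (\<forall>\<Omega>\<in>lattice_forms \<Gamma>. \<not> preserves I \<Omega>)"
  unfolding generic_period_def alternating_form_def preserves_def Ball_def mem_Collect_eq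
  by (simp only: not_ex not_all de_Morgan_conj imp_conv_disj disj_assoc)

lemma closed_complex_structures: "closed (complex_structures :: (real^'m^'m) set)"
  unfolding complex_structures_def by (intro closed_Collect_eq continuous_intros)

lemma Baire_avoid:
  fixes S :: "'a::{real_normed_vector,heine_borel} set"
  assumes S: "closed S" and U: "openin (top_of_set S) U" "U \<noteq> {}" and c: "countable \<B>"
    and B: "\<And>B. B \<in> \<B> \<Longrightarrow> openin (top_of_set S) (U - B) \<and> U \<subseteq> closure (U - B)"
  obtains x where "x \<in> U" "\<And>B. B \<in> \<B> \<Longrightarrow> x \<notin> B"
proof -
  \<comment> \<open>Baire's theorem concerns open dense subsets of all of \<open>S\<close>; adding
    the exterior of \<open>U\<close> makes \<open>U - B\<close> dense in \<open>S\<close>.\<close>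
  define G where "G = (\<lambda>B. (S - closure U) \<union> (U - B))"
  have US: "U \<subseteq> S" using U openin_imp_subset by blast
  have "openin (top_of_set S) (G B) \<and> S \<subseteq> closure (G B)" if "B \<in> \<B>" for B
  proof
    show "openin (top_of_set S) (G B)"
      unfolding G_def using B[OF that]
      by (intro openin_Un) (auto simp: openin_open intro!: exI[of _ "- closure U"])
    have "closure U \<subseteq> closure (U - B)" using B[OF that] by (simp add: closure_minimal)
    then show "S \<subseteq> closure (G B)" unfolding G_def closure_Un using closure_subset by blast
  qed
  then have "S \<subseteq> closure (\<Inter>(G ` \<B>))" using c S by (intro Baire) auto
  then have dense: "U \<subseteq> closure (\<Inter>(G ` \<B>))" using US by blast
  obtain V where V: "open V" "U = S \<inter> V" using U by (auto simp: openin_open)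
  obtain u where "u \<in> U" using U by blast
  have "V \<inter> \<Inter>(G ` \<B>) \<noteq> {}"
    using dense \<open>u \<in> U\<close> V open_Int_closure_eq_empty[OF V(1)] by blast
  then obtain y where y: "y \<in> V" "\<And>B. B \<in> \<B> \<Longrightarrow> y \<in> G B" by auto
  show ?thesis
  proof (cases "\<B> = {}")
    \<comment> \<open>For an empty family the intersection is the universe, so \<open>y\<close> need
      not lie in \<open>S\<close>; any point of \<open>U\<close> serves.\<close>
    case True
    then show ?thesis using that \<open>u \<in> U\<close> by blast
  next
    case False
    then have "y \<in> U" using y V US unfolding G_def by blast
    moreover have "y \<notin> B" if "B \<in> \<B>" for B
      using y(2)[OF that] closure_subset \<open>y \<in> U\<close> unfolding G_def by blast
    ultimately show ?thesis using that by blast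
  qed
qed

text \<open>\<open>c X\<close> is a joint produced from \<open>X\<close>. Openness comes from
  continuity of \<open>c\<close>, density from deforming \<open>X\<close> by the centraliser of
  \<open>Q\<close>, which carries \<open>c X\<close> along. \<open>Q\<close> may depend on
  \<open>X\<close>: for the identity map any structure anticommuting with \<open>X\<close> will
  do.\<close>

lemma preserving_set_nowhere_dense:
  fixes U :: "(real^'m^'m) set" and c :: "real^'m^'m \<Rightarrow> real^'m^'m"
  assumes Om: "alternating_form \<Omega>" and U: "openin (top_of_set complex_structures) U"
    and c: "continuous_on U c"
    and cU: "\<And>X. X \<in> U \<Longrightarrow> c X \<in> complex_structures"
    and Q: "\<And>X. X \<in> U \<Longrightarrow> \<exists>Q\<in>complex_structures. Q ** c X = - (c X ** Q) \<and>
       (\<forall>g h. near_identity Q g h \<longrightarrow> (\<forall>\<^sub>F t in at 0. c (g t ** X ** h t) = g t ** c X ** h t))"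
  defines "B \<equiv> {X \<in> U. preserves (c X) \<Omega>}"
  shows "openin (top_of_set complex_structures) (U - B) \<and> U \<subseteq> closure (U - B)"
proof
  have bl: "bounded_bilinear \<Omega>"
    using Om by (simp add: alternating_form_def bilinear_conv_bounded_bilinear)
  have mv: "continuous_on UNIV (\<lambda>M::real^'m^'m. M *v x)" for x
    by (intro linear_continuous_on linear_conv_bounded_linear[THEN iffD1] linearI)
      (simp_all add: matrix_vector_mult_add_rdistrib scaleR_matrix_vector_assoc)
  have "closed {M. preserves M \<Omega>}"
    unfolding preserves_def
    by (intro closed_Collect_all closed_Collect_eq bounded_bilinear.continuous_on[OF bl] mv continuous_on_const)
  then have "closedin (top_of_set U) (U \<inter> c -` {M. preserves M \<Omega>})"
    by (rule continuous_closedin_preimage[OF c])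
  moreover have "U \<inter> c -` {M. preserves M \<Omega>} = B" by (auto simp: B_def)
  ultimately have "openin (top_of_set U) (U - B)" by (metis openin_diff openin_subtopology_self)
  then show "openin (top_of_set complex_structures) (U - B)" using U openin_trans by blast
  show "U \<subseteq> closure (U - B)"
  proof
    fix X assume X: "X \<in> U"
    then obtain Q where Qc: "Q \<in> complex_structures" "Q ** c X = - (c X ** Q)"
      and eqv: "\<And>g h. near_identity Q g h \<Longrightarrow> \<forall>\<^sub>F t in at 0. c (g t ** X ** h t) = g t ** c X ** h t"
      using Q by blast
    obtain g h where gh: "near_identity Q g h"
      and np: "\<forall>\<^sub>F t in at 0. \<not> preserves (g t ** c X ** h t) \<Omega>"
      by (rule eventually_not_preserves[OF Qc(1) cU[OF X] Qc(2) Om])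
    have "((\<lambda>t. g t ** X ** h t) \<longlongrightarrow> mat 1 ** X ** mat 1) (at 0)"
      using gh by (intro tendsto_intros) (auto simp: near_identity_def)
    then have lim: "((\<lambda>t. g t ** X ** h t) \<longlongrightarrow> X) (at 0)" by simp
    obtain V where V: "open V" "U = complex_structures \<inter> V" using U by (auto simp: openin_open)
    have "\<forall>\<^sub>F t in at 0. g t ** X ** h t \<in> V"
      using topological_tendstoD[OF lim V(1)] X V by blast
    moreover have "\<forall>\<^sub>F t in at 0. h t ** g t = mat 1"
      using gh by (auto simp: near_identity_def elim: eventually_mono)
    ultimately have "\<forall>\<^sub>F t in at 0. g t ** X ** h t \<in> U - B"
      using eqv[OF gh] np
    proof eventually_elim
      case (elim t)
      have "g t ** X ** h t \<in> U"
        using conjugate_complex_structure[of X "h t" "g t"] elim X V by auto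
      then show ?case using elim by (simp add: B_def)
    qed
    then have "\<forall>\<^sub>F t in at 0. g t ** X ** h t \<in> closure (U - B)"
      by (rule eventually_mono) (rule subsetD[OF closure_subset])
    then show "X \<in> closure (U - B)"
      by (rule Lim_in_closed_set[OF closed_closure _ at_neq_bot lim])
  qed
qed

text \<open>A basis stable under \<open>X\<close> is built in blocks \<open>e\<close>,
  \<open>X e\<close>, \<open>f\<close>, \<open>X f\<close>; this is where divisibility of the
  dimension by four enters.\<close>

lemma exists_anticommuting:
  fixes X :: "real^'m^'m"
  assumes X: "X \<in> complex_structures" and n: "CARD('m) = 4 * n"
  obtains J where "J \<in> complex_structures" "X ** J = - (J ** X)"
proof -
  note XX = complex_structure_vector[OF X]
  have "\<exists>B (J :: real^'m^'m). independent B \<and> finite B \<and> card B = 4 * k \<and> (\<forall>b\<in>B. X *v b \<in> span B \<and>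
     J *v b \<in> span B \<and> J *v (J *v b) = - b \<and> J *v (X *v b) = - (X *v (J *v b)))" if "k \<le> n" for k
    using that
  proof (induction k)
    case 0
    then show ?case by (intro exI[of _ "{}"]) (simp add: independent_empty)
  next
    case (Suc k)
    then obtain B and J :: "real^'m^'m" where B: "independent B" "finite B" "card B = 4 * k"
      and XB: "\<And>b. b \<in> B \<Longrightarrow> X *v b \<in> span B" and JB: "\<And>b. b \<in> B \<Longrightarrow> J *v b \<in> span B"
      and JJ: "\<And>b. b \<in> B \<Longrightarrow> J *v (J *v b) = - b"
      and JX: "\<And>b. b \<in> B \<Longrightarrow> J *v (X *v b) = - (X *v (J *v b))" by auto
    have big: "\<exists>v. v \<notin> span C" if "finite C" "card C < 4 * n" for C :: "(real^'m) set"
    proof (rule ccontr)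
      assume "\<nexists>v. v \<notin> span C"
      then have "(UNIV :: (real^'m) set) \<subseteq> span C" by auto
      then have "dim (UNIV :: (real^'m) set) \<le> card C" using that(1) dim_le_card by blast
      then show False using that(2) n by (simp add: dim_UNIV)
    qed
    obtain e where e: "e \<notin> span B" using big[OF B(2)] B(3) Suc.prems by auto
    note B1 = insert_complex_pair[OF X B(1) XB e]
    define C where "C = insert (X *v e) (insert e B)"
    have C: "finite C" "card C = 4 * k + 2" using B B1 by (auto simp: C_def)
    obtain f where f: "f \<notin> span C" using big[OF C(1)] C(2) Suc.prems by auto
    note C1 = insert_complex_pair[OF X B1(1,6)[folded C_def] f]
    define D where "D = insert (X *v f) (insert f C)"
    have D: "finite D" "card D = 4 * Suc k" using C C1 by (auto simp: D_def)
    have BD: "B \<subseteq> D" "span B \<subseteq> span D" by (auto simp: C_def D_def intro!: span_mono)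
    have dist: "e \<notin> B" "X *v e \<noteq> e" "X *v e \<notin> B" "f \<notin> B" "f \<noteq> e" "f \<noteq> X *v e"
      "X *v f \<noteq> f" "X *v f \<notin> B" "X *v f \<noteq> e" "X *v f \<noteq> X *v e"
      using B1(3-5) C1(3-5) by (auto simp: C_def)
    \<comment> \<open>Forced on the new block by \<open>J e = f\<close>, \<open>J J = -1\<close> and
      \<open>J X = - X J\<close>; on \<open>B\<close> the old \<open>J\<close> is kept.\<close>
    define \<phi> where "\<phi> = (\<lambda>b. if b = e then f else if b = X *v e then - (X *v f) else if b = f then - e
        else if b = X *v f then X *v e else J *v b)"
    obtain J' :: "real^'m^'m" where J': "\<And>b. b \<in> D \<Longrightarrow> J' *v b = \<phi> b"
      using matrix_with_values[OF C1(1)[folded D_def]] by blast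
    have J'e: "J' *v e = f" "J' *v (X *v e) = - (X *v f)" "J' *v f = - e" "J' *v (X *v f) = X *v e"
      using J'[of e] J'[of "X *v e"] J'[of f] J'[of "X *v f"] dist
      by (simp_all add: C_def D_def \<phi>_def)
    have J'B: "J' *v b = J *v b" if "b \<in> span B" for b
    proof (rule matrix_eq_on_span[OF _ that])
      fix b assume b: "b \<in> B"
      then have "J' *v b = \<phi> b" using J' BD by blast
      then show "J' *v b = J *v b" using b dist unfolding \<phi>_def by metis
    qed
    have neg_mult: "g *v (- y) = - (g *v y)" for g :: "real^'m^'m" and y
      by (metis linear_neg linear_matrix_vector)
    have mem: "e \<in> span D" "f \<in> span D" "X *v e \<in> span D" "X *v f \<in> span D"
      by (auto simp: C_def D_def intro: span_base)
    have "\<forall>b\<in>D. X *v b \<in> span D \<and>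
       J' *v b \<in> span D \<and> J' *v (J' *v b) = - b \<and> J' *v (X *v b) = - (X *v (J' *v b))"
    proof
      fix b assume b: "b \<in> D"
      have 1: "X *v b \<in> span D" using C1(6) b by (simp add: D_def)
      consider "b \<in> B" | "b = e" | "b = X *v e" | "b = f" | "b = X *v f"
        using b by (auto simp: C_def D_def)
      then have "J' *v b \<in> span D \<and> J' *v (J' *v b) = - b \<and> J' *v (X *v b) = - (X *v (J' *v b))"
      proof cases
        case 1
        then show ?thesis using XB[OF 1] JB[OF 1] JJ[OF 1] JX[OF 1] J'B span_base[OF 1] BD(2) by auto
      qed (simp_all add: J'e mem XX neg_mult span_neg)
      with 1 show "X *v b \<in> span D \<and> J' *v b \<in> span D \<and> J' *v (J' *v b) = - b \<and> J' *v (X *v b) = - (X *v (J' *v b))"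
        by simp
    qed
    then show ?case using C1(1)[folded D_def] D by (intro exI[of _ D] exI[of _ J']) simp
  qed
  then obtain B and J :: "real^'m^'m" where B: "independent B" "finite B" "card B = 4 * n"
      and JJ: "\<And>b. b \<in> B \<Longrightarrow> J *v (J *v b) = - b"
      and JX: "\<And>b. b \<in> B \<Longrightarrow> J *v (X *v b) = - (X *v (J *v b))" by blast
  have "dim (UNIV :: (real^'m) set) \<le> card B" using n B by (simp add: dim_UNIV)
  then have sp: "span B = UNIV" using card_ge_dim_independent[of B UNIV] B by auto
  have ext: "A = C" if "\<And>b. b \<in> B \<Longrightarrow> A *v b = C *v b" for A C :: "real^'m^'m"
    using matrix_eq_on_span[of B A C] that sp by (simp add: matrix_eq)
  show ?thesis
  proof (rule that[of J])
    have "J ** J = - mat 1"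
      by (rule ext) (simp add: matrix_vector_mul_assoc[symmetric] JJ matrix_minus_vector_mult)
    then show "J \<in> complex_structures" by (simp add: complex_structures_def)
    show "X ** J = - (J ** X)"
      by (rule ext) (simp add: matrix_vector_mul_assoc[symmetric] JX matrix_minus_vector_mult)
  qed
qed

section \<open>Local and global connection by generic paths\<close>

lemma generic_dense:
  fixes U :: "(real^'m^'m) set"
  assumes \<Gamma>: "full_lattice \<Gamma>" and n: "CARD('m) = 4 * n"
    and U: "openin (top_of_set complex_structures) U" "U \<noteq> {}"
  obtains P where "P \<in> U" "generic_period \<Gamma> P"
proof -
  have US: "U \<subseteq> complex_structures" using U openin_imp_subset by blast
  define \<B> where "\<B> = (\<lambda>\<Omega>. {X \<in> U. preserves X \<Omega>}) ` lattice_forms \<Gamma>"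
  have "countable \<B>" unfolding \<B>_def using alternating_forms_countable[OF \<Gamma>] by (rule countable_image)
  have "openin (top_of_set complex_structures) (U - B) \<and> U \<subseteq> closure (U - B)" if B: "B \<in> \<B>" for B
  proof -
    obtain \<Omega> where \<Omega>: "alternating_form \<Omega>" "B = {X \<in> U. preserves X \<Omega>}" using B by (auto simp: \<B>_def)
    have "\<exists>Q\<in>complex_structures. Q ** X = - (X ** Q)" if X: "X \<in> U" for X
    proof -
      obtain J where "J \<in> complex_structures" "X ** J = - (J ** X)"
        using exists_anticommuting[OF _ n] X US by blast
      then show ?thesis by (metis minus_minus)
    qed
    then show ?thesis unfolding \<Omega>(2)
      using US by (intro preserving_set_nowhere_dense[OF \<Omega>(1) U(1), where c = "\<lambda>X. X"]) auto
  qed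
  then obtain P where P: "P \<in> U" "\<And>B. B \<in> \<B> \<Longrightarrow> P \<notin> B"
    using Baire_avoid[OF closed_complex_structures U \<open>countable \<B>\<close>] by blast
  have "generic_period \<Gamma> P"
    unfolding generic_period_iff
  proof (intro conjI ballI)
    show "P \<in> complex_structures" using P US by blast
    fix \<Omega> :: "real^'m \<Rightarrow> real^'m \<Rightarrow> real" assume "\<Omega> \<in> lattice_forms \<Gamma>"
    then have "{X \<in> U. preserves X \<Omega>} \<in> \<B>" unfolding \<B>_def by (rule imageI)
    then show "\<not> preserves P \<Omega>" using P by blast
  qed
  with P(1) show ?thesis by (rule that)
qed

lemma locally_reachable:
  fixes X :: "real^'m^'m"
  assumes \<Gamma>: "full_lattice \<Gamma>" and n: "CARD('m) = 4 * n" and X: "X \<in> complex_structures"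
  obtains T where "openin (top_of_set complex_structures) T" "X \<in> T"
    "\<And>P Q. P \<in> T \<Longrightarrow> Q \<in> T \<Longrightarrow> reach \<Gamma> P Q"
proof -
  obtain e :: real and conn :: "real^'m^'m \<Rightarrow> real^'m^'m \<Rightarrow> real^'m^'m" where e: "e > 0"
    and conn1: "\<And>P J. \<lbrakk>P \<in> complex_structures; J \<in> complex_structures; norm (anticommutator_defect P J) < e\<rbrakk>
       \<Longrightarrow> conn P J \<in> complex_structures \<and> P ** conn P J = - (conn P J ** P) \<and> J ** conn P J = - (conn P J ** J)"
    and conn2: "\<And>P. continuous_on {J. norm (anticommutator_defect P J) < e} (conn P)"
    and conn3: "\<And>P J g h. \<lbrakk>norm (anticommutator_defect P J) < e; near_identity P g h\<rbrakk>
       \<Longrightarrow> \<forall>\<^sub>F t in at 0. conn P (g t ** J ** h t) = g t ** conn P J ** h t"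
    by (rule connector_exists) (rule that; assumption)
  obtain J where J: "J \<in> complex_structures" "X ** J = - (J ** X)"
    using exists_anticommuting[OF X n] by blast
  define N where "N = (\<lambda>P::real^'m^'m. complex_structures \<inter> {J. norm (anticommutator_defect P J) < e})"
  have Nopen: "openin (top_of_set complex_structures) (N P)" for P
  proof -
    have "open {J. norm (anticommutator_defect P J) < e}"
      unfolding anticommutator_defect_def by (intro open_Collect_less continuous_intros)
    then show ?thesis unfolding N_def by (intro openin_open_Int)
  qed
  define T where "T = complex_structures \<inter> {P. norm (anticommutator_defect P J) < e}"
  have "open {P. norm (anticommutator_defect P J) < e}"
    unfolding anticommutator_defect_def by (intro open_Collect_less continuous_intros)
  then have "openin (top_of_set complex_structures) T" unfolding T_def by (intro openin_open_Int)
  moreover have "X \<in> T" using X J e by (simp add: T_def anticommutator_defect_def mm.zero_left)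
  moreover have "reach \<Gamma> P Q" if P: "P \<in> T" and Q: "Q \<in> T" for P Q
  proof -
    \<comment> \<open>Nonempty because \<open>J\<close> itself belongs to it: \<open>T\<close> is
      defined by smallness of the defect with this same \<open>J\<close>.\<close>
    define U where "U = N P \<inter> N Q"
    have U: "openin (top_of_set complex_structures) U" "U \<noteq> {}"
      using Nopen P Q J by (auto simp: U_def N_def T_def intro: openin_Int)
    have US: "U \<subseteq> complex_structures" using U openin_imp_subset by blast
    have C: "P \<in> complex_structures" "Q \<in> complex_structures" using P Q by (auto simp: T_def)
    define \<C> where "\<C> = {(\<lambda>X. X), conn P, conn Q}"
    define bad :: "((real^'m^'m \<Rightarrow> real^'m^'m) \<times> (real^'m \<Rightarrow> real^'m \<Rightarrow> real)) \<Rightarrow> (real^'m^'m) set"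
      where "bad = (\<lambda>(c, \<Omega>). {X \<in> U. preserves (c X) \<Omega>})"
    have "countable (bad ` (\<C> \<times> lattice_forms \<Gamma>))"
      using alternating_forms_countable[OF \<Gamma>] by (intro countable_image countable_SIGMA) (auto simp: \<C>_def)
    moreover have "openin (top_of_set complex_structures) (U - B) \<and> U \<subseteq> closure (U - B)"
      if B: "B \<in> bad ` (\<C> \<times> lattice_forms \<Gamma>)" for B
    proof -
      obtain c \<Omega> where c: "c \<in> \<C>" and \<Omega>: "alternating_form \<Omega>" "B = {X \<in> U. preserves (c X) \<Omega>}"
        using B by (auto simp: bad_def)
      have anti: "R ** conn R J' = - (conn R J' ** R)" "J' ** conn R J' = - (conn R J' ** J')"
        "conn R J' ** J' = - (J' ** conn R J')" "conn R J' \<in> complex_structures"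
        if "J' \<in> U" "R = P \<or> R = Q" for R J'
        using conn1[of R J'] that C US unfolding U_def N_def by auto
      have "continuous_on U c \<and> (\<forall>X\<in>U. c X \<in> complex_structures \<and> (\<exists>R\<in>complex_structures. R ** c X = - (c X ** R) \<and>
         (\<forall>g h. near_identity R g h \<longrightarrow> (\<forall>\<^sub>F t in at 0. c (g t ** X ** h t) = g t ** c X ** h t))))"
      proof (cases "c = (\<lambda>X. X)")
        \<comment> \<open>For the identity map, \<open>conn P X\<close> anticommutes with
          \<open>X\<close> and can play the role of \<open>R\<close>; equivariance is then
          trivial.\<close>
        case True
        then show ?thesis using anti(3,4)[of _ P] US by auto
      next
        case False
        then obtain R where R: "R = P \<or> R = Q" "c = conn R" using c by (auto simp: \<C>_def)
        have "U \<subseteq> {J. norm (anticommutator_defect R J) < e}" using R by (auto simp: U_def N_def)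
        then have "continuous_on U c" "\<And>X. X \<in> U \<Longrightarrow> norm (anticommutator_defect R X) < e"
          using continuous_on_subset conn2 R by blast+
        then show ?thesis using anti[OF _ R(1)] R C conn3[of R] by blast
      qed
      then show ?thesis unfolding \<Omega>(2)
        by (intro preserving_set_nowhere_dense[OF \<Omega>(1) U(1)]) auto
    qed
    ultimately obtain J' where J': "J' \<in> U" "\<And>B. B \<in> bad ` (\<C> \<times> lattice_forms \<Gamma>) \<Longrightarrow> J' \<notin> B"
      using Baire_avoid[OF closed_complex_structures U] by blast
    have np: "\<not> preserves (c J') \<Omega>" if "c \<in> \<C>" "\<Omega> \<in> lattice_forms \<Gamma>" for c \<Omega>
    proof -
      have "bad (c, \<Omega>) \<in> bad ` (\<C> \<times> lattice_forms \<Gamma>)" using that by blast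
      then show ?thesis using J' by (auto simp: bad_def)
    qed
    define M M' where "M = conn P J'" and "M' = conn Q J'"
    have J'C: "J' \<in> complex_structures" using J' US by blast
    have M: "M \<in> complex_structures" "P ** M = - (M ** P)" "J' ** M = - (M ** J')"
      and M': "M' \<in> complex_structures" "Q ** M' = - (M' ** Q)" "J' ** M' = - (M' ** J')"
      using conn1[of P J'] conn1[of Q J'] C J' US unfolding M_def M'_def U_def N_def by auto
    have "generic_period \<Gamma> M" "generic_period \<Gamma> M'" "generic_period \<Gamma> J'"
      using np M(1) M'(1) J'C unfolding generic_period_iff M_def M'_def \<C>_def by blast+
    moreover have "linked P M" "linked M J'" "linked J' M'" "linked M' Q"
      using linked_anticommute C J'C M M' by blast+
    ultimately show ?thesis
      using reach_step[OF reach_step[OF reach_step[OF reach_linked[of P M]]]] by metis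
  qed
  ultimately show ?thesis by (rule that)
qed

text \<open>Two structures \<open>P\<close>, \<open>Q\<close> are intertwined by \<open>1 - Q P\<close>, which is close to \<open>2\<close> if
  \<open>Q\<close> is close to \<open>P\<close>.\<close>

lemma openin_components_complex_structures:
  assumes "C \<in> components (complex_structures :: (real^'m^'m) set)"
  shows "openin (top_of_set complex_structures) C"
proof -
  obtain e :: real and v :: "real^'m^'m \<Rightarrow> real^'m^'m" where e: "e > 0"
    and v: "\<And>E. norm E < e \<Longrightarrow> (mat 1 - E) ** v E = mat 1 \<and> v E ** (mat 1 - E) = mat 1"
    and cv: "continuous_on (ball 0 e) v"
    by (rule matrix_inverse_near_identity) (rule that; assumption)
  have v0: "v 0 = mat 1" using v[of 0] e by simp
  have CS: "C \<subseteq> complex_structures" using assms in_components_subset by blast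
  show ?thesis
  proof (subst openin_subopen, intro ballI)
    fix P assume P: "P \<in> C"
    then have PS: "P \<in> complex_structures" using CS by blast
    define E where "E = (\<lambda>Q. (1/2) *\<^sub>R (mat 1 + Q ** P))"
    define T where "T = complex_structures \<inter> {Q. norm (E Q) < e}"
    have "open {Q. norm (E Q) < e}"
      unfolding E_def by (intro open_Collect_less continuous_intros)
    then have T: "openin (top_of_set complex_structures) T" unfolding T_def by (intro openin_open_Int)
    have "P \<in> T" using PS e by (simp add: T_def E_def complex_structures_sq)
    moreover have "T \<subseteq> C"
    proof
      fix Q assume "Q \<in> T"
      then have Q: "Q \<in> complex_structures" "norm (E Q) < e" by (auto simp: T_def)
      define f where "f = (\<lambda>t::real. (mat 1 - t *\<^sub>R E Q) ** P ** v (t *\<^sub>R E Q))"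
      have small: "norm (t *\<^sub>R E Q) < e" if "t \<in> {0..1}" for t
      proof -
        have "\<bar>t\<bar> * norm (E Q) \<le> 1 * norm (E Q)" using that by (intro mult_right_mono) auto
        then show ?thesis using Q by simp
      qed
      have "continuous_on {0..1} (\<lambda>t. v (t *\<^sub>R E Q))"
        by (rule continuous_on_compose2[OF cv]) (use small in \<open>auto intro!: continuous_intros\<close>)
      then have "continuous_on {0..1} f" unfolding f_def by (intro continuous_intros)
      then have "connected (f ` {0..1})" by (intro connected_continuous_image) auto
      moreover have "f ` {0..1} \<subseteq> complex_structures"
        unfolding f_def using conjugate_complex_structure[OF PS] v[OF small] by blast
      moreover have f0: "f 0 = P" by (simp add: f_def v0)
      then have "P \<in> f ` {0..1}" by (metis atLeastAtMost_iff image_eqI order_refl zero_le_one)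
      ultimately have sub: "f ` {0..1} \<subseteq> C"
        using components_maximal[OF assms, of "f ` {0..1}"] P by blast
      \<comment> \<open>Both sides equal \<open>(P + Q) / 2\<close>, so at \<open>t = 1\<close> the
        conjugation turns \<open>P\<close> into \<open>Q\<close>.\<close>
      have "(mat 1 - E Q) ** P = Q ** (mat 1 - E Q)"
        by (simp add: E_def matrix_ring_simps complex_structures_sq[OF PS] complex_structures_sq[OF Q(1)])
      then have "f 1 = Q ** ((mat 1 - E Q) ** v (E Q))" by (simp add: f_def matrix_mul_assoc)
      also have "\<dots> = Q" using v[OF Q(2)] by simp
      finally show "Q \<in> C" using sub by (metis atLeastAtMost_iff image_subset_iff order_refl zero_le_one)
    qed
    ultimately show "\<exists>T. openin (top_of_set complex_structures) T \<and> P \<in> T \<and> T \<subseteq> C" using T by blast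
  qed
qed

text \<open>\<open>reach\<close> composes only through generic points, so connectedness is applied
  to the relation on the dense set of generic periods of \<open>C\<close>; \<open>P\<close> and
  \<open>Q\<close> are attached to generic neighbours \<open>P'\<close> and \<open>Q'\<close> at the
  end.\<close>

theorem generic_path_connected_components:
  fixes P Q :: "real^'m^'m"
  assumes \<Gamma>: "full_lattice \<Gamma>" and n: "CARD('m) = 4 * n"
    and C: "C \<in> components complex_structures" and P: "P \<in> C" and Q: "Q \<in> C"
  shows "\<exists>Ss. generic_path \<Gamma> Ss \<and> path_connects Ss P Q"
proof -
  have CS: "C \<subseteq> complex_structures" using C in_components_subset by blast
  note Copen = openin_components_complex_structures[OF C]
  have loc: "\<exists>T. openin (top_of_set complex_structures) T \<and> T \<subseteq> C \<and> X \<in> T \<and> (\<forall>P\<in>T. \<forall>Q\<in>T. reach \<Gamma> P Q)"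
    if X: "X \<in> C" for X
  proof -
    obtain T where "openin (top_of_set complex_structures) T" "X \<in> T"
      "\<And>P Q. P \<in> T \<Longrightarrow> Q \<in> T \<Longrightarrow> reach \<Gamma> P Q"
      using locally_reachable[OF \<Gamma> n] X CS by blast
    then show ?thesis using X Copen by (intro exI[of _ "T \<inter> C"]) (auto intro: openin_Int)
  qed
  obtain TP where TP: "openin (top_of_set complex_structures) TP" "TP \<subseteq> C" "P \<in> TP"
    "\<forall>P\<in>TP. \<forall>Q\<in>TP. reach \<Gamma> P Q" using loc[OF P] by blast
  obtain TQ where TQ: "openin (top_of_set complex_structures) TQ" "TQ \<subseteq> C" "Q \<in> TQ"
    "\<forall>P\<in>TQ. \<forall>Q\<in>TQ. reach \<Gamma> P Q" using loc[OF Q] by blast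
  obtain P' where P': "P' \<in> TP" "generic_period \<Gamma> P'" using generic_dense[OF \<Gamma> n TP(1)] TP(3) by blast
  obtain Q' where Q': "Q' \<in> TQ" "generic_period \<Gamma> Q'" using generic_dense[OF \<Gamma> n TQ(1)] TQ(3) by blast
  define R where "R = (\<lambda>x y. generic_period \<Gamma> x \<and> generic_period \<Gamma> y \<and> reach \<Gamma> x y)"
  have "R P' Q'"
  proof (rule connected_equivalence_relation_gen[where S = C and P = "generic_period \<Gamma>"])
    show "connected C" using C in_components_connected by blast
    show "P' \<in> C" "Q' \<in> C" using P' Q' TP TQ by auto
    show "generic_period \<Gamma> P'" "generic_period \<Gamma> Q'" using P' Q' by auto
    show "R x z" if "R x y" "R y z" for x y z using that reach_trans unfolding R_def by blast
    show "\<exists>z. z \<in> T \<and> generic_period \<Gamma> z" if "openin (top_of_set C) T" "a \<in> T" for T a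
      using generic_dense[OF \<Gamma> n, of T] openin_trans[OF that(1) Copen] that(2) by blast
    show "\<exists>T. openin (top_of_set C) T \<and> a \<in> T \<and> (\<forall>x\<in>T. \<forall>y\<in>T. generic_period \<Gamma> x \<and> generic_period \<Gamma> y \<longrightarrow> R x y)"
      if "a \<in> C" for a
      using loc[OF that] openin_subset_trans[OF _ _ CS] unfolding R_def by blast
  qed
  then have "reach \<Gamma> P' Q'" by (simp add: R_def)
  moreover have "reach \<Gamma> P P'" "reach \<Gamma> Q' Q" using TP TQ P' Q' by auto
  ultimately have "reach \<Gamma> P Q" using reach_trans P' Q' by blast
  then show ?thesis by (rule reach_generic_path)
qed

section \<open>Twistor spheres as submanifolds of the Grassmannian\<close>

definition cmat :: "real^'n^'m \<Rightarrow> complex^'n^'m" where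
  "cmat A = (\<chi> i j. complex_of_real (A $ i $ j))"

lemma cmat_mult: "cmat (A ** B) = cmat A ** cmat B"
  by (simp add: cmat_def matrix_matrix_mult_def vec_eq_iff)

lemma cmat_vector: "cmat A *v complexify v = complexify (A *v v)"
  by (simp add: cmat_def complexify_def matrix_vector_mult_def vec_eq_iff)

lemma cmat_neg_vector: "cmat (- A) *v x = - (cmat A *v x)"
  by (simp add: cmat_def matrix_vector_mult_def vec_eq_iff sum_negf)

lemma cmat_comb_vector:
  "cmat (a *\<^sub>R A + b *\<^sub>R B + c *\<^sub>R C) *v x = of_real a *s (cmat A *v x) + of_real b *s (cmat B *v x) + of_real c *s (cmat C *v x)"
  by (simp add: cmat_def matrix_vector_mult_def vec_eq_iff sum.distrib algebra_simps sum_distrib_left)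

lemma cmat_one_vector: "cmat (mat 1) *v x = (x :: complex^'m)"
proof -
  have "cmat (mat 1 :: real^'m^'m) = mat 1" by (simp add: cmat_def mat_def vec_eq_iff)
  then show ?thesis by simp
qed

lemma complexify_neg: "complexify (- w) = - complexify w"
  by (simp add: complexify_def vec_eq_iff)

lemma cmat_scale: "(A :: complex^'n^'m) *v (c *s x) = c *s (A *v x)"
  by (simp add: matrix_vector_mult_def vec_eq_iff sum_distrib_left mult_ac)

lemma cmat_neg: "(A :: complex^'n^'m) *v (- x) = - (A *v x)"
  by (simp add: matrix_vector_mult_def vec_eq_iff sum_negf)

lemmas cvec_simps = cmat_scale cmat_neg matrix_vector_right_distrib matrix_vector_mult_diff_distrib
  vec.scale_right_distrib vec.scale_right_diff_distrib vec.scale_minus_right vec.scale_scale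

lemma cmat_complex_structure:
  assumes "R \<in> complex_structures"
  shows "cmat R *v (cmat R *v x) = - x"
  using complex_structures_sq(1)[OF assms]
  by (simp add: matrix_vector_mul_assoc cmat_mult[symmetric] cmat_neg_vector cmat_one_vector)

text \<open>\<open>1 - \<i> R\<close> is twice the projection onto the eigenspace for \<i>.
  Conversely, an eigenvector \<open>a + \<i> b\<close> with real \<open>a\<close>, \<open>b\<close>
  has \<open>b = - R a\<close>, so it is determined by its real part.\<close>

lemma period_plane_eq:
  assumes R: "R \<in> complex_structures"
  shows "period_plane R = {x. cmat R *v x = \<i> *s x}"
proof (intro equalityI subsetI)
  fix x assume "x \<in> period_plane R"
  then obtain v where x: "x = complexify v - \<i> *s complexify (R *v v)" by (auto simp: period_plane_def)
  show "x \<in> {x. cmat R *v x = \<i> *s x}"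
    by (simp add: x cvec_simps cmat_vector complex_structure_vector[OF R] complexify_neg)
next
  fix x assume "x \<in> {x. cmat R *v x = \<i> *s x}"
  then have Rx: "cmat R *v x = \<i> *s x" by simp
  define a where "a = (\<chi> i. Re (x $ i))"
  define b where "b = (\<chi> i. Im (x $ i))"
  have x: "x = complexify a + \<i> *s complexify b"
    by (simp add: a_def b_def complexify_def vec_eq_iff complex_eq_iff)
  have "complexify (R *v a) + \<i> *s complexify (R *v b) = \<i> *s complexify a - complexify b"
    using Rx unfolding x by (simp add: cvec_simps cmat_vector)
  then have "R *v a = - b"
    by (auto simp: vec_eq_iff complexify_def complex_eq_iff)
  then have "x = complexify a - \<i> *s complexify (R *v a)" by (simp add: x complexify_neg)
  then show "x \<in> period_plane R" unfolding period_plane_def by blast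
qed

lemma subspace_period_plane:
  assumes "R \<in> complex_structures"
  shows "vec.subspace (period_plane R)"
  unfolding period_plane_eq[OF assms] vec.subspace_def by (auto simp: cvec_simps mult.commute)

lemma complementary_dim:
  fixes A B :: "(complex^'m) set"
  assumes "complementary A B"
  shows "vec.dim A + vec.dim B = CARD('m)"
proof -
  have AB: "vec.subspace A" "vec.subspace B" "A \<inter> B = {0}" and ex: "\<forall>v. \<exists>a\<in>A. \<exists>b\<in>B. v = a + b"
    using assms by (auto simp: complementary_def)
  from ex have "{x + y |x y. x \<in> A \<and> y \<in> B} = UNIV" by blast
  then show ?thesis using vec.dim_sums_Int[OF AB(1,2)] AB(3) by (simp add: card_cart_basis)
qed

context
  fixes I J :: "real^'m^'m"
  assumes I: "I \<in> complex_structures" and J: "J \<in> complex_structures" and IJ: "I ** J = - (J ** I)"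
begin

lemma cmat_anticommute: "cmat I *v (cmat J *v x) = - (cmat J *v (cmat I *v x))"
  by (simp add: matrix_vector_mul_assoc cmat_mult[symmetric] IJ cmat_neg_vector)

text \<open>\<open>J\<close> anticommutes with \<open>I\<close>, so it exchanges the eigenspaces for
  \<i> and - \<i>. Thus \<open>w\<close> and \<open>J w'\<close> are the eigencomponents of
  \<open>x\<close>, and \<open>w'\<close> is found from the inverse \<open>- J\<close> of
  \<open>J\<close>.\<close>

lemma quaternion_plane_decomposition:
  obtains w w' where "w \<in> period_plane I" "w' \<in> period_plane I" "x = w + cmat J *v w'"
proof -
  define w where "w = (1/2) *s (x - \<i> *s (cmat I *v x))"
  define w' where "w' = - (cmat J *v ((1/2) *s (x + \<i> *s (cmat I *v x))))"
  show ?thesis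
  proof (rule that)
    show "w \<in> period_plane I" "w' \<in> period_plane I"
      by (simp_all add: period_plane_eq[OF I] w_def w'_def cvec_simps cmat_complex_structure[OF I] cmat_anticommute)
    show "x = w + cmat J *v w'"
      by (simp add: w_def w'_def cvec_simps cmat_complex_structure[OF J])
         (simp add: vec_eq_iff algebra_simps)
  qed
qed

lemma quaternion_plane_independent:
  assumes "w \<in> period_plane I" "w' \<in> period_plane I" "w + cmat J *v w' = 0"
  shows "w = 0" "w' = 0"
proof -
  have Iw: "cmat I *v w = \<i> *s w" "cmat I *v w' = \<i> *s w'" using assms period_plane_eq[OF I] by auto
  have eq: "w = - (cmat J *v w')" using assms(3) by (simp add: eq_neg_iff_add_eq_0)
  have "\<i> *s w = cmat I *v (- (cmat J *v w'))" using Iw eq by simp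
  also have "\<dots> = \<i> *s (cmat J *v w')" by (simp add: cvec_simps cmat_anticommute Iw)
  also have "\<dots> = - (\<i> *s w)" by (simp add: eq cvec_simps)
  finally show "w = 0" by (simp add: vec_eq_iff)
  then have "cmat J *v (cmat J *v w') = 0" using eq by simp
  then show "w' = 0" by (simp add: cmat_complex_structure[OF J])
qed

text \<open>An affine coordinate on the sphere of planes, whose point at infinity is the plane
  \<open>J W\<close> of \<open>- I\<close>.\<close>

definition sphere_plane :: "complex \<Rightarrow> (complex^'m) set" where
  "sphere_plane t = (\<lambda>w. w + t *s (cmat J *v w)) ` period_plane I"

text \<open>On \<open>W + J W\<close> the operator \<open>R\<close> acts as a two by two matrix, and
  the eigenvector condition for \<open>w + J w'\<close> becomes two linear equations. They are
  proportional since \<open>a^2 + b^2 + c^2 = 1\<close>; for \<open>a \<noteq> -1\<close> what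
  remains is \<open>w' = t w\<close>, with \<open>t\<close> a stereographic coordinate centred at
  \<open>- I\<close>.\<close>

lemma period_plane_sphere:
  assumes abc: "a\<^sup>2 + b\<^sup>2 + c\<^sup>2 = 1"
  defines "R \<equiv> a *\<^sub>R I + b *\<^sub>R J + c *\<^sub>R (I ** J)"
  shows "a \<noteq> -1 \<Longrightarrow> period_plane R = sphere_plane ((of_real b - \<i> * of_real c) / (\<i> * of_real (1 + a)))"
    and "a = -1 \<Longrightarrow> period_plane R = (*v) (cmat J) ` period_plane I"
proof -
  have RC: "R \<in> complex_structures"
    using twistor_sphere_subset_complex_structures[OF I J IJ] twistor_sphereI[OF abc] unfolding R_def by blast
  have Rw: "cmat R *v w = (a * \<i>) *s w + (b - \<i> * c) *s (cmat J *v w)"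
    and RJ: "cmat R *v (cmat J *v w) = - ((b + \<i> * c) *s w) - (a * \<i>) *s (cmat J *v w)"
    if w: "w \<in> period_plane I" for w
  proof -
    have Iw: "cmat I *v w = \<i> *s w" using w period_plane_eq[OF I] by auto
    show "cmat R *v w = (a * \<i>) *s w + (b - \<i> * c) *s (cmat J *v w)"
      unfolding R_def cmat_comb_vector cmat_mult
      by (simp add: matrix_vector_mul_assoc[symmetric] cmat_anticommute Iw cvec_simps vec.scale_left_diff_distrib mult.commute)
    show "cmat R *v (cmat J *v w) = - ((b + \<i> * c) *s w) - (a * \<i>) *s (cmat J *v w)"
      unfolding R_def cmat_comb_vector cmat_mult
      by (simp add: matrix_vector_mul_assoc[symmetric] cmat_anticommute Iw cvec_simps
          cmat_complex_structure[OF J])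
  qed
  have sub: "vec.subspace (period_plane I)" by (rule subspace_period_plane[OF I])
  have coords: "w + cmat J *v w' \<in> period_plane R \<longleftrightarrow>
      (\<i> * (1 - a)) *s w + (b + \<i> * c) *s w' = 0 \<and> (b - \<i> * c) *s w - (\<i> * (1 + a)) *s w' = 0"
    (is "_ \<longleftrightarrow> ?u = 0 \<and> ?v = 0")
    if w: "w \<in> period_plane I" "w' \<in> period_plane I" for w w'
  proof -
    have "w + cmat J *v w' \<in> period_plane R \<longleftrightarrow> \<i> *s (w + cmat J *v w') - cmat R *v (w + cmat J *v w') = 0"
      by (auto simp: period_plane_eq[OF RC])
    also have "\<i> *s (w + cmat J *v w') - cmat R *v (w + cmat J *v w') = ?u + cmat J *v (- ?v)"
      by (simp add: cvec_simps Rw[OF w(1)] RJ[OF w(2)]) (simp add: vec_eq_iff algebra_simps)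
    also have "?u + cmat J *v (- ?v) = 0 \<longleftrightarrow> ?u = 0 \<and> ?v = 0"
      using quaternion_plane_independent[of ?u "- ?v"] w sub
      by (auto simp: vec.subspace_add vec.subspace_diff vec.subspace_neg vec.subspace_scale)
    finally show ?thesis .
  qed
  show "period_plane R = sphere_plane ((of_real b - \<i> * of_real c) / (\<i> * of_real (1 + a)))" if a: "a \<noteq> -1"
  proof -
    define t where "t = (of_real b - \<i> * of_real c) / (\<i> * of_real (1 + a))"
    have nz: "\<i> * complex_of_real (1 + a) \<noteq> 0" using a by (simp add: complex_eq_iff)
    have iff: "w + cmat J *v w' \<in> period_plane R \<longleftrightarrow> w' = t *s w"
      if w: "w \<in> period_plane I" "w' \<in> period_plane I" for w w'
    proof -
      have "(b - \<i> * c) *s w - (\<i> * (1 + a)) *s w' = 0 \<longleftrightarrow> w' = t *s w"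
        using nz by (auto simp: t_def vec_eq_iff field_simps)
      moreover have "(\<i> * (1 - a)) *s w + (b + \<i> * c) *s (t *s w) = 0"
      proof -
        have "(b + \<i> * c) * (b - \<i> * c) = of_real (b\<^sup>2 + c\<^sup>2)" by (simp add: algebra_simps power2_eq_square)
        also have "b\<^sup>2 + c\<^sup>2 = (1 + a) * (1 - a)"
          using abc by (simp add: algebra_simps power2_eq_square)
        finally have sq: "(b + \<i> * c) * (b - \<i> * c) = complex_of_real ((1 + a) * (1 - a))" .
        have t: "t * (\<i> * (1 + a)) = b - \<i> * c" using nz by (simp add: t_def)
        have "(\<i> * (1 - a) + (b + \<i> * c) * t) * (\<i> * (1 + a))
            = (\<i> * \<i>) * ((1 - a) * (1 + a)) + (b + \<i> * c) * (t * (\<i> * (1 + a)))"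
          by (simp add: algebra_simps)
        also have "\<dots> = 0" unfolding t sq by (simp add: mult.commute)
        finally have "\<i> * (1 - a) + (b + \<i> * c) * t = 0" using nz by (metis mult_eq_0_iff)
        moreover have "(\<i> * (1 - a)) *s w + (b + \<i> * c) *s (t *s w) = (\<i> * (1 - a) + (b + \<i> * c) * t) *s w"
          by (simp add: vec_eq_iff algebra_simps)
        ultimately show ?thesis by simp
      qed
      ultimately show ?thesis using coords[OF w] by metis
    qed
    have "x \<in> period_plane R \<longleftrightarrow> x \<in> sphere_plane t" for x
    proof -
      obtain w w' where w: "w \<in> period_plane I" "w' \<in> period_plane I" "x = w + cmat J *v w'"
        by (rule quaternion_plane_decomposition)
      have "x \<in> sphere_plane t \<longleftrightarrow> w' = t *s w"
      proof
        assume "x \<in> sphere_plane t"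
        then obtain v where v: "v \<in> period_plane I" "x = v + t *s (cmat J *v v)" by (auto simp: sphere_plane_def)
        have "(w - v) + cmat J *v (w' - t *s v) = x - x" by (subst (1) w(3), subst v(2)) (simp add: cvec_simps)
        then have "(w - v) + cmat J *v (w' - t *s v) = 0" by simp
        moreover have "w - v \<in> period_plane I" "w' - t *s v \<in> period_plane I"
          using w v sub by (simp_all add: vec.subspace_diff vec.subspace_scale)
        ultimately have "w - v = 0" "w' - t *s v = 0"
          using quaternion_plane_independent[of "w - v" "w' - t *s v"] by blast+
        then show "w' = t *s w" by simp
      next
        assume "w' = t *s w"
        then show "x \<in> sphere_plane t" using w by (auto simp: sphere_plane_def cvec_simps)
      qed
      then show ?thesis using iff[OF w(1,2)] w(3) by simp
    qed
    then show ?thesis unfolding t_def by blast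
  qed
  show "period_plane R = (*v) (cmat J) ` period_plane I" if a: "a = -1"
  proof -
    have "b\<^sup>2 + c\<^sup>2 = 0" using abc a by simp
    then have bc: "b = 0" "c = 0" by (simp_all add: sum_power2_eq_zero_iff)
    have "x \<in> period_plane R \<longleftrightarrow> x \<in> (*v) (cmat J) ` period_plane I" for x
    proof -
      obtain w w' where w: "w \<in> period_plane I" "w' \<in> period_plane I" "x = w + cmat J *v w'"
        by (rule quaternion_plane_decomposition)
      have "x \<in> period_plane R \<longleftrightarrow> w = 0"
        unfolding w(3) coords[OF w(1,2)] by (simp add: a bc vec_eq_iff)
      also have "\<dots> \<longleftrightarrow> x \<in> (*v) (cmat J) ` period_plane I"
      proof
        assume "x \<in> (*v) (cmat J) ` period_plane I"
        then obtain v where v: "v \<in> period_plane I" "x = cmat J *v v" by auto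
        have "w + cmat J *v (w' - v) = x - x" by (subst (1) w(3), subst v(2)) (simp add: cvec_simps)
        then have "w + cmat J *v (w' - v) = 0" by simp
        moreover have "w' - v \<in> period_plane I" using w v sub by (simp add: vec.subspace_diff)
        ultimately show "w = 0" using quaternion_plane_independent(1)[of w "w' - v"] w by blast
      qed (use w in auto)
      finally show ?thesis .
    qed
    then show ?thesis by blast
  qed
qed

lemma period_planes_twistor_sphere:
  "period_plane ` twistor_sphere I J = insert ((*v) (cmat J) ` period_plane I) (range sphere_plane)"
proof (intro equalityI subsetI)
  fix W assume "W \<in> period_plane ` twistor_sphere I J"
  then obtain a b c where "a\<^sup>2 + b\<^sup>2 + c\<^sup>2 = 1" "W = period_plane (a *\<^sub>R I + b *\<^sub>R J + c *\<^sub>R (I ** J))"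
    by (auto simp: twistor_sphere_def)
  then show "W \<in> insert ((*v) (cmat J) ` period_plane I) (range sphere_plane)"
    using period_plane_sphere[of a b c] by (cases "a = -1") auto
next
  fix W assume "W \<in> insert ((*v) (cmat J) ` period_plane I) (range sphere_plane)"
  then consider "W = (*v) (cmat J) ` period_plane I" | t where "W = sphere_plane t" by auto
  then show "W \<in> period_plane ` twistor_sphere I J"
  proof cases
    case 1
    have "W = period_plane ((-1) *\<^sub>R I + 0 *\<^sub>R J + 0 *\<^sub>R (I ** J))"
      using period_plane_sphere(2)[of "-1" 0 0] 1 by simp
    then show ?thesis using twistor_sphereI[of "-1" 0 0 I J] by (metis image_eqI one_power2 power2_minus add.right_neutral zero_power2)
  next
    case 2
    \<comment> \<open>Inverse stereographic projection: \<open>1 + a = 2 / (1 + r)\<close>, and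
      \<open>b - \<i> c = t \<i> (1 + a)\<close> determines \<open>b\<close> and
      \<open>c\<close>.\<close>
    define r where "r = (cmod t)\<^sup>2"
    define a where "a = (1 - r) / (1 + r)"
    define b where "b = - (1 + a) * Im t"
    define c where "c = - (1 + a) * Re t"
    have r: "r \<ge> 0" "(Re t)\<^sup>2 + (Im t)\<^sup>2 = r" by (simp_all add: r_def cmod_power2)
    have a1: "1 + a = 2 / (1 + r)" using r by (simp add: a_def field_simps)
    have "a\<^sup>2 + b\<^sup>2 + c\<^sup>2 = a\<^sup>2 + (1 + a)\<^sup>2 * ((Re t)\<^sup>2 + (Im t)\<^sup>2)"
      by (simp only: b_def c_def power_mult_distrib mult_minus_left power2_minus) (simp add: distrib_left)
    also have "\<dots> = ((1 - r)\<^sup>2 + 4 * r) / (1 + r)\<^sup>2"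
      unfolding r(2) a1 by (simp add: a_def power_divide add_divide_distrib)
    also have "(1 - r)\<^sup>2 + 4 * r = (1 + r)\<^sup>2" by (simp add: power2_eq_square algebra_simps)
    also have "(1 + r)\<^sup>2 / (1 + r)\<^sup>2 = 1" using r(1) by simp
    finally have abc: "a\<^sup>2 + b\<^sup>2 + c\<^sup>2 = 1" .
    have an: "1 + a \<noteq> 0" using a1 r(1) by simp
    have "(b - \<i> * c) = t * (\<i> * (1 + a))"
      by (simp add: b_def c_def complex_eq_iff algebra_simps)
    moreover have "\<i> * complex_of_real (1 + a) \<noteq> 0" using an by (simp add: complex_eq_iff)
    ultimately have "(of_real b - \<i> * of_real c) / (\<i> * of_real (1 + a)) = t" by simp
    then have "W = period_plane (a *\<^sub>R I + b *\<^sub>R J + c *\<^sub>R (I ** J))"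
      using period_plane_sphere(1)[OF abc] 2 an by simp
    then show ?thesis using twistor_sphereI[OF abc] by blast
  qed
qed

lemma complementary_quaternion_planes:
  "complementary (period_plane I) ((*v) (cmat J) ` period_plane I)"
proof -
  have sub: "vec.subspace (period_plane I)" by (rule subspace_period_plane[OF I])
  have "x = 0" if x: "x \<in> period_plane I" "x = cmat J *v w" "w \<in> period_plane I" for x w
  proof -
    have "x + cmat J *v (- w) = 0" using x by (simp add: cvec_simps)
    then show ?thesis
      using quaternion_plane_independent(1)[of x "- w"] x sub by (auto simp: vec.subspace_neg)
  qed
  moreover have "0 \<in> period_plane I \<inter> (*v) (cmat J) ` period_plane I"
  proof -
    have "0 = cmat J *v 0" by simp
    then show ?thesis using vec.subspace_0[OF sub] by blast
  qed
  ultimately have "period_plane I \<inter> (*v) (cmat J) ` period_plane I = {0}" by blast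
  moreover have "\<exists>a\<in>period_plane I. \<exists>b\<in>(*v) (cmat J) ` period_plane I. v = a + b" for v
    by (rule quaternion_plane_decomposition[of v]) blast
  ultimately show ?thesis
    unfolding complementary_def using sub vec.subspace_image[OF sub, of "cmat J"] by blast
qed

lemma dim_period_plane: "2 * vec.dim (period_plane I) = CARD('m)"
proof -
  have "inj_on ((*v) (cmat J)) A" for A
    by (rule inj_onI) (metis cmat_complex_structure[OF J] neg_equal_iff_equal)
  then have "vec.dim ((*v) (cmat J) ` period_plane I) = vec.dim (period_plane I)"
    by (rule vec.dim_image_eq[OF matrix_vector_mul_linear_gen])
  then show ?thesis using complementary_dim[OF complementary_quaternion_planes] by simp
qed

end

section \<open>Complex differentiability of rational maps in several variables\<close>

definition cdiff_at :: "(complex^'a \<Rightarrow> complex) \<Rightarrow> complex^'a \<Rightarrow> bool" where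
  "cdiff_at f z \<longleftrightarrow> (\<exists>v. (f has_derivative (\<lambda>x. \<Sum>j\<in>UNIV. v $ j * x $ j)) (at z))"

lemma cdiff_at_const [simp]: "cdiff_at (\<lambda>_. c) z"
  unfolding cdiff_at_def by (rule exI[of _ 0]) simp

lemma cdiff_at_nth [simp]: "cdiff_at (\<lambda>z. z $ j) z"
proof -
  have "(\<Sum>i\<in>UNIV. axis j 1 $ i * x $ i) = x $ j" for x :: "complex^'a"
    by (simp add: axis_def if_distrib[of "\<lambda>u. u * _"] sum.delta cong: if_cong)
  then show ?thesis unfolding cdiff_at_def
    by (intro exI[of _ "axis j 1"]) (simp add: bounded_linear_imp_has_derivative bounded_linear_vec_nth)
qed

lemma cdiff_at_add:
  assumes "cdiff_at f z" "cdiff_at g z"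
  shows "cdiff_at (\<lambda>z. f z + g z) z"
proof -
  obtain v w where "(f has_derivative (\<lambda>x. \<Sum>j\<in>UNIV. v $ j * x $ j)) (at z)"
    "(g has_derivative (\<lambda>x. \<Sum>j\<in>UNIV. w $ j * x $ j)) (at z)" using assms by (auto simp: cdiff_at_def)
  from has_derivative_add[OF this] show ?thesis unfolding cdiff_at_def
    by (intro exI[of _ "v + w"]) (simp add: distrib_right sum.distrib)
qed

lemma cdiff_at_mult:
  assumes "cdiff_at f z" "cdiff_at g z"
  shows "cdiff_at (\<lambda>z. f z * g z) z"
proof -
  obtain v w where "(f has_derivative (\<lambda>x. \<Sum>j\<in>UNIV. v $ j * x $ j)) (at z)"
    "(g has_derivative (\<lambda>x. \<Sum>j\<in>UNIV. w $ j * x $ j)) (at z)" using assms by (auto simp: cdiff_at_def)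
  from has_derivative_mult[OF this] show ?thesis unfolding cdiff_at_def
    by (intro exI[of _ "f z *s w + g z *s v"])
       (simp add: algebra_simps sum.distrib sum_distrib_left)
qed

lemma cdiff_at_inverse:
  assumes "cdiff_at f z" "f z \<noteq> 0"
  shows "cdiff_at (\<lambda>z. inverse (f z)) z"
proof -
  obtain v where "(f has_derivative (\<lambda>x. \<Sum>j\<in>UNIV. v $ j * x $ j)) (at z)"
    using assms by (auto simp: cdiff_at_def)
  from Deriv.has_derivative_inverse[OF assms(2) this] show ?thesis unfolding cdiff_at_def
    by (intro exI[of _ "(- inverse (f z) * inverse (f z)) *s v"])
       (simp add: sum_distrib_left sum_distrib_right mult_ac sum_negf)
qed

lemma cdiff_at_divide:
  "cdiff_at f z \<Longrightarrow> cdiff_at g z \<Longrightarrow> g z \<noteq> 0 \<Longrightarrow> cdiff_at (\<lambda>z. f z / g z) z"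
  unfolding divide_inverse by (intro cdiff_at_mult cdiff_at_inverse)

lemma cdiff_at_sum: "(\<And>i. i \<in> S \<Longrightarrow> cdiff_at (f i) z) \<Longrightarrow> cdiff_at (\<lambda>z. \<Sum>i\<in>S. f i z) z"
  by (induction S rule: infinite_finite_induct) (auto intro: cdiff_at_add)

lemma cdiff_at_prod: "(\<And>i. i \<in> S \<Longrightarrow> cdiff_at (f i) z) \<Longrightarrow> cdiff_at (\<lambda>z. \<Prod>i\<in>S. f i z) z"
  by (induction S rule: infinite_finite_induct) (auto intro: cdiff_at_mult)

lemma cdiff_at_isCont: "cdiff_at f z \<Longrightarrow> isCont f z"
  unfolding cdiff_at_def using has_derivative_continuous by blast

lemma holomorphic_map_onI:
  assumes "\<And>z i. z \<in> U \<Longrightarrow> cdiff_at (\<lambda>z. f z $ i) z"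
  shows "holomorphic_map_on f U"
  unfolding holomorphic_map_on_def
proof
  fix z assume z: "z \<in> U"
  have "\<forall>i. \<exists>v. ((\<lambda>z. f z $ i) has_derivative (\<lambda>x. \<Sum>j\<in>UNIV. v $ j * x $ j)) (at z)"
    using assms[OF z] by (simp add: cdiff_at_def)
  then obtain v where v: "\<And>i. ((\<lambda>z. f z $ i) has_derivative (\<lambda>x. \<Sum>j\<in>UNIV. v i $ j * x $ j)) (at z)"
    by metis
  have "(f has_derivative (\<lambda>x. (\<chi> i. v i) *v x)) (at z)"
    unfolding has_derivative_componentwise_within[of f]
  proof
    fix b :: "complex^'b" assume "b \<in> Basis"
    then obtain i u where b: "b = axis i u" by (auto simp: Basis_vec_def)
    have "((\<lambda>z. f z $ i \<bullet> u) has_derivative (\<lambda>x. (\<Sum>j\<in>UNIV. v i $ j * x $ j) \<bullet> u)) (at z)"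
      by (rule has_derivative_inner_left[OF v])
    then show "((\<lambda>x. f x \<bullet> b) has_derivative (\<lambda>x. ((\<chi> i. v i) *v x) \<bullet> b)) (at z)"
      by (simp add: b inner_axis matrix_vector_mult_def)
  qed
  then show "\<exists>A. (f has_derivative (*v) A) (at z)" by blast
qed

lemma holomorphic_map_on_imp_continuous_on:
  "holomorphic_map_on f U \<Longrightarrow> continuous_on U f"
  unfolding holomorphic_map_on_def
  by (meson continuous_at_imp_continuous_on has_derivative_continuous)

definition cdiff_matrix_at :: "(complex^'a \<Rightarrow> complex^'n^'m) \<Rightarrow> complex^'a \<Rightarrow> bool" where
  "cdiff_matrix_at M z \<longleftrightarrow> (\<forall>i j. cdiff_at (\<lambda>z. M z $ i $ j) z)"

lemma cdiff_matrix_at_const [simp]: "cdiff_matrix_at (\<lambda>_. A) z"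
  by (simp add: cdiff_matrix_at_def)

lemma cdiff_matrix_at_add:
  "cdiff_matrix_at A z \<Longrightarrow> cdiff_matrix_at B z \<Longrightarrow> cdiff_matrix_at (\<lambda>z. A z + B z) z"
  by (simp add: cdiff_matrix_at_def cdiff_at_add)

lemma cdiff_matrix_at_mult:
  "cdiff_matrix_at A z \<Longrightarrow> cdiff_matrix_at B z \<Longrightarrow> cdiff_matrix_at (\<lambda>z. A z ** B z) z"
  by (simp add: cdiff_matrix_at_def matrix_matrix_mult_def cdiff_at_sum cdiff_at_mult)

lemma cdiff_at_det:
  "cdiff_matrix_at A z \<Longrightarrow> cdiff_at (\<lambda>z. det (A z)) z"
  unfolding det_def cdiff_matrix_at_def
  by (intro cdiff_at_sum cdiff_at_mult cdiff_at_prod) auto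

lemma cmatrix_axis: "(A :: complex^'n^'m) *v axis k 1 = column k A"
  by (simp add: matrix_vector_mult_def axis_def column_def vec_eq_iff if_distrib[of "\<lambda>u. _ * u"] cong: if_cong)

text \<open>The inverse by Cramer's rule, whose entries are visibly rational functions.\<close>

definition cramer_inverse :: "complex^'n^'n \<Rightarrow> complex^'n^'n" where
  "cramer_inverse A = (\<chi> k i. det (\<chi> i' j. if j = k then axis i 1 $ i' else A $ i' $ j) / det A)"

lemma cramer_inverse:
  assumes "det A \<noteq> 0"
  shows "A ** cramer_inverse A = mat 1" "cramer_inverse A ** A = mat 1"
proof -
  have "A *v (cramer_inverse A *v axis i 1) = axis i 1" for i
    by (subst cramer[OF assms])
      (simp add: cramer_inverse_def vec_eq_iff cmatrix_axis column_def)
  then have "(A ** cramer_inverse A) *v axis i 1 = mat 1 *v axis i 1" for i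
    by (simp add: matrix_vector_mul_assoc)
  then have "column i (A ** cramer_inverse A) = column i (mat 1)" for i
    by (simp only: cmatrix_axis)
  then show "A ** cramer_inverse A = mat 1" by (simp add: column_def vec_eq_iff)
  then show "cramer_inverse A ** A = mat 1" using matrix_left_right_inverse by blast
qed

lemma cramer_inverse_unique:
  assumes "A ** B = mat 1"
  shows "cramer_inverse A = B"
proof -
  have "det A \<noteq> 0" using assms by (metis det_mul det_I mult_zero_left zero_neq_one)
  then show ?thesis using cramer_inverse[of A] assms
    by (metis matrix_mul_assoc matrix_mul_lid matrix_mul_rid)
qed

lemma cdiff_matrix_at_cramer_inverse:
  assumes "cdiff_matrix_at A z" "det (A z) \<noteq> 0"
  shows "cdiff_matrix_at (\<lambda>z. cramer_inverse (A z)) z"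
proof -
  have "cdiff_matrix_at (\<lambda>z. \<chi> i' j. if j = k then axis i 1 $ i' else A z $ i' $ j) z" for k i
    unfolding cdiff_matrix_at_def
  proof (intro allI)
    fix i' j
    show "cdiff_at (\<lambda>z. (\<chi> i' j. if j = k then axis i 1 $ i' else A z $ i' $ j) $ i' $ j) z"
      using assms(1) by (cases "j = k") (simp_all add: cdiff_matrix_at_def)
  qed
  then show ?thesis
    using assms unfolding cdiff_matrix_at_def[of "\<lambda>z. cramer_inverse (A z)"]
    unfolding cramer_inverse_def
    by (auto intro!: cdiff_at_divide cdiff_at_det)
qed

lemma bounded_bilinear_complex_matrix_mult:
  "bounded_bilinear ((**) :: complex^'n^'m \<Rightarrow> complex^'p^'n \<Rightarrow> complex^'p^'m)"
  unfolding bilinear_conv_bounded_bilinear[symmetric] bilinear_def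
  by (auto intro!: linearI simp: matrix_matrix_mult_def vec_eq_iff sum.distrib algebra_simps
      scaleR_sum_right)

interpretation cm: bounded_bilinear "(**) :: complex^'n^'m \<Rightarrow> complex^'p^'n \<Rightarrow> complex^'p^'m"
  by (rule bounded_bilinear_complex_matrix_mult)

lemmas cmatrix_ring_simps = matrix_mul_assoc[symmetric] cm.add_left cm.add_right cm.diff_left
  cm.diff_right cm.minus_left cm.minus_right cm.zero_left cm.zero_right

definition flatten :: "complex^'m^'m \<Rightarrow> complex^('m \<times> 'm)" where
  "flatten M = (\<chi> ij. M $ fst ij $ snd ij)"

lemma unflatten_flatten [simp]: "unflatten (flatten M) = M"
  by (simp add: flatten_def unflatten_def vec_eq_iff)

lemma flatten_unflatten [simp]: "flatten (unflatten z) = z"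
  by (simp add: flatten_def unflatten_def vec_eq_iff)

subsection \<open>Changes of charts of the Grassmannian\<close>

text \<open>Let \<open>p\<close> be the projection onto \<open>A\<close> along \<open>B\<close>. An invertible \<open>g\<close> maps the graph of
  \<open>Z\<close> to the graph of \<open>moved p g Z\<close> provided that \<open>denom p g Z\<close> is invertible. The chart
  map extends this to the ambient space by the identity on a complement of the block
  \<open>(1 - p) Z p\<close>.\<close>

definition block :: "complex^'m^'m \<Rightarrow> complex^'m^'m \<Rightarrow> complex^'m^'m" where
  "block p Z = (mat 1 - p) ** Z ** p"

definition denom :: "complex^'m^'m \<Rightarrow> complex^'m^'m \<Rightarrow> complex^'m^'m \<Rightarrow> complex^'m^'m" where
  "denom p g Z = p ** g ** (mat 1 + Z) ** p + (mat 1 - p)"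

definition moved :: "complex^'m^'m \<Rightarrow> complex^'m^'m \<Rightarrow> complex^'m^'m \<Rightarrow> complex^'m^'m" where
  "moved p g Z = (mat 1 - p) ** g ** (mat 1 + Z) ** p ** cramer_inverse (denom p g Z) ** p"

text \<open>The range of \<open>S = (1 + Z) p\<close> is the graph. The denominator \<open>N\<close>
  is the \<open>A\<close>-block of \<open>g S\<close> completed by \<open>1 - p\<close>; it commutes
  with \<open>p\<close>, and dividing by it restores the normalised form \<open>(1 + Y) p\<close>.
  For the way back the denominator is the same expression in the inverse of \<open>N\<close>, so
  \<open>Z\<close> is recovered.\<close>

lemma moved_graph:
  fixes p g h Z :: "complex^'m^'m"
  assumes p: "p ** p = p" and gh: "g ** h = mat 1" and Z: "block p Z = Z"
    and N: "det (denom p g Z) \<noteq> 0"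
  defines "Y \<equiv> moved p g Z"
  shows "block p Y = Y" "g ** (mat 1 + Z) ** p = (mat 1 + Y) ** p ** denom p g Z"
    "det (denom p h Y) \<noteq> 0" "moved p h Y = Z"
proof -
  define N where "N = denom p g Z"
  define N' where "N' = cramer_inverse N"
  have NN: "N ** N' = mat 1" "N' ** N = mat 1" using cramer_inverse assms(4) unfolding N_def N'_def by blast+
  have hg: "h ** g = mat 1" using gh matrix_left_right_inverse by blast
  have pX: "p ** (p ** X) = p ** X" for X :: "complex^'m^'m" by (simp add: matrix_mul_assoc p)
  have hgX: "h ** (g ** X) = X" for X :: "complex^'m^'m" by (simp add: matrix_mul_assoc hg)
  define S where "S = (mat 1 + Z) ** p"
  have Zp: "Z ** p = Z" by (subst (1 2) Z[symmetric]) (simp add: block_def matrix_mul_assoc[symmetric] p)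
  have pZ: "p ** Z = 0" by (subst Z[symmetric]) (simp add: block_def cmatrix_ring_simps p pX)
  have Neq: "N = p ** g ** S + (mat 1 - p)" by (simp add: N_def denom_def S_def matrix_mul_assoc)
  have Sp: "S ** p = S" by (simp add: S_def matrix_mul_assoc[symmetric] p)
  have pN: "p ** N = p ** g ** S" by (simp add: Neq cmatrix_ring_simps p pX)
  have Np: "N ** p = p ** g ** S" by (simp add: Neq cmatrix_ring_simps p pX Sp)
  have N'p: "N' ** p = p ** N'"
  proof -
    have "N' ** p = N' ** (p ** (N ** N'))" by (simp add: NN)
    also have "\<dots> = N' ** ((N ** p) ** N')" using pN Np by (simp add: matrix_mul_assoc)
    also have "\<dots> = (N' ** N) ** (p ** N')" by (simp add: matrix_mul_assoc)
    finally show ?thesis by (simp add: NN)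
  qed
  have Y: "Y = (mat 1 - p) ** g ** S ** N' ** p"
    by (simp add: Y_def moved_def S_def N'_def N_def matrix_mul_assoc)
  have Yp: "Y ** p = Y" by (simp add: Y matrix_mul_assoc[symmetric] p)
  have pY: "p ** Y = 0" by (simp add: Y cmatrix_ring_simps p pX)
  show "block p Y = Y" by (simp add: block_def Yp matrix_mul_assoc[symmetric] cm.diff_left pY)
  have YN: "Y ** N = (mat 1 - p) ** g ** S"
  proof -
    have "Y ** N = (mat 1 - p) ** g ** S ** (N' ** (p ** N))" by (simp add: Y matrix_mul_assoc)
    also have "p ** N = N ** p" by (simp add: pN Np)
    also have "N' ** (N ** p) = p" by (simp add: matrix_mul_assoc NN)
    finally show ?thesis by (simp add: matrix_mul_assoc[symmetric] Sp)
  qed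
  have gS: "g ** S = (mat 1 + Y) ** p ** N"
  proof -
    have "(mat 1 + Y) ** p ** N = p ** N + Y ** N" by (simp add: cm.add_left Yp)
    also have "\<dots> = g ** S" by (simp add: pN YN cmatrix_ring_simps)
    finally show ?thesis by simp
  qed
  then show "g ** (mat 1 + Z) ** p = (mat 1 + Y) ** p ** denom p g Z"
    by (simp add: S_def N_def matrix_mul_assoc)
  have hS: "h ** ((mat 1 + Y) ** p) = S ** N'"
  proof -
    have "h ** ((mat 1 + Y) ** p) = h ** ((mat 1 + Y) ** p ** N ** N')"
      by (simp add: matrix_mul_assoc[symmetric] NN)
    also have "\<dots> = h ** (g ** S ** N')" by (simp add: gS)
    finally show ?thesis by (simp add: matrix_mul_assoc[symmetric] hgX)
  qed
  have pS: "p ** S = p" by (simp add: S_def cmatrix_ring_simps p Zp pZ)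
  have D: "denom p h Y = p ** N' + (mat 1 - p)"
  proof -
    have "denom p h Y = p ** (h ** ((mat 1 + Y) ** p)) + (mat 1 - p)"
      by (simp add: denom_def matrix_mul_assoc)
    also have "\<dots> = p ** (S ** N') + (mat 1 - p)" by (simp only: hS)
    finally show ?thesis by (simp add: matrix_mul_assoc pS)
  qed
  define E where "E = p ** N + (mat 1 - p)"
  have N'pX: "N' ** (p ** X) = p ** (N' ** X)" for X :: "complex^'m^'m"
    by (metis N'p matrix_mul_assoc)
  have NpX: "N ** p = p ** N" by (simp add: pN Np)
  have DE: "denom p h Y ** E = mat 1"
    by (simp add: D E_def cmatrix_ring_simps p pX N'p N'pX NN)
  then have "det (denom p h Y) * det E = 1" by (metis det_mul det_I)
  then show "det (denom p h Y) \<noteq> 0" by auto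
  have "cramer_inverse (denom p h Y) = E" using cramer_inverse_unique[OF DE] .
  then have "moved p h Y = (mat 1 - p) ** (h ** ((mat 1 + Y) ** p)) ** E ** p"
    by (simp add: moved_def matrix_mul_assoc)
  also have "\<dots> = (mat 1 - p) ** S ** (N' ** (E ** p))"
    by (simp only: hS) (simp only: matrix_mul_assoc)
  also have "E ** p = N ** p" by (simp add: E_def cmatrix_ring_simps p pX NpX)
  also have "N' ** (N ** p) = p" by (simp add: matrix_mul_assoc NN)
  also have "(mat 1 - p) ** S ** p = Z"
    by (simp add: matrix_mul_assoc[symmetric] Sp) (simp add: S_def cmatrix_ring_simps p Zp pZ)
  finally show "moved p h Y = Z" .
qed

definition chart_map :: "complex^'m^'m \<Rightarrow> complex^'m^'m \<Rightarrow> complex^('m \<times> 'm) \<Rightarrow> complex^('m \<times> 'm)" where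
  "chart_map p g z = flatten (moved p g (block p (unflatten z)) + (unflatten z - block p (unflatten z)))"

definition chart_domain :: "complex^'m^'m \<Rightarrow> complex^'m^'m \<Rightarrow> (complex^('m \<times> 'm)) set" where
  "chart_domain p g = {z. det (denom p g (block p (unflatten z))) \<noteq> 0}"

lemma block_block: "p ** p = p \<Longrightarrow> block p (block p Z) = block p Z"
proof -
  assume p: "p ** p = p"
  have "block p (block p Z) = ((mat 1 - p) ** (mat 1 - p)) ** Z ** (p ** p)"
    by (simp add: block_def matrix_mul_assoc)
  then show ?thesis by (simp add: block_def p cm.diff_left cm.diff_right)
qed

lemma block_add: "block p (Y + Z) = block p Y + block p Z"
  by (simp add: block_def cm.add_left cm.add_right)

lemma block_diff: "block p (Y - Z) = block p Y - block p Z"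
  by (simp add: block_def cm.diff_left cm.diff_right)

lemma chart_map_inverse:
  assumes p: "p ** p = p" and gh: "g ** h = mat 1" and z: "z \<in> chart_domain p g"
  shows "chart_map p g z \<in> chart_domain p h" "chart_map p h (chart_map p g z) = z"
proof -
  define Z where "Z = unflatten z"
  define Y where "Y = moved p g (block p Z)"
  have N: "det (denom p g (block p Z)) \<noteq> 0" using z by (simp add: chart_domain_def Z_def)
  note m = moved_graph[OF p gh block_block[OF p] N, folded Y_def]
  have F: "unflatten (chart_map p g z) = Y + (Z - block p Z)" by (simp add: chart_map_def Y_def Z_def)
  have bF: "block p (unflatten (chart_map p g z)) = Y"
    by (simp add: F block_add block_diff block_block[OF p] m(1))
  show "chart_map p g z \<in> chart_domain p h" unfolding chart_domain_def mem_Collect_eq bF by (rule m(3))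
  show "chart_map p h (chart_map p g z) = z"
    unfolding chart_map_def[of p h] bF m(4) by (simp add: F) (simp add: Z_def)
qed

lemma cdiff_matrix_at_unflatten [simp]: "cdiff_matrix_at unflatten z"
  by (simp add: cdiff_matrix_at_def unflatten_def)

lemma cdiff_denom: "cdiff_matrix_at (\<lambda>z. denom p g (block p (unflatten z))) z"
  unfolding denom_def block_def
  by (intro cdiff_matrix_at_add cdiff_matrix_at_mult cdiff_matrix_at_const cdiff_matrix_at_unflatten)

lemma open_chart_domain: "open (chart_domain p g)"
proof -
  have "continuous_on UNIV (\<lambda>z. det (denom p g (block p (unflatten z))))"
    by (intro continuous_at_imp_continuous_on ballI cdiff_at_isCont cdiff_at_det cdiff_denom)
  then show ?thesis unfolding chart_domain_def by (intro open_Collect_neq) auto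
qed

lemma holomorphic_chart_map: "holomorphic_map_on (chart_map p g) (chart_domain p g)"
proof (rule holomorphic_map_onI)
  fix z ij assume z: "z \<in> chart_domain p g"
  have "cdiff_matrix_at (\<lambda>z. moved p g (block p (unflatten z)) + (unflatten z - block p (unflatten z))) z"
  proof -
    have 1: "unflatten z - block p (unflatten z) = unflatten z + (p - mat 1) ** unflatten z ** p" for z
      by (simp add: block_def cm.diff_left)
    show ?thesis unfolding 1 unfolding moved_def block_def
      using z by (intro cdiff_matrix_at_add cdiff_matrix_at_mult cdiff_matrix_at_cramer_inverse
          cdiff_matrix_at_const cdiff_matrix_at_unflatten cdiff_denom[unfolded block_def])
        (simp add: chart_domain_def block_def)
  qed
  then show "cdiff_at (\<lambda>z. chart_map p g z $ ij) z"
    by (simp add: cdiff_matrix_at_def chart_map_def flatten_def)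
qed

lemma homeomorphism_chart_map:
  assumes p: "p ** p = p" and gh: "g ** h = mat 1"
  shows "homeomorphism (chart_domain p g) (chart_domain p h) (chart_map p g) (chart_map p h)"
proof -
  have hg: "h ** g = mat 1" using gh matrix_left_right_inverse by blast
  show ?thesis
    by (intro homeomorphismI holomorphic_map_on_imp_continuous_on holomorphic_chart_map)
      (use chart_map_inverse[OF p gh] chart_map_inverse[OF p hg] in auto)
qed

section \<open>Transport of splittings and charts centred on the sphere\<close>

lemma cmat_ext: "(\<And>x. A *v x = B *v x) \<Longrightarrow> A = (B :: complex^'n^'m)"
  by (metis matrix_eq)

lemma complementary_projection:
  fixes A B :: "(complex^'m) set"
  assumes AB: "complementary A B"
  obtains p where "\<And>x. p *v x \<in> A" "\<And>x. x - p *v x \<in> B" "\<And>a. a \<in> A \<Longrightarrow> p *v a = a"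
    "\<And>b. b \<in> B \<Longrightarrow> p *v b = 0" "p ** p = p"
proof -
  have A: "vec.subspace A" and B: "vec.subspace B" and zero: "A \<inter> B = {0}"
    and ex: "\<forall>v. \<exists>a\<in>A. \<exists>b\<in>B. v = a + b" using AB by (auto simp: complementary_def)
  have uniq: "a = a'" if "a \<in> A" "a' \<in> A" "x - a \<in> B" "x - a' \<in> B" for a a' x
  proof -
    have "(x - a') - (x - a) \<in> B" using that B vec.subspace_diff by blast
    then have "a - a' \<in> A \<inter> B" using that A vec.subspace_diff by (auto simp: algebra_simps)
    then show ?thesis using zero by simp
  qed
  define f where "f = (\<lambda>x. THE a. a \<in> A \<and> x - a \<in> B)"
  have f: "f x \<in> A" "x - f x \<in> B" for x
  proof -
    obtain a b where "a \<in> A" "b \<in> B" "x = a + b" using ex by blast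
    then have "\<exists>!a. a \<in> A \<and> x - a \<in> B" using uniq by (intro ex1I[of _ a]) auto
    from theI'[OF this] show "f x \<in> A" "x - f x \<in> B" by (auto simp: f_def)
  qed
  have feq: "f x = a" if "a \<in> A" "x - a \<in> B" for x a using uniq f that by blast
  have "Vector_Spaces.linear (*s) (*s) f"
  proof unfold_locales
    fix x y
    show "f (x + y) = f x + f y"
    proof (rule feq)
      show "f x + f y \<in> A" using f A vec.subspace_add by blast
      have "(x - f x) + (y - f y) \<in> B" using f B vec.subspace_add by blast
      then show "x + y - (f x + f y) \<in> B" by (simp add: algebra_simps)
    qed
  next
    fix c x
    show "f (c *s x) = c *s f x"
    proof (rule feq)
      show "c *s f x \<in> A" using f A vec.subspace_scale by blast
      have "c *s (x - f x) \<in> B" using f B vec.subspace_scale by blast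
      then show "c *s x - c *s f x \<in> B" by (simp add: vec.scale_right_diff_distrib)
    qed
  qed
  then have p: "matrix f *v x = f x" for x by (rule matrix_works)
  have fa: "f a = a" if "a \<in> A" for a using that B by (intro feq) (auto simp: vec.subspace_0)
  have fb: "f b = 0" if "b \<in> B" for b using that A by (intro feq) (auto simp: vec.subspace_0)
  show ?thesis
  proof (rule that[of "matrix f"])
    show "matrix f ** matrix f = matrix f"
      by (rule cmat_ext) (simp add: matrix_vector_mul_assoc[symmetric] p fa f)
  qed (simp_all add: p f fa fb)
qed

text \<open>\<open>h\<close> is assembled from an isomorphism from \<open>A\<close> to
  \<open>W\<close> and one from \<open>B\<close> to \<open>W'\<close>, which exists because
  complements have equal dimensions.\<close>

lemma complementary_transport:
  fixes A B W W' :: "(complex^'m) set"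
  assumes AB: "complementary A B" and W: "complementary W W'" and d: "vec.dim A = vec.dim W"
  obtains g h where "g ** h = mat 1" "h ** g = mat 1" "(*v) h ` A = W" "(*v) h ` B = W'"
proof -
  obtain p where p: "\<And>x. p *v x \<in> A" "\<And>x. x - p *v x \<in> B" "\<And>a. a \<in> A \<Longrightarrow> p *v a = a"
    "\<And>b. b \<in> B \<Longrightarrow> p *v b = 0" using complementary_projection[OF AB] by metis
  have d': "vec.dim B = vec.dim W'" using complementary_dim[OF AB] complementary_dim[OF W] d by simp
  obtain f1 where f1: "Vector_Spaces.linear (*s) (*s) f1" "f1 ` A = W"
    using vec.subspace_isomorphism[of A W] AB W d by (auto simp: complementary_def)
  obtain f2 where f2: "Vector_Spaces.linear (*s) (*s) f2" "f2 ` B = W'"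
    using vec.subspace_isomorphism[of B W'] AB W d' by (auto simp: complementary_def)
  define h where "h = matrix f1 ** p + matrix f2 ** (mat 1 - p)"
  have ha: "h *v a = f1 a" if "a \<in> A" for a
    using that by (simp add: h_def matrix_vector_mult_add_rdistrib matrix_vector_mul_assoc[symmetric]
        matrix_vector_mult_diff_rdistrib p(3) matrix_works[OF f1(1)])
  have hb: "h *v b = f2 b" if "b \<in> B" for b
    using that by (simp add: h_def matrix_vector_mult_add_rdistrib matrix_vector_mul_assoc[symmetric]
        matrix_vector_mult_diff_rdistrib p(4) matrix_works[OF f2(1)])
  have hA: "(*v) h ` A = W" and hB: "(*v) h ` B = W'" using ha hb f1(2) f2(2) by (metis image_cong)+
  have "surj ((*v) h)"
  proof -
    have "y \<in> range ((*v) h)" for y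
    proof -
      obtain w w' where w: "w \<in> W" "w' \<in> W'" "y = w + w'" using W unfolding complementary_def by blast
      then obtain a b where "a \<in> A" "b \<in> B" "w = h *v a" "w' = h *v b" using hA hB by blast
      then have "y = h *v (a + b)" using w by (simp add: matrix_vector_right_distrib)
      then show ?thesis by blast
    qed
    then show ?thesis by blast
  qed
  then obtain g where "h ** g = mat 1" using matrix_right_invertible_surjective by blast
  moreover then have "g ** h = mat 1" using matrix_left_right_inverse by blast
  ultimately show ?thesis using that hA hB by blast
qed

text \<open>A unit vector orthogonal to \<open>R\<close> supplies a second generator. Any point of
  the sphere can thus serve as the centre of a chart.\<close>

lemma twistor_sphere_recenter:
  fixes I J :: "real^'m^'m"
  assumes IJ: "I \<in> complex_structures" "J \<in> complex_structures" "I ** J = - (J ** I)"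
    and R: "R \<in> twistor_sphere I J"
  obtains U where "R \<in> complex_structures" "U \<in> complex_structures" "R ** U = - (U ** R)"
    "twistor_sphere I J = twistor_sphere R U"
proof -
  obtain a b c where abc: "R = a *\<^sub>R I + b *\<^sub>R J + c *\<^sub>R (I ** J)" "a\<^sup>2 + b\<^sup>2 + c\<^sup>2 = 1"
    using R by (auto simp: twistor_sphere_def)
  obtain x y z where xyz: "x\<^sup>2 + y\<^sup>2 + z\<^sup>2 = 1" "a * x + b * y + c * z = 0"
  proof (cases "a = 0 \<and> b = 0")
    case True
    then show ?thesis using that[of 1 0 0] by simp
  next
    case False
    define r where "r = sqrt (a\<^sup>2 + b\<^sup>2)"
    have "a\<^sup>2 + b\<^sup>2 > 0" using False by (simp add: sum_power2_gt_zero_iff)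
    then have r: "r > 0" "r\<^sup>2 = a\<^sup>2 + b\<^sup>2" by (simp_all add: r_def)
    have "(b / r)\<^sup>2 + (- a / r)\<^sup>2 + 0\<^sup>2 = (a\<^sup>2 + b\<^sup>2) / r\<^sup>2" by (simp add: power_divide add_divide_distrib)
    also have "\<dots> = 1" using r(1) by (simp add: r(2)[symmetric])
    finally show ?thesis by (rule that) simp
  qed
  define U where "U = x *\<^sub>R I + y *\<^sub>R J + z *\<^sub>R (I ** J)"
  have U: "U \<in> twistor_sphere I J" unfolding U_def by (rule twistor_sphereI[OF xyz(1)])
  have "R ** U + U ** R = (- 2 * (a * x + b * y + c * z)) *\<^sub>R mat 1"
    unfolding abc U_def quaternion_mult[OF IJ] by (simp add: vec_eq_iff algebra_simps)
  then have RU: "R ** U = - (U ** R)" using xyz(2) by (simp add: eq_neg_iff_add_eq_0)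
  have "twistor_sphere I J = twistor_sphere R U" using twistor_sphere_eq[OF IJ R U RU] by simp
  then show ?thesis
    using that R U RU twistor_sphere_subset_complex_structures[OF IJ] by blast
qed

text \<open>For \<open>z0\<close> with plane \<open>W\<close>, coordinates are changed by the linear
  map \<open>g\<close> taking the splitting \<open>W\<close>, \<open>W'\<close> to \<open>A\<close>,
  \<open>B\<close>. There the affine part of the sphere becomes the complex line \<open>L\<close>,
  and its point at infinity becomes \<open>B\<close>, which is no graph over
  \<open>A\<close>.\<close>

lemma complex_submanifold_twistor_chart:
  fixes I J :: "real^'m^'m" and A B :: "(complex^'m) set"
  assumes IJ: "I \<in> complex_structures" "J \<in> complex_structures" "I ** J = - (J ** I)"
    and AB: "complementary A B" and dA: "2 * vec.dim A = CARD('m)"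
  shows "complex_submanifold 1 {z \<in> hom_space A B. graph_plane A z \<in> period_plane ` twistor_sphere I J}"
    (is "complex_submanifold 1 ?S")
  unfolding complex_submanifold_def
proof
  obtain p where p: "\<And>x. p *v x \<in> A" "\<And>x. x - p *v x \<in> B" "\<And>a. a \<in> A \<Longrightarrow> p *v a = a"
    "\<And>b. b \<in> B \<Longrightarrow> p *v b = 0" "p ** p = p" by (rule complementary_projection[OF AB]) (rule that; assumption)
  have sA: "vec.subspace A" and sB: "vec.subspace B" and AB0: "A \<inter> B = {0}"
    using AB by (auto simp: complementary_def)
  have q: "(mat 1 - p) *v x = x - p *v x" for x by (simp add: matrix_vector_mult_diff_rdistrib)
  have block_eq: "block p Z *v x = Z *v (p *v x) - p *v (Z *v (p *v x))" for Z x
    by (simp add: block_def matrix_vector_mul_assoc[symmetric] q)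
  have hom_iff: "z \<in> hom_space A B \<longleftrightarrow> block p (unflatten z) = unflatten z" for z
  proof
    assume z: "z \<in> hom_space A B"
    show "block p (unflatten z) = unflatten z"
    proof (rule cmat_ext)
      fix x
      have 1: "unflatten z *v (p *v x) \<in> B" and 2: "unflatten z *v (x - p *v x) = 0"
        using z p by (auto simp: hom_space_def)
      from 2 have "unflatten z *v (p *v x) = unflatten z *v x"
        by (simp add: matrix_vector_mult_diff_distrib)
      then show "block p (unflatten z) *v x = unflatten z *v x"
        unfolding block_eq p(4)[OF 1] by simp
    qed
  next
    assume b: "block p (unflatten z) = unflatten z"
    show "z \<in> hom_space A B" unfolding hom_space_def
    proof (intro CollectI conjI ballI)
      fix a assume "a \<in> A"
      show "unflatten z *v a \<in> B" by (subst b[symmetric], subst block_eq) (rule p)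
    next
      fix c assume c: "c \<in> B"
      show "unflatten z *v c = 0" by (subst b[symmetric], subst block_eq) (simp add: p(4)[OF c])
    qed
  qed
  have graph: "graph_plane A z = range ((*v) ((mat 1 + unflatten z) ** p))" for z
  proof -
    have "range ((*v) ((mat 1 + unflatten z) ** p)) = (\<lambda>a. a + unflatten z *v a) ` range ((*v) p)"
      by (simp add: image_image matrix_vector_mul_assoc[symmetric] matrix_vector_mult_add_rdistrib)
    also have "range ((*v) p) = A"
    proof (intro equalityI subsetI)
      fix a assume "a \<in> A"
      then have "a = p *v a" using p(3) by simp
      then show "a \<in> range ((*v) p)" by blast
    qed (use p(1) in blast)
    finally show ?thesis by (simp add: graph_plane_def)
  qed
  fix z0 assume z0: "z0 \<in> ?S"
  then obtain R0 where R0: "R0 \<in> twistor_sphere I J" "graph_plane A z0 = period_plane R0" by auto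
  obtain R J0 where RJ: "R \<in> complex_structures" "J0 \<in> complex_structures" "R ** J0 = - (J0 ** R)"
    and T: "twistor_sphere I J = twistor_sphere R J0" and zR: "graph_plane A z0 = period_plane R"
    using twistor_sphere_recenter[OF IJ R0(1)] R0(2) by metis
  define W where "W = period_plane R"
  define W' where "W' = (*v) (cmat J0) ` W"
  note planes = period_planes_twistor_sphere[OF RJ, folded T W_def, folded W'_def]
  have WW': "complementary W W'" unfolding W_def W'_def by (rule complementary_quaternion_planes[OF RJ])
  have "2 * vec.dim W = CARD('m)" unfolding W_def by (rule dim_period_plane[OF RJ])
  then have dAW: "vec.dim A = vec.dim W" using dA by simp
  obtain g h where gh: "g ** h = mat 1" "h ** g = mat 1" and hA: "(*v) h ` A = W" and hB: "(*v) h ` B = W'"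
    by (rule complementary_transport[OF AB WW' dAW])
  have ghv: "g *v (h *v x) = x" "h *v (g *v x) = x" for x
    by (simp_all add: matrix_vector_mul_assoc gh)
  have gW: "(*v) g ` W = A" "(*v) g ` W' = B"
    unfolding hA[symmetric] hB[symmetric] by (simp_all add: image_image ghv)
  \<comment> \<open>The structure \<open>J0\<close> transported to a map from \<open>A\<close> to
    \<open>B\<close> and extended by zero on \<open>B\<close>: the direction of the line.\<close>
  define J1 where "J1 = g ** cmat J0 ** h ** p"
  have J1v: "J1 *v x = g *v (cmat J0 *v (h *v (p *v x)))" for x
    by (simp add: J1_def matrix_vector_mul_assoc[symmetric])
  have J1B: "J1 *v x \<in> B" for x
  proof -
    have "h *v (p *v x) \<in> W" using hA p(1) by blast
    then have "cmat J0 *v (h *v (p *v x)) \<in> W'" by (simp add: W'_def)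
    then show ?thesis using gW(2) unfolding J1v by blast
  qed
  define L where "L = vec.span {flatten J1}"
  have L: "y \<in> L \<longleftrightarrow> (\<exists>t. y = t *s flatten J1)" for y
    unfolding L_def vec.span_singleton by auto
  have unL: "unflatten (t *s flatten M) *v x = t *s (M *v x)" for t M x
    by (simp add: unflatten_def flatten_def matrix_vector_mult_def vec_eq_iff sum_distrib_left mult_ac)
  have Lhom: "y \<in> hom_space A B" if yL: "y \<in> L" for y
  proof -
    obtain t where t: "y = t *s flatten J1" using yL unfolding L by blast
    have "J1 *v b = 0" if "b \<in> B" for b unfolding J1v p(4)[OF that] by simp
    then show ?thesis unfolding hom_space_def t mem_Collect_eq unL
      using vec.subspace_scale[OF sB J1B] by simp
  qed
  have gsphere: "(*v) g ` sphere_plane R J0 t = graph_plane A (t *s flatten J1)" for t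
  proof -
    have "sphere_plane R J0 t = (\<lambda>a. h *v a + t *s (cmat J0 *v (h *v a))) ` A"
      unfolding sphere_plane_def[OF RJ] W_def[symmetric] hA[symmetric] by (simp add: image_image)
    moreover have "g *v (h *v a + t *s (cmat J0 *v (h *v a))) = a + unflatten (t *s flatten J1) *v a"
      if "a \<in> A" for a
      unfolding unL J1v p(3)[OF that] by (simp add: matrix_vector_right_distrib cmat_scale ghv)
    ultimately show ?thesis unfolding graph_plane_def by (simp add: image_image cong: image_cong)
  qed
  have A0: "\<not> A \<subseteq> {0}"
  proof
    assume "A \<subseteq> {0}"
    then have "vec.dim A = 0" by simp
    then have "CARD('m) = 0" using dA by linarith
    then show False using zero_less_card_finite[where 'a = 'm] by linarith
  qed
  have J1_0: "flatten J1 \<noteq> 0"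
  proof
    assume "flatten J1 = 0"
    then have J1z: "J1 *v x = 0" for x using unL[of 1 J1 x] by (simp add: unflatten_def matrix_vector_mult_def vec_eq_iff)
    obtain a where a: "a \<in> A" "a \<noteq> 0" using A0 by blast
    have "cmat J0 *v (h *v a) = h *v (J1 *v a)" by (simp add: J1v ghv p(3)[OF a(1)])
    then have "cmat J0 *v (cmat J0 *v (h *v a)) = 0" by (simp add: J1z)
    then have "h *v a = 0" by (simp add: cmat_complex_structure[OF RJ(2)])
    then have "g *v (h *v a) = 0" by simp
    then show False using a by (simp add: ghv)
  qed
  define F where "F = chart_map p g"
  define G where "G = chart_map p h"
  define U where "U = chart_domain p g"
  define V where "V = chart_domain p h"
  have graph_move: "graph_plane A (chart_map p g' z) = (*v) g' ` graph_plane A z \<and> chart_map p g' z \<in> hom_space A B"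
    if gh': "g' ** h' = mat 1" and z: "z \<in> hom_space A B" "z \<in> chart_domain p g'" for g' h' z
  proof -
    define Z where "Z = unflatten z"
    have bZ: "block p Z = Z" using z hom_iff by (simp add: Z_def)
    then have N: "det (denom p g' Z) \<noteq> 0" using z by (simp add: chart_domain_def Z_def)
    note m = moved_graph[OF p(5) gh' bZ N]
    have c: "unflatten (chart_map p g' z) = moved p g' Z"
      using bZ by (simp add: chart_map_def Z_def)
    have "surj ((*v) (denom p g' Z))"
      using cramer_inverse(1)[OF N] matrix_right_invertible_surjective by blast
    then have "range ((*v) ((mat 1 + moved p g' Z) ** p ** denom p g' Z)) = range ((*v) ((mat 1 + moved p g' Z) ** p))"
      by (metis (no_types, lifting) image_cong image_image matrix_vector_mul_assoc)
    then have "graph_plane A (chart_map p g' z) = range ((*v) (g' ** ((mat 1 + Z) ** p)))"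
      unfolding graph c m(2)[symmetric] by (simp add: matrix_mul_assoc)
    also have "\<dots> = (*v) g' ` graph_plane A z"
      unfolding graph Z_def by (simp add: image_image matrix_vector_mul_assoc)
    finally show ?thesis using m(1) hom_iff c by simp
  qed
  have graph_inj: "y = y'" if y: "y \<in> hom_space A B" "y' \<in> hom_space A B" "graph_plane A y = graph_plane A y'" for y y'
  proof -
    have "unflatten y *v a = unflatten y' *v a" if a: "a \<in> A" for a
    proof -
      have "a + unflatten y *v a \<in> graph_plane A y'" using a y(3) by (auto simp: graph_plane_def)
      then obtain a' where a': "a' \<in> A" "a + unflatten y *v a = a' + unflatten y' *v a'" by (auto simp: graph_plane_def)
      have "p *v (a + unflatten y *v a) = p *v (a' + unflatten y' *v a')" using a' by simp
      then have "a = a'" using a a'(1) y by (simp add: matrix_vector_right_distrib p(3,4) hom_space_def)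
      then show ?thesis using a'(2) by simp
    qed
    then have "block p (unflatten y) = block p (unflatten y')"
      by (intro cmat_ext) (simp add: block_eq p(1))
    then have "flatten (unflatten y) = flatten (unflatten y')" using y hom_iff by metis
    then show ?thesis by simp
  qed
  have "z0 \<in> U"
  proof -
    have z0h: "z0 \<in> hom_space A B" using z0 by simp
    define Z where "Z = unflatten z0"
    have bZ: "block p Z = Z" using z0h hom_iff by (simp add: Z_def)
    \<comment> \<open>\<open>g\<close> maps the graph of \<open>Z\<close>, which is
      \<open>W\<close>, onto \<open>A\<close>. For a kernel vector, \<open>s\<close> therefore lies
      in \<open>A\<close> while its projection to \<open>A\<close> vanishes.\<close>
    have inj: "x = 0" if x: "denom p g Z *v x = 0" for x
    proof -
      define s where "s = g *v (p *v x + Z *v (p *v x))"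
      have e: "p *v s + (x - p *v x) = 0"
        using x by (simp add: denom_def matrix_vector_mult_add_rdistrib matrix_vector_mul_assoc[symmetric] q s_def)
      have "p *v (p *v s + (x - p *v x)) = 0" using e by simp
      then have ps: "p *v s = 0" using p(1,2) by (simp add: matrix_vector_right_distrib p(3,4))
      then have xA: "p *v x = x" using e by simp
      have "p *v x + Z *v (p *v x) \<in> W"
        using zR p(1) unfolding W_def Z_def graph_plane_def by blast
      then have "s \<in> A" using gW by (auto simp: s_def)
      then have "s = 0" using ps p(3) by metis
      then have "h *v s = 0" by simp
      then have "x + Z *v x = 0" by (simp add: s_def ghv xA)
      moreover have "Z *v x \<in> B" using z0h p(1)[of x] by (simp add: hom_space_def Z_def xA)
      ultimately have "p *v (x + Z *v x) = 0" "p *v (Z *v x) = 0" using p(4) by auto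
      then show ?thesis using xA by (simp add: matrix_vector_right_distrib)
    qed
    have "invertible (denom p g Z)"
      using matrix_left_invertible_ker inj invertible_left_inverse by blast
    then show ?thesis
      unfolding U_def chart_domain_def using bZ by (simp add: invertible_det_nz Z_def)
  qed
  moreover have "F ` (?S \<inter> U) = L \<inter> V"
  proof (intro equalityI subsetI)
    fix y assume "y \<in> F ` (?S \<inter> U)"
    then obtain z where z: "z \<in> hom_space A B" "graph_plane A z \<in> period_plane ` twistor_sphere I J" "z \<in> U" "y = F z"
      by blast
    have yV: "y \<in> V" using chart_map_inverse(1)[OF p(5) gh(1)] z unfolding V_def U_def F_def by blast
    have y: "graph_plane A y = (*v) g ` graph_plane A z" "y \<in> hom_space A B"
      using graph_move[OF gh(1)] z by (auto simp: F_def U_def)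
    consider "graph_plane A z = W'" | t where "graph_plane A z = sphere_plane R J0 t"
      using z(2) unfolding planes by blast
    then show "y \<in> L \<inter> V"
    proof cases
      \<comment> \<open>Contradictory: \<open>B\<close> would be a graph over the nonzero space
        \<open>A\<close>.\<close>
      case 1
      then have "graph_plane A y = B" using y gW by simp
      obtain a where a: "a \<in> A" "a \<noteq> 0" using A0 by blast
      then have "a + unflatten y *v a \<in> B" "unflatten y *v a \<in> B"
        using \<open>graph_plane A y = B\<close> y(2) by (auto simp: graph_plane_def hom_space_def)
      then have "p *v (a + unflatten y *v a) = 0" "p *v (unflatten y *v a) = 0" using p(4) by auto
      then show ?thesis using a p(3) by (simp add: matrix_vector_right_distrib)
    next
      case 2
      have tL: "t *s flatten J1 \<in> L" using L by blast
      have "y = t *s flatten J1"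
        by (rule graph_inj[OF y(2) Lhom[OF tL]]) (simp add: y(1) 2 gsphere)
      then show ?thesis using yV tL by simp
    qed
  next
    fix y assume y: "y \<in> L \<inter> V"
    then obtain t where t: "y = t *s flatten J1" using L by blast
    have z: "G y \<in> hom_space A B" "graph_plane A (G y) = (*v) h ` graph_plane A y"
      using graph_move[OF gh(2)] Lhom y by (auto simp: G_def V_def)
    have "graph_plane A (G y) = sphere_plane R J0 t"
      using z(2)[unfolded t gsphere[symmetric]] by (simp add: t image_image ghv)
    then have "graph_plane A (G y) \<in> period_plane ` twistor_sphere I J" unfolding planes by blast
    moreover have "G y \<in> U" "F (G y) = y"
      using chart_map_inverse[OF p(5) gh(2)] y unfolding U_def V_def F_def G_def by auto
    ultimately show "y \<in> F ` (?S \<inter> U)" using z(1) by (intro image_eqI[of _ _ "G y"]) auto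
  qed
  moreover have "vec.dim L = 1" "vec.subspace L"
    unfolding L_def using J1_0 by (simp_all add: vec.dim_span)
  moreover have "open U" "open V" "holomorphic_map_on F U" "holomorphic_map_on G V" "homeomorphism U V F G"
    unfolding U_def V_def F_def G_def
    by (rule open_chart_domain holomorphic_chart_map homeomorphism_chart_map[OF p(5) gh(1)])+
  ultimately show "\<exists>(U :: (complex^('m \<times> 'm)) set) (V :: (complex^('m \<times> 'm)) set) F G L. open U \<and> open V \<and> z0 \<in> U \<and>
      homeomorphism U V F G \<and> holomorphic_map_on F U \<and> holomorphic_map_on G V \<and>
      vec.subspace L \<and> vec.dim L = 1 \<and> F ` (?S \<inter> U) = L \<inter> V"
    by (intro exI[of _ U] exI[of _ V] exI[of _ F] exI[of _ G] exI[of _ L]) simp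
qed

theorem period_submanifold_twistor_sphere:
  fixes I J :: "real^'m^'m"
  assumes IJ: "I \<in> complex_structures" "J \<in> complex_structures" "I ** J = - (J ** I)"
  shows "period_submanifold 1 (twistor_sphere I J)"
proof -
  have T: "twistor_sphere I J \<subseteq> complex_structures" by (rule twistor_sphere_subset_complex_structures[OF IJ])
  have d: "2 * vec.dim (period_plane R) = CARD('m)" if "R \<in> twistor_sphere I J" for R
    using twistor_sphere_recenter[OF IJ that] dim_period_plane by metis
  have m: "2 * (CARD('m) div 2) = CARD('m)" using dim_period_plane[OF IJ] by (metis dvd_mult_div_cancel dvd_triv_left)
  show ?thesis
    unfolding period_submanifold_def grassmannian_submanifold_def grassmannian_def
  proof (intro conjI allI impI T subsetI)
    fix W assume "W \<in> period_plane ` twistor_sphere I J"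
    then obtain R where R: "R \<in> twistor_sphere I J" "W = period_plane R" by blast
    then have "vec.subspace W" "2 * vec.dim W = CARD('m)" using subspace_period_plane T d by auto
    then have "vec.subspace W" "vec.dim W = CARD('m) div 2" using m by auto
    then show "W \<in> {W. vec.subspace W \<and> vec.dim W = CARD('m) div 2}" by simp
  next
    fix A B :: "(complex^'m) set"
    assume "A \<in> {W. vec.subspace W \<and> vec.dim W = CARD('m) div 2}" "complementary A B"
    then show "complex_submanifold 1 {z \<in> hom_space A B. graph_plane A z \<in> period_plane ` twistor_sphere I J}"
      using m by (intro complex_submanifold_twistor_chart[OF IJ]) auto
  qed
qed

section \<open>The degree of twistor spheres\<close>

subsection \<open>Pluecker coordinates\<close>

text \<open>Rows may repeat and come in any order, as happens when products of sums are expanded;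
  the row index type is arbitrary.\<close>

definition row_det :: "nat \<Rightarrow> (nat \<Rightarrow> 'x) \<Rightarrow> ('x \<Rightarrow> nat \<Rightarrow> complex) \<Rightarrow> complex" where
  "row_det k g B = (\<Sum>p | p permutes {..<k}. of_int (sign p) * (\<Prod>j<k. B (g j) (p j)))"

lemma row_det_cong: "(\<And>j. j < k \<Longrightarrow> g j = g' j) \<Longrightarrow> row_det k g B = row_det k g' B"
  unfolding row_det_def by (intro sum.cong arg_cong2[where f = "(*)"] prod.cong) auto

lemma row_det_permute:
  assumes s: "\<sigma> permutes {..<k}"
  shows "row_det k (g \<circ> \<sigma>) B = of_int (sign \<sigma>) * row_det k g B"
proof -
  have ps: "permutation \<sigma>" using s permutation_permutes by blast
  have "row_det k (g \<circ> \<sigma>) B = (\<Sum>p | p permutes {..<k}. of_int (sign (p \<circ> \<sigma>)) * (\<Prod>j<k. B ((g \<circ> \<sigma>) j) ((p \<circ> \<sigma>) j)))"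
    unfolding row_det_def by (rule sum_permutations_compose_right[OF s])
  also have "\<dots> = (\<Sum>p | p permutes {..<k}. of_int (sign \<sigma>) * (of_int (sign p) * (\<Prod>j<k. B (g j) (p j))))"
  proof (rule sum.cong[OF refl])
    fix p assume "p \<in> {p. p permutes {..<k}}"
    then have "permutation p" using permutation_permutes by blast
    then have "sign (p \<circ> \<sigma>) = sign p * sign \<sigma>" using ps by (rule sign_compose)
    moreover have "(\<Prod>j<k. B ((g \<circ> \<sigma>) j) ((p \<circ> \<sigma>) j)) = (\<Prod>j<k. B (g j) (p j))"
      using prod.permute[OF s, of "\<lambda>j. B (g j) (p j)"] by (simp add: comp_def)
    ultimately show "of_int (sign (p \<circ> \<sigma>)) * (\<Prod>j<k. B ((g \<circ> \<sigma>) j) ((p \<circ> \<sigma>) j)) =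
        of_int (sign \<sigma>) * (of_int (sign p) * (\<Prod>j<k. B (g j) (p j)))" by simp
  qed
  also have "\<dots> = of_int (sign \<sigma>) * row_det k g B" by (simp add: row_det_def sum_distrib_left)
  finally show ?thesis .
qed

lemma row_det_not_inj:
  assumes "\<not> inj_on g {..<k}"
  shows "row_det k g B = 0"
proof -
  obtain a b where ab: "a < k" "b < k" "a \<noteq> b" "g a = g b" using assms by (auto simp: inj_on_def)
  define \<tau> where "\<tau> = Transposition.transpose a b"
  have "\<tau> permutes {..<k}" unfolding \<tau>_def using ab by (intro permutes_swap_id) auto
  moreover have "g \<circ> \<tau> = g" using ab by (auto simp: \<tau>_def fun_eq_iff Transposition.transpose_def)
  moreover have "sign \<tau> = - 1" using ab by (simp add: \<tau>_def sign_swap_id)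
  ultimately have "row_det k g B = - row_det k g B" using row_det_permute[of \<tau> k g B] by simp
  then show ?thesis by simp
qed

lemma row_det_transpose:
  "row_det k (\<lambda>j. j) A = (\<Sum>p | p permutes {..<k}. of_int (sign p) * (\<Prod>i<k. A (p i) i))"
proof -
  have "row_det k (\<lambda>j. j) A = (\<Sum>p | p permutes {..<k}. of_int (sign (inv p)) * (\<Prod>j<k. A j (inv p j)))"
    unfolding row_det_def by (rule sum_permutations_inverse)
  also have "\<dots> = (\<Sum>p | p permutes {..<k}. of_int (sign p) * (\<Prod>i<k. A (p i) i))"
  proof (rule sum.cong[OF refl])
    fix p assume "p \<in> {p. p permutes {..<k}}"
    then have p: "p permutes {..<k}" by simp
    have "(\<Prod>j<k. A j (inv p j)) = (\<Prod>i<k. A (p i) i)"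
      using prod.permute[OF p, of "\<lambda>j. A j (inv p j)"] by (simp add: comp_def permutes_inverses(2)[OF p])
    moreover have "sign (inv p) = sign p" using p permutation_permutes sign_inverse by blast
    ultimately show "of_int (sign (inv p)) * (\<Prod>j<k. A j (inv p j)) = of_int (sign p) * (\<Prod>i<k. A (p i) i)" by simp
  qed
  finally show ?thesis .
qed

text \<open>Multilinearity in the rows: choosing one summand in each factor amounts to choosing a
  function \<open>g\<close>.\<close>

lemma row_det_expand:
  assumes "finite M"
  shows "(\<Sum>p | p permutes {..<k}. of_int (sign p) * (\<Prod>j<k. \<Sum>m\<in>M. a j m * B m (p j))) =
    (\<Sum>g\<in>{..<k} \<rightarrow>\<^sub>E M. (\<Prod>j<k. a j (g j)) * row_det k g B)"
proof -
  have "(\<Sum>p | p permutes {..<k}. of_int (sign p) * (\<Prod>j<k. \<Sum>m\<in>M. a j m * B m (p j))) =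
    (\<Sum>p | p permutes {..<k}. \<Sum>g\<in>{..<k} \<rightarrow>\<^sub>E M. (\<Prod>j<k. a j (g j)) * (of_int (sign p) * (\<Prod>j<k. B (g j) (p j))))"
    using assms by (simp add: prod_sum_PiE prod.distrib sum_distrib_left mult_ac)
  also have "\<dots> = (\<Sum>g\<in>{..<k} \<rightarrow>\<^sub>E M. \<Sum>p | p permutes {..<k}. (\<Prod>j<k. a j (g j)) * (of_int (sign p) * (\<Prod>j<k. B (g j) (p j))))"
    by (rule sum.swap)
  finally show ?thesis by (simp add: row_det_def sum_distrib_left)
qed

text \<open>The factor is the sign of \<open>g\<close> if it is a permutation and 0 otherwise; the
  point is that it is the same for all \<open>B\<close>.\<close>

lemma row_det_self_map:
  assumes g: "g \<in> {..<k} \<rightarrow>\<^sub>E {..<k}"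
  shows "\<exists>s. \<forall>B. row_det k g B = s * row_det k (\<lambda>j. j) B"
proof (cases "inj_on g {..<k}")
  case True
  define \<sigma> where "\<sigma> = (\<lambda>i. if i < k then g i else i)"
  have "g ` {..<k} = {..<k}" using True g by (intro endo_inj_surj) auto
  then have "bij_betw g {..<k} {..<k}" using True by (simp add: bij_betw_def)
  then have "bij_betw \<sigma> {..<k} {..<k}" by (rule bij_betw_cong[THEN iffD1, rotated]) (simp add: \<sigma>_def)
  then have s: "\<sigma> permutes {..<k}" by (rule bij_imp_permutes) (simp add: \<sigma>_def)
  have "row_det k g B = row_det k ((\<lambda>j. j) \<circ> \<sigma>) B" for B :: "nat \<Rightarrow> nat \<Rightarrow> complex"
    by (rule row_det_cong) (simp add: \<sigma>_def)
  then show ?thesis unfolding row_det_permute[OF s] by blast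
next
  case False
  then show ?thesis using row_det_not_inj by (intro exI[of _ 0]) auto
qed

lemma index_list:
  "set (index_list S) = S" "distinct (index_list S)" "length (index_list S) = card (S :: 'm::finite set)"
proof -
  show "set (index_list S) = S" unfolding index_list_def by (simp add: image_image)
  have inj: "inj_on to_nat S" by (rule inj_onI) simp
  show "distinct (index_list S)" unfolding index_list_def
    by (simp add: distinct_map inj_on_def)
  show "length (index_list S) = card S" unfolding index_list_def by (simp add: card_image[OF inj])
qed

lemma pluecker_coords_row_det:
  assumes "card S = k"
  shows "pluecker_coords k w S = row_det k (\<lambda>i. index_list S ! i) (\<lambda>m j. w j $ m)"
    and "pluecker_coords k w S = row_det k (\<lambda>j. j) (\<lambda>j i. w j $ (index_list S ! i))"
  using assms by (simp_all add: row_det_transpose) (simp_all add: pluecker_coords_def pluecker_indices_def row_det_def)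

text \<open>Sorting the rows into the order of \<open>index_list\<close> costs a sign and repeated
  rows give 0, both independently of \<open>w\<close>.\<close>

lemma row_det_pluecker_coords:
  fixes g :: "nat \<Rightarrow> 'm::finite"
  shows "\<exists>s. \<forall>w. row_det k g (\<lambda>m j. w j $ m) = s * pluecker_coords k w (g ` {..<k})"
proof (cases "inj_on g {..<k}")
  case True
  define S where "S = g ` {..<k}"
  have S: "card S = k" using card_image[OF True] by (simp add: S_def)
  have bg: "bij_betw g {..<k} S" using True by (simp add: S_def bij_betw_def)
  have bL: "bij_betw ((!) (index_list S)) {..<k} S"
    using index_list[of S] S by (intro bij_betw_nth) auto
  define \<sigma>0 where "\<sigma>0 = inv_into {..<k} ((!) (index_list S)) \<circ> g"
  define \<sigma> where "\<sigma> = (\<lambda>i. if i < k then \<sigma>0 i else i)"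
  have b0: "bij_betw \<sigma>0 {..<k} {..<k}" unfolding \<sigma>0_def
    using bij_betw_trans[OF bg bij_betw_inv_into[OF bL]] .
  then have "bij_betw \<sigma> {..<k} {..<k}" by (rule bij_betw_cong[THEN iffD1, rotated]) (simp add: \<sigma>_def)
  then have s: "\<sigma> permutes {..<k}" by (rule bij_imp_permutes) (simp add: \<sigma>_def)
  have "row_det k g B = row_det k ((!) (index_list S) \<circ> \<sigma>) B" for B :: "'m \<Rightarrow> nat \<Rightarrow> complex"
  proof (rule row_det_cong)
    fix j assume "j < k"
    then have "g j \<in> (!) (index_list S) ` {..<k}" using bL by (auto simp: S_def bij_betw_def)
    then show "g j = ((!) (index_list S) \<circ> \<sigma>) j"
      using \<open>j < k\<close> by (simp add: \<sigma>_def \<sigma>0_def f_inv_into_f)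
  qed
  then have "row_det k g (\<lambda>m j. w j $ m) = of_int (sign \<sigma>) * pluecker_coords k w S" for w
    unfolding row_det_permute[OF s] pluecker_coords_row_det(1)[OF S] by blast
  then show ?thesis unfolding S_def by blast
next
  case False
  then show ?thesis using row_det_not_inj by (intro exI[of _ 0]) auto
qed

text \<open>A weak form of the Cauchy--Binet formula.\<close>

lemma functional_det_pluecker:
  fixes \<phi> :: "nat \<Rightarrow> 'm::finite \<Rightarrow> complex"
  obtains h :: "'m set \<Rightarrow> complex" where
    "\<And>w. (\<Sum>p | p permutes {..<k}. of_int (sign p) * (\<Prod>i<k. \<Sum>m\<in>UNIV. \<phi> i m * w (p i) $ m)) =
       (\<Sum>S\<in>pluecker_indices k. h S * pluecker_coords k w S)"
proof -
  obtain s where s: "\<And>(g :: nat \<Rightarrow> 'm) w. row_det k g (\<lambda>m j. w j $ m) = s g * pluecker_coords k w (g ` {..<k})"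
    using row_det_pluecker_coords[where 'm = 'm] by metis
  define G where "G = ({..<k} \<rightarrow>\<^sub>E (UNIV :: 'm set))"
  define a where "a = (\<lambda>g. (\<Prod>j<k. \<phi> j (g j)) * s g)"
  define h where "h = (\<lambda>S. \<Sum>g\<in>{g\<in>G. g ` {..<k} = S}. a g)"
  show ?thesis
  proof (rule that[of h])
    fix w :: "nat \<Rightarrow> complex^'m"
    have "(\<Sum>p | p permutes {..<k}. of_int (sign p) * (\<Prod>i<k. \<Sum>m\<in>UNIV. \<phi> i m * w (p i) $ m)) =
       (\<Sum>g\<in>G. a g * pluecker_coords k w (g ` {..<k}))"
      using row_det_expand[where M = UNIV and k = k and a = \<phi> and B = "\<lambda>m j. w j $ m"] by (simp add: s G_def a_def mult_ac)
    also have "\<dots> = (\<Sum>S\<in>UNIV. \<Sum>g\<in>{g\<in>G. g ` {..<k} = S}. a g * pluecker_coords k w (g ` {..<k}))"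
      by (rule sum.group[symmetric]) (auto simp: G_def intro!: finite_PiE)
    also have "\<dots> = (\<Sum>S\<in>UNIV. h S * pluecker_coords k w S)"
      by (intro sum.cong) (auto simp: h_def sum_distrib_right)
    also have "\<dots> = (\<Sum>S\<in>pluecker_indices k. h S * pluecker_coords k w S)"
      by (rule sum.mono_neutral_right) (auto simp: pluecker_coords_def)
    finally show "(\<Sum>p | p permutes {..<k}. of_int (sign p) * (\<Prod>i<k. \<Sum>m\<in>UNIV. \<phi> i m * w (p i) $ m)) =
       (\<Sum>S\<in>pluecker_indices k. h S * pluecker_coords k w S)" .
  qed
qed

text \<open>The common factor is the determinant of the matrix \<open>c\<close>.\<close>

lemma pluecker_coords_change_basis:
  fixes w w' :: "nat \<Rightarrow> complex^'m"
  assumes "\<And>j. j < k \<Longrightarrow> w j = (\<Sum>l<k. c j l *s w' l)"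
  shows "\<exists>d. \<forall>S. pluecker_coords k w S = d * pluecker_coords k w' S"
proof -
  have "\<exists>s. \<forall>g\<in>{..<k} \<rightarrow>\<^sub>E {..<k}. \<forall>B. row_det k g B = s g * row_det k (\<lambda>j. j) B"
    using row_det_self_map by (intro bchoice) blast
  then obtain s where s: "\<And>g B. g \<in> {..<k} \<rightarrow>\<^sub>E {..<k} \<Longrightarrow> row_det k g B = s g * row_det k (\<lambda>j. j) B" by blast
  have "pluecker_coords k w S = (\<Sum>g\<in>{..<k} \<rightarrow>\<^sub>E {..<k}. (\<Prod>j<k. c j (g j)) * s g) * pluecker_coords k w' S" for S
  proof (cases "card S = k")
    case True
    have "pluecker_coords k w S = (\<Sum>p | p permutes {..<k}. of_int (sign p) * (\<Prod>j<k. w j $ (index_list S ! p j)))"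
      unfolding pluecker_coords_row_det(2)[OF True] row_det_def ..
    also have "\<dots> = (\<Sum>p | p permutes {..<k}. of_int (sign p) * (\<Prod>j<k. \<Sum>l<k. c j l * w' l $ (index_list S ! p j)))"
      by (intro sum.cong arg_cong2[where f = "(*)"] prod.cong) (simp_all add: assms)
    also have "\<dots> = (\<Sum>g\<in>{..<k} \<rightarrow>\<^sub>E {..<k}. (\<Prod>j<k. c j (g j)) * row_det k g (\<lambda>l i. w' l $ (index_list S ! i)))"
      by (rule row_det_expand) simp
    also have "\<dots> = (\<Sum>g\<in>{..<k} \<rightarrow>\<^sub>E {..<k}. (\<Prod>j<k. c j (g j)) * (s g * pluecker_coords k w' S))"
      unfolding pluecker_coords_row_det(2)[OF True] by (intro sum.cong refl) (simp add: s)
    finally show ?thesis by (simp add: sum_distrib_right mult.assoc)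
  next
    case False
    then show ?thesis by (simp add: pluecker_coords_def pluecker_indices_def)
  qed
  then show ?thesis by blast
qed

lemma proj_point_scale: "d \<noteq> 0 \<Longrightarrow> proj_point (\<lambda>i. d * v i) = proj_point v"
proof (intro equalityI subsetI)
  fix x assume d: "d \<noteq> 0"
  { assume "x \<in> proj_point (\<lambda>i. d * v i)"
    then obtain c where "c \<noteq> 0" "x = (\<lambda>i. c * (d * v i))" by (auto simp: proj_point_def)
    then have "x = (\<lambda>i. (c * d) * v i)" "c * d \<noteq> 0" using d by (simp_all add: mult.assoc)
    then show "x \<in> proj_point v" unfolding proj_point_def by blast }
  { assume "x \<in> proj_point v"
    then obtain c where "c \<noteq> 0" "x = (\<lambda>i. c * v i)" by (auto simp: proj_point_def)
    then have "x = (\<lambda>i. (c / d) * (d * v i))" "c / d \<noteq> 0" using d by simp_all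
    then show "x \<in> proj_point (\<lambda>i. d * v i)" unfolding proj_point_def by blast }
qed

text \<open>\<open>pluecker\<close> picks some basis; any other one changes the coordinates by a
  common factor, and a nonvanishing coordinate guarantees that this factor is not 0.\<close>

lemma pluecker_eq:
  fixes w :: "nat \<Rightarrow> complex^'m"
  assumes w: "is_basis_of k w W" and nz: "pluecker_coords k w S \<noteq> 0"
  shows "pluecker k W = proj_point (pluecker_coords k w)"
proof -
  define b where "b = (SOME w. is_basis_of k w W)"
  have b: "is_basis_of k b W" unfolding b_def by (rule someI[of "\<lambda>w. is_basis_of k w W", OF w])
  have "\<exists>c. w j = (\<Sum>l<k. c l *s b l)" if "j < k" for j
  proof -
    have "w j \<in> W" using w that vec.span_base[of "w j" "w ` {..<k}"] by (auto simp: is_basis_of_def)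
    then have "w j \<in> vec.span (b ` {..<k})" using b by (simp add: is_basis_of_def)
    then obtain u where "w j = (\<Sum>v\<in>b ` {..<k}. u v *s v)" by (auto simp: vec.span_finite)
    also have "\<dots> = (\<Sum>l<k. u (b l) *s b l)"
      using b by (subst sum.reindex) (simp_all add: is_basis_of_def)
    finally show ?thesis by (intro exI[of _ "\<lambda>l. u (b l)"])
  qed
  then obtain c where "\<And>j. j < k \<Longrightarrow> w j = (\<Sum>l<k. c j l *s b l)" by metis
  then obtain d where d: "\<And>S. pluecker_coords k w S = d * pluecker_coords k b S"
    using pluecker_coords_change_basis by blast
  then have "d \<noteq> 0" using nz by auto
  moreover have "pluecker_coords k w = (\<lambda>S. d * pluecker_coords k b S)" using d by blast
  ultimately show ?thesis unfolding pluecker_def b_def[symmetric] by (simp add: proj_point_scale)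
qed

subsection \<open>A discriminant\<close>

lemma polynomial_maps_sum:
  "finite A \<Longrightarrow> (\<And>x. x \<in> A \<Longrightarrow> f x \<in> polynomial_maps X) \<Longrightarrow> (\<lambda>h. \<Sum>x\<in>A. f x h) \<in> polynomial_maps X"
  by (induction A rule: finite_induct) (auto intro: polynomial_maps.intros)

lemma polynomial_maps_prod:
  "finite A \<Longrightarrow> (\<And>x. x \<in> A \<Longrightarrow> f x \<in> polynomial_maps X) \<Longrightarrow> (\<lambda>h. \<Prod>x\<in>A. f x h) \<in> polynomial_maps X"
  by (induction A rule: finite_induct) (auto intro: polynomial_maps.intros)

lemma polynomial_maps_det:
  fixes M :: "('i \<Rightarrow> complex) \<Rightarrow> complex^'m^'m"
  assumes "\<And>i j. (\<lambda>h. M h $ i $ j) \<in> polynomial_maps X"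
  shows "(\<lambda>h. det (M h)) \<in> polynomial_maps X"
  unfolding det_def
  by (intro polynomial_maps_sum polynomial_maps.mult polynomial_maps_prod polynomial_maps.const assms) auto

lemma degree_linear_comb_monom_le:
  "N \<ge> 1 \<Longrightarrow> degree (\<Sum>c<N. monom (x c :: complex) c) \<le> N - 1"
  by (rule degree_sum_le) (auto intro: order_trans[OF degree_monom_le])

text \<open>The Sylvester matrix of \<open>f\<close> and its derivative, both regarded as polynomials of degree at
  most \<open>N\<close>, so that its size is \<open>2 N\<close>; its rows and columns are numbered by \<open>r\<close>. Its
  determinant vanishes if \<open>f\<close> has a multiple root, but also if the degree of \<open>f\<close> is less
  than \<open>N\<close>.\<close>

definition sylvester :: "nat \<Rightarrow> ('m \<Rightarrow> nat) \<Rightarrow> complex poly \<Rightarrow> complex^'m^'m" where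
  "sylvester N r f = (\<chi> i j. coeff (if r j < N then monom 1 (r j) * f else monom 1 (r j - N) * pderiv f) (r i))"

context
  fixes N :: nat and r :: "'m::finite \<Rightarrow> nat"
  assumes N: "N \<ge> 1" and r: "bij_betw r UNIV {..<2 * N}"
begin

text \<open>In the numbering \<open>r\<close>, the first \<open>N\<close> entries of
  \<open>x\<close> are the coefficients of \<open>U\<close> and the others those of
  \<open>V\<close>; the matrix is the map from such pairs to \<open>U f + V f'\<close>.\<close>

lemma sylvester_mult_vector:
  obtains U V where "degree U \<le> N - 1" "degree V \<le> N - 1"
    "\<And>i. (sylvester N r f *v x) $ i = coeff (U * f + V * pderiv f) (r i)"
    "U = 0 \<Longrightarrow> V = 0 \<Longrightarrow> x = 0"
proof -
  define e where "e = inv_into UNIV r"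
  have re: "r (e c) = c" if "c < 2 * N" for c
    using bij_betw_inv_into_right[OF r, of c] that by (simp add: e_def)
  have er: "e (r i) = i" for i using bij_betw_inv_into_left[OF r, of i] by (simp add: e_def)
  have rN: "r i < 2 * N" for i using r by (auto simp: bij_betw_def)
  have be: "bij_betw e {..<2 * N} UNIV" unfolding e_def by (rule bij_betw_inv_into[OF r])
  define U where "U = (\<Sum>c<N. monom (x $ e c) c)"
  define V where "V = (\<Sum>c<N. monom (x $ e (N + c)) c)"
  show ?thesis
  proof (rule that[of U V])
    show "degree U \<le> N - 1" "degree V \<le> N - 1"
      unfolding U_def V_def using degree_linear_comb_monom_le[OF N] by auto
    fix i
    define col where "col = (\<lambda>c. coeff (if c < N then monom 1 c * f else monom 1 (c - N) * pderiv f) (r i))"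
    have "(sylvester N r f *v x) $ i = (\<Sum>j\<in>UNIV. col (r j) * x $ j)"
      by (simp add: matrix_vector_mult_def sylvester_def col_def)
    also have "\<dots> = (\<Sum>c<2*N. col (r (e c)) * x $ e c)"
      using sum.reindex_bij_betw[OF be, of "\<lambda>j. col (r j) * x $ j"] by simp
    also have "\<dots> = (\<Sum>c<2*N. col c * x $ e c)" by (intro sum.cong refl) (simp add: re)
    also have "\<dots> = (\<Sum>c<N. col c * x $ e c) + (\<Sum>c<N. col (N + c) * x $ e (N + c))"
      using sum.atLeastLessThan_concat[of 0 N "2 * N" "\<lambda>c. col c * x $ e c"]
        sum.shift_bounds_nat_ivl[of "\<lambda>c. col c * x $ e c" 0 N N]
      by (simp add: lessThan_atLeast0 mult_2 add.commute)
    also have "(\<Sum>c<N. col c * x $ e c) = coeff (U * f) (r i)"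
    proof -
      have "U * f = (\<Sum>c<N. smult (x $ e c) (monom 1 c * f))"
        unfolding U_def sum_distrib_right by (simp add: smult_monom flip: mult_smult_left)
      then show ?thesis by (simp add: coeff_sum col_def mult.commute)
    qed
    also have "(\<Sum>c<N. col (N + c) * x $ e (N + c)) = coeff (V * pderiv f) (r i)"
    proof -
      have "V * pderiv f = (\<Sum>c<N. smult (x $ e (N + c)) (monom 1 c * pderiv f))"
        unfolding V_def sum_distrib_right by (simp add: smult_monom flip: mult_smult_left)
      then show ?thesis by (simp add: coeff_sum col_def mult.commute)
    qed
    finally show "(sylvester N r f *v x) $ i = coeff (U * f + V * pderiv f) (r i)" by simp
  next
    assume UV: "U = 0" "V = 0"
    have cU: "coeff U c = (if c < N then x $ e c else 0)" and cV: "coeff V c = (if c < N then x $ e (N + c) else 0)" for c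
      unfolding U_def V_def by (auto simp: coeff_sum if_distrib cong: if_cong)
    have "x $ i = 0" for i
    proof (cases "r i < N")
      case True
      then show ?thesis using cU[of "r i"] UV by (simp add: er)
    next
      case False
      then have "r i - N < N" "N + (r i - N) = r i" using rN[of i] by linarith+
      then show ?thesis using cV[of "r i - N"] UV by (simp add: er)
    qed
    then show "x = 0" by (simp add: vec_eq_iff)
  qed
qed

lemma sylvester_surj:
  assumes "det (sylvester N r f) \<noteq> 0" and g: "degree g < 2 * N" and f: "degree f \<le> N"
  obtains U V where "degree U \<le> N - 1" "degree V \<le> N - 1" "U * f + V * pderiv f = g"
proof -
  have rN: "r i < 2 * N" for i using r by (auto simp: bij_betw_def)
  have "\<exists>x. sylvester N r f *v x = (\<chi> i. coeff g (r i))"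
    using assms(1) by (metis invertible_det_nz invertible_right_inverse matrix_right_invertible_surjective surjD)
  then obtain x where x: "sylvester N r f *v x = (\<chi> i. coeff g (r i))" by blast
  obtain U V where UV: "degree U \<le> N - 1" "degree V \<le> N - 1"
    "\<And>i. (sylvester N r f *v x) $ i = coeff (U * f + V * pderiv f) (r i)"
    using sylvester_mult_vector[of f x] by metis
  have "coeff (U * f + V * pderiv f) k = coeff g k" for k
  proof (cases "k < 2 * N")
    case True
    then obtain i where "r i = k" using r by (metis bij_betw_imp_surj_on imageE lessThan_iff)
    then show ?thesis using UV(3)[of i] x by (simp add: vec_eq_iff)
  next
    case False
    have "degree (U * f) < 2 * N" using degree_mult_le[of U f] UV(1) f N by linarith
    moreover have "degree (pderiv f) \<le> N" using f by (simp add: degree_pderiv)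
    then have "degree (V * pderiv f) < 2 * N" using degree_mult_le[of V "pderiv f"] UV(2) N by linarith
    ultimately show ?thesis using False g by (simp add: coeff_eq_0)
  qed
  then show ?thesis using that UV(1,2) by (metis poly_eqI)
qed

text \<open>Invertibility lets \<open>U f + V f'\<close> represent every polynomial of degree below
  \<open>2 N\<close>. Representing the monomial of degree \<open>2 N - 1\<close> forces
  \<open>f\<close> to have degree \<open>N\<close>; representing 1 excludes common roots of
  \<open>f\<close> and \<open>f'\<close>.\<close>

lemma discriminant_nonzero:
  assumes D: "det (sylvester N r f) \<noteq> 0" and f: "degree f \<le> N"
  shows "coeff f N \<noteq> 0" "finite {t. poly f t = 0}" "card {t. poly f t = 0} = N"
proof -
  show lead: "coeff f N \<noteq> 0"
  proof
    assume c: "coeff f N = 0"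
    have df: "degree f \<le> N - 1"
    proof (rule degree_le, intro allI impI)
      fix i assume "N - 1 < i"
      then show "coeff f i = 0" using c f by (cases "i = N") (auto simp: coeff_eq_0)
    qed
    have "degree (monom (1::complex) (2 * N - 1)) < 2 * N" using N by (simp add: degree_monom_eq)
    then obtain U V where UV: "degree U \<le> N - 1" "degree V \<le> N - 1" "U * f + V * pderiv f = monom 1 (2 * N - 1)"
      using sylvester_surj[OF D _ f] by metis
    have "degree (U * f) < 2 * N - 1" using degree_mult_le[of U f] UV(1) df N by linarith
    moreover have "degree (pderiv f) \<le> N - 1" using df by (simp add: degree_pderiv)
    then have "degree (V * pderiv f) < 2 * N - 1" using degree_mult_le[of V "pderiv f"] UV(2) N by linarith
    ultimately have "coeff (U * f + V * pderiv f) (2 * N - 1) = 0" by (simp add: coeff_eq_0)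
    then show False unfolding UV(3) by simp
  qed
  then have f0: "f \<noteq> 0" and dN: "degree f = N" using f le_degree by (auto intro: antisym)
  show fin: "finite {t. poly f t = 0}" using f0 by (rule poly_roots_finite)
  have "degree (1 :: complex poly) < 2 * N" using N by simp
  then obtain U V where UV: "U * f + V * pderiv f = 1" using sylvester_surj[OF D _ f] by metis
  have "rsquarefree f" unfolding rsquarefree_roots
  proof (intro allI notI)
    fix a assume "poly f a = 0 \<and> poly (pderiv f) a = 0"
    then have "poly (U * f + V * pderiv f) a = 0" by simp
    then show False unfolding UV by simp
  qed
  then have fac: "smult (lead_coeff f) (\<Prod>z|poly f z = 0. [:-z, 1:]) = f"
    by (rule complex_poly_decompose_rsquarefree)
  have "degree (\<Prod>z|poly f z = 0. [:-z, 1:]) = card {z. poly f z = 0}"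
    by (subst degree_prod_eq_sum_degree) auto
  then show "card {t. poly f t = 0} = N" using arg_cong[OF fac, of degree] lead dN by simp
qed

lemma discriminant_monom: "det (sylvester N r (monom 1 N - 1)) \<noteq> 0"
proof -
  define f where "f = (monom 1 N - 1 :: complex poly)"
  have df: "degree f = N"
  proof -
    have "degree (monom (1::complex) N) = N" by (simp add: degree_monom_eq)
    moreover have "degree (- 1 :: complex poly) < N" using N by simp
    ultimately show ?thesis unfolding f_def by (metis degree_add_eq_left diff_conv_add_uminus)
  qed
  then have f0: "f \<noteq> 0" using N by auto
  have rN: "r i < 2 * N" for i using r by (auto simp: bij_betw_def)
  have "x = 0" if x: "sylvester N r f *v x = 0" for x
  proof -
    obtain U V where UV: "degree U \<le> N - 1" "degree V \<le> N - 1"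
      "\<And>i. (sylvester N r f *v x) $ i = coeff (U * f + V * pderiv f) (r i)" "U = 0 \<Longrightarrow> V = 0 \<Longrightarrow> x = 0"
      using sylvester_mult_vector[of f x] by metis
    have "coeff (U * f + V * pderiv f) k = 0" for k
    proof (cases "k < 2 * N")
      case True
      then obtain i where "r i = k" using r by (metis bij_betw_imp_surj_on imageE lessThan_iff)
      then show ?thesis using UV(3)[of i] x by simp
    next
      case False
      have "degree (U * f) < 2 * N" using degree_mult_le[of U f] UV(1) df N by linarith
      moreover have "degree (pderiv f) \<le> N" using df by (simp add: degree_pderiv)
      then have "degree (V * pderiv f) < 2 * N" using degree_mult_le[of V "pderiv f"] UV(2) N by linarith
      ultimately show ?thesis using False by (simp add: coeff_eq_0)
    qed
    then have eq: "U * f + V * pderiv f = 0" by (simp add: poly_eq_iff)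
    \<comment> \<open>With \<open>y = t / N\<close> there is the explicit Bezout identity
      \<open>y f' - f = 1\<close> for \<open>f = t^N - 1\<close>. It makes \<open>V\<close> a
      multiple of \<open>f\<close>, which the degree bound rules out unless
      \<open>V = 0\<close>.\<close>
    define y where "y = smult (1 / of_nat N) (monom (1::complex) 1)"
    have bez: "y * pderiv f - f = 1"
    proof -
      have "pderiv f = monom (of_nat N) (N - 1)" by (simp add: f_def pderiv_diff pderiv_monom)
      then have "y * pderiv f = monom 1 N" using N by (simp add: y_def smult_monom mult_monom)
      then show ?thesis by (simp add: f_def)
    qed
    have "V = V * (y * pderiv f - f)" by (simp add: bez)
    also have "\<dots> = y * (U * f + V * pderiv f) - f * (V + y * U)" by (simp add: algebra_simps)
    finally have V: "V = - (f * (V + y * U))" by (simp add: eq)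
    have "V = 0"
    proof (rule ccontr)
      assume V0: "V \<noteq> 0"
      then have "V + y * U \<noteq> 0" using V by auto
      then have "degree V = N + degree (V + y * U)"
        using f0 df by (subst V) (simp add: degree_mult_eq)
      then show False using UV(2) N by linarith
    qed
    then have "U * f = 0" using eq by simp
    then have "U = 0" using f0 by simp
    then show ?thesis using UV(4) \<open>V = 0\<close> by simp
  qed
  then have "invertible (sylvester N r f)"
    using matrix_left_invertible_ker invertible_left_inverse by blast
  then show ?thesis by (simp add: invertible_det_nz f_def)
qed

lemma polynomial_maps_sylvester:
  assumes "\<And>k. (\<lambda>h. coeff (f h) k) \<in> polynomial_maps X"
  shows "(\<lambda>h. det (sylvester N r (f h))) \<in> polynomial_maps X"
proof (rule polynomial_maps_det)
  fix i j
  have 1: "(\<lambda>h. coeff (monom 1 k * f h) l) \<in> polynomial_maps X" for k l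
    using assms by (cases "l < k") (simp_all add: coeff_monom_mult polynomial_maps.const)
  have 2: "(\<lambda>h. coeff (monom 1 k * pderiv (f h)) l) \<in> polynomial_maps X" for k l
    using assms by (cases "l < k")
      (simp_all add: coeff_monom_mult coeff_pderiv polynomial_maps.const polynomial_maps.mult del: of_nat_Suc)
  show "(\<lambda>h. sylvester N r (f h) $ i $ j) \<in> polynomial_maps X"
    using 1 2 by (cases "r j < N") (simp_all add: sylvester_def)
qed

end

subsection \<open>The degree of a twistor sphere\<close>

lemma poly_linear_combination:
  "poly (\<Sum>p\<in>A. smult (c p) (\<Prod>i\<in>B. [:a p i, b p i:])) t = (\<Sum>p\<in>A. c p * (\<Prod>i\<in>B. a p i + b p i * t))"
  by (simp add: poly_sum poly_prod mult.commute)

lemma prod_linear_degree_coeff: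
  fixes a b :: "'i \<Rightarrow> complex"
  assumes "finite B"
  shows "degree (\<Prod>i\<in>B. [:a i, b i:]) \<le> card B \<and> coeff (\<Prod>i\<in>B. [:a i, b i:]) (card B) = (\<Prod>i\<in>B. b i)"
  using assms
proof (induction B rule: finite_induct)
  case empty
  then show ?case by simp
next
  case (insert x F)
  let ?p = "\<Prod>i\<in>F. [:a i, b i:]"
  have "degree ([:a x, b x:] * ?p) \<le> Suc (card F)"
    using degree_mult_le[of "[:a x, b x:]" ?p] insert.IH by (simp split: if_splits)
  moreover have "coeff ([:a x, b x:] * ?p) (Suc (card F)) = b x * coeff ?p (card F)"
    using insert.IH by (simp add: coeff_eq_0)
  ultimately show ?case using insert by simp
qed

lemma mat_vector: "mat t *v x = t *s (x :: complex^'m)"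
  by (simp add: mat_def matrix_vector_mult_def vec_eq_iff if_distrib[of "\<lambda>u. u * _"] cong: if_cong)

lemma is_basis_of_image:
  assumes w: "is_basis_of k w W" and inj: "inj_on ((*v) (M :: complex^'m^'m)) W"
  shows "is_basis_of k (\<lambda>j. M *v w j) ((*v) M ` W)"
proof -
  have sp: "vec.span (w ` {..<k}) = W" using w by (simp add: is_basis_of_def)
  have im: "(\<lambda>j. M *v w j) ` {..<k} = (*v) M ` w ` {..<k}" by (simp add: image_image)
  have "w ` {..<k} \<subseteq> W" using vec.span_superset[of "w ` {..<k}"] sp by simp
  then have "inj_on ((*v) M \<circ> w) {..<k}"
    using w inj by (intro comp_inj_on) (auto simp: is_basis_of_def intro: inj_on_subset)
  then have "inj_on (\<lambda>j. M *v w j) {..<k}" by (simp add: comp_def)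
  moreover have "vec.independent ((*v) M ` w ` {..<k})"
    using w inj sp by (intro vec.independent_injective_image) (auto simp: is_basis_of_def)
  moreover have "vec.span ((*v) M ` w ` {..<k}) = (*v) M ` W" using vec.span_image sp by metis
  ultimately show ?thesis by (simp add: is_basis_of_def im)
qed

lemma exists_basis:
  fixes W :: "(complex^'m) set"
  assumes "vec.subspace W" "vec.dim W = k"
  obtains w where "is_basis_of k w W"
proof -
  obtain B where B: "B \<subseteq> W" "vec.independent B" "W \<subseteq> vec.span B" "card B = vec.dim W"
    using vec.basis_exists by blast
  have "finite B" using B(2) vec.finiteI_independent by blast
  then obtain w where "bij_betw w {0..<card B} B" using ex_bij_betw_nat_finite by blast
  then have w: "inj_on w {..<k}" "w ` {..<k} = B" using B(4) assms(2) by (auto simp: bij_betw_def lessThan_atLeast0)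
  have "vec.span B = W" using B assms(1) vec.span_minimal by blast
  then show ?thesis using that[of w] w B by (simp add: is_basis_of_def)
qed

lemma proj_point_eqD:
  assumes "proj_point v = proj_point w"
  obtains c where "c \<noteq> 0" "\<And>i. v i = c * w i"
proof -
  have "v \<in> proj_point v" unfolding proj_point_def by (intro CollectI exI[of _ 1]) simp
  then have "v \<in> proj_point w" using assms by simp
  then obtain c where "c \<noteq> 0" "v = (\<lambda>i. c * w i)" by (auto simp: proj_point_def)
  then show ?thesis using that[of c] by simp
qed

lemma proj_point_in_hyperplane:
  assumes "proj_point v \<in> proj_space X"
  shows "proj_point v \<in> hyperplane X h \<longleftrightarrow> (\<Sum>i\<in>X. h i * v i) = 0"
proof -
  have "(\<Sum>i\<in>X. h i * (c * v i)) = c * (\<Sum>i\<in>X. h i * v i)" for c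
    by (simp add: sum_distrib_left mult_ac)
  then have "(\<forall>x\<in>proj_point v. (\<Sum>i\<in>X. h i * x i) = 0) \<longleftrightarrow> (\<forall>c. c \<noteq> 0 \<longrightarrow> c * (\<Sum>i\<in>X. h i * v i) = 0)"
    by (auto simp: proj_point_def)
  also have "\<dots> \<longleftrightarrow> (\<Sum>i\<in>X. h i * v i) = 0" by (metis mult_eq_0_iff one_neq_zero)
  finally show ?thesis using assms by (simp add: hyperplane_def)
qed

text \<open>The Pluecker coordinates of the plane with basis \<open>w j + t u j\<close> are polynomials of degree at
  most \<open>N\<close> in \<open>t\<close>; evaluating determinants of coordinate functionals shows that the linear
  forms in them comprise all powers of \<open>t\<close> up to \<open>N\<close>, so the curve is a rational normal
  curve.\<close>

definition pencil_poly :: "nat \<Rightarrow> (nat \<Rightarrow> complex^'m) \<Rightarrow> (nat \<Rightarrow> complex^'m) \<Rightarrow> 'm::finite set \<Rightarrow> complex poly" where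
  "pencil_poly N w u S = (\<Sum>p | p permutes {..<N}. smult (of_int (sign p))
     (\<Prod>i<N. [:w (p i) $ (index_list S ! i), u (p i) $ (index_list S ! i):]))"

lemma poly_pencil_poly:
  assumes "card S = N"
  shows "poly (pencil_poly N w u S) t = pluecker_coords N (\<lambda>j. w j + t *s u j) S"
  using assms unfolding pencil_poly_def
  by (subst poly_linear_combination) (simp add: pluecker_coords_def pluecker_indices_def mult.commute)

lemma degree_pencil_poly: "degree (pencil_poly N w u S) \<le> N"
  unfolding pencil_poly_def
proof (rule degree_sum_le)
  fix p assume "p \<in> {p. p permutes {..<N}}"
  show "degree (smult (of_int (sign p)) (\<Prod>i<N. [:w (p i) $ (index_list S ! i), u (p i) $ (index_list S ! i):])) \<le> N"
    using prod_linear_degree_coeff[of "{..<N}" "\<lambda>i. w (p i) $ (index_list S ! i)" "\<lambda>i. u (p i) $ (index_list S ! i)"]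
    by (intro order_trans[OF degree_smult_le]) simp
qed (simp add: finite_permutations)

lemma lead_coeff_pencil_poly:
  assumes "card S = N"
  shows "coeff (pencil_poly N w u S) N = pluecker_coords N u S"
proof -
  have "coeff (\<Prod>i<N. [:w (p i) $ (index_list S ! i), u (p i) $ (index_list S ! i):]) N = (\<Prod>i<N. u (p i) $ (index_list S ! i))" for p
    using prod_linear_degree_coeff[of "{..<N}" "\<lambda>i. w (p i) $ (index_list S ! i)" "\<lambda>i. u (p i) $ (index_list S ! i)"]
    by simp
  then show ?thesis
    using assms unfolding pencil_poly_def by (simp add: coeff_sum pluecker_coords_def pluecker_indices_def)
qed

lemma pencil_functional:
  fixes w u :: "nat \<Rightarrow> complex^'m" and D :: "complex^'m^'m" and e :: "nat \<Rightarrow> 'm"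
  assumes e: "inj_on e {..<2 * N}"
    and D: "\<And>j. j < N \<Longrightarrow> D *v w j = axis (e j) 1" "\<And>j. j < N \<Longrightarrow> D *v u j = axis (e (N + j)) 1"
    and k: "k \<le> N"
  obtains h where "\<And>t. (\<Sum>S\<in>pluecker_indices N. h S * pluecker_coords N (\<lambda>j. w j + t *s u j) S) = t ^ k"
proof -
  \<comment> \<open>In the coordinates given by \<open>D\<close> the pencil consists of an identity
    block above \<open>t\<close> times the identity. Taking row \<open>i\<close> from the lower
    block for \<open>i < k\<close> and from the upper one otherwise leaves a diagonal matrix with
    determinant \<open>t ^ k\<close>.\<close>
  define row where "row = (\<lambda>i. if i < k then e (N + i) else e i)"
  obtain h where h: "\<And>v. (\<Sum>p | p permutes {..<N}. of_int (sign p) * (\<Prod>i<N. \<Sum>m\<in>UNIV. D $ row i $ m * v (p i) $ m)) =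
       (\<Sum>S\<in>pluecker_indices N. h S * pluecker_coords N v S)"
    using functional_det_pluecker[where \<phi> = "\<lambda>i m. D $ row i $ m" and k = N] by blast
  have e_eq: "e a = e b \<longleftrightarrow> a = b" if "a < 2 * N" "b < 2 * N" for a b
    using e that by (auto simp: inj_on_def)
  have entry: "(\<Sum>m\<in>UNIV. D $ row i $ m * (w j + t *s u j) $ m) = (if i = j then (if i < k then t else 1) else 0)"
    if ij: "i < N" "j < N" for i j t
  proof -
    have "(\<Sum>m\<in>UNIV. D $ row i $ m * (w j + t *s u j) $ m) = (D *v (w j + t *s u j)) $ row i"
      by (simp add: matrix_vector_mult_def)
    also have "\<dots> = axis (e j) 1 $ row i + t * axis (e (N + j)) 1 $ row i"
      using ij by (simp add: matrix_vector_right_distrib cmat_scale D)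
    also have "\<dots> = (if i = j then (if i < k then t else 1) else 0)"
      using ij k by (auto simp: axis_def row_def e_eq)
    finally show ?thesis .
  qed
  show ?thesis
  proof (rule that[of h])
    fix t
    have "(\<Sum>S\<in>pluecker_indices N. h S * pluecker_coords N (\<lambda>j. w j + t *s u j) S) =
      (\<Sum>p | p permutes {..<N}. of_int (sign p) * (\<Prod>i<N. if i = p i then (if i < k then t else 1) else 0))"
      unfolding h[symmetric]
    proof (intro sum.cong refl arg_cong2[where f = "(*)"] prod.cong)
      fix p i assume p: "p \<in> {p. p permutes {..<N}}" and i: "i \<in> {..<N}"
      then have "p i < N" using permutes_in_image[of p "{..<N}" i] by simp
      then show "(\<Sum>m\<in>UNIV. D $ row i $ m * (w (p i) + t *s u (p i)) $ m) = (if i = p i then (if i < k then t else 1) else 0)"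
        using entry[of i "p i"] i by simp
    qed
    also have "\<dots> = (\<Sum>p\<in>{id}. of_int (sign p) * (\<Prod>i<N. if i = p i then (if i < k then t else 1) else 0))"
    proof (rule sum.mono_neutral_right)
      show "finite {p. p permutes {..<N}}" by (simp add: finite_permutations)
      show "{id} \<subseteq> {p. p permutes {..<N}}" using permutes_id by auto
      show "\<forall>p\<in>{p. p permutes {..<N}} - {id}. of_int (sign p) * (\<Prod>i<N. if i = p i then (if i < k then t else 1) else 0) = 0"
      proof
        fix p assume "p \<in> {p. p permutes {..<N}} - {id}"
        then obtain i where "p i \<noteq> i" "p permutes {..<N}" by (auto simp: fun_eq_iff)
        then have "i < N" "i \<noteq> p i" by (auto simp: permutes_def)
        then have "(\<Prod>i<N. if i = p i then (if i < k then t else 1) else 0) = 0"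
          by (intro prod_zero) auto
        then show "of_int (sign p) * (\<Prod>i<N. if i = p i then (if i < k then t else 1) else 0) = 0" by simp
      qed
    qed
    also have "\<dots> = (\<Prod>i<N. if i < k then t else 1)" by (simp add: sign_id)
    also have "\<dots> = (\<Prod>i<k. t)"
      using k by (intro prod.mono_neutral_cong_right) auto
    finally show "(\<Sum>S\<in>pluecker_indices N. h S * pluecker_coords N (\<lambda>j. w j + t *s u j) S) = t ^ k" by simp
  qed
qed

theorem has_degree_twistor_sphere:
  fixes I J :: "real^'m^'m"
  assumes IJ: "I \<in> complex_structures" "J \<in> complex_structures" "I ** J = - (J ** I)"
    and N: "CARD('m) = 2 * N"
  shows "has_degree (pluecker_indices N) (pluecker N ` period_plane ` twistor_sphere I J) N"
proof -
  define W where "W = period_plane I"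
  define X where "X = (pluecker_indices N :: 'm set set)"
  have N1: "N \<ge> 1" using N zero_less_card_finite[where 'a = 'm] by linarith
  have sW: "vec.subspace W" unfolding W_def by (rule subspace_period_plane[OF IJ(1)])
  have "vec.dim W = N" using dim_period_plane[OF IJ] N by (simp add: W_def)
  then obtain w where w: "is_basis_of N w W" using exists_basis[OF sW] by blast
  define u where "u = (\<lambda>j. cmat J *v w j)"
  have wW: "w j \<in> W" if "j < N" for j
    using w that vec.span_base[of "w j" "w ` {..<N}"] by (auto simp: is_basis_of_def)
  have JJ: "cmat J *v (cmat J *v x) = - x" for x by (rule cmat_complex_structure[OF IJ(2)])
  note indep = quaternion_plane_independent[OF IJ, folded W_def]
  obtain e :: "nat \<Rightarrow> 'm" where e: "bij_betw e {..<2 * N} UNIV"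
    using ex_bij_betw_nat_finite[of "UNIV :: 'm set"] N by (auto simp: lessThan_atLeast0)
  obtain D where D: "\<And>j. j < N \<Longrightarrow> D *v w j = axis (e j) 1" "\<And>j. j < N \<Longrightarrow> D *v u j = axis (e (N + j)) 1"
  proof -
    have wi: "inj_on w {..<N}" "vec.independent (w ` {..<N})" using w by (auto simp: is_basis_of_def)
    have ex: "\<exists>F :: complex^'m^'m. \<forall>j<N. F *v w j = a j" for a
    proof -
      obtain f where f: "Vector_Spaces.linear (*s) (*s) f" "\<forall>x\<in>w ` {..<N}. f x = a (inv_into {..<N} w x)"
        using vec.linear_independent_extend[OF wi(2), of "\<lambda>x. a (inv_into {..<N} w x)"] by blast
      have "matrix f *v w j = a j" if "j < N" for j
        using f that wi(1) by (simp add: matrix_works[OF f(1)])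
      then show ?thesis by blast
    qed
    obtain F1 where F1: "\<And>j. j < N \<Longrightarrow> F1 *v w j = axis (e j) 1" using ex[of "\<lambda>j. axis (e j) 1"] by blast
    obtain F2 where F2: "\<And>j. j < N \<Longrightarrow> F2 *v w j = axis (e (N + j)) 1" using ex[of "\<lambda>j. axis (e (N + j)) 1"] by blast
    obtain p where p: "\<And>a. a \<in> W \<Longrightarrow> p *v a = a" "\<And>b. b \<in> (*v) (cmat J) ` W \<Longrightarrow> p *v b = 0"
      using complementary_projection[OF complementary_quaternion_planes[OF IJ], folded W_def] by metis
    \<comment> \<open>\<open>F1\<close> acts on \<open>W\<close>; on \<open>J W\<close> the inverse
      \<open>- J\<close> of \<open>J\<close> first returns to \<open>W\<close>, where
      \<open>F2\<close> acts.\<close>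
    define D where "D = F1 ** p - F2 ** cmat J ** (mat 1 - p)"
    have Dv: "D *v x = F1 *v (p *v x) - F2 *v (cmat J *v (x - p *v x))" for x
      by (simp add: D_def matrix_vector_mult_diff_rdistrib matrix_vector_mul_assoc[symmetric])
    show ?thesis
    proof (rule that[of D])
      fix j assume j: "j < N"
      show "D *v w j = axis (e j) 1" by (simp add: Dv p(1)[OF wW[OF j]] F1[OF j])
      have "p *v u j = 0" using p(2) wW[OF j] by (simp add: u_def)
      then show "D *v u j = axis (e (N + j)) 1" by (simp add: Dv u_def JJ cmat_neg F2[OF j])
    qed
  qed
  have finX: "finite X" by simp
  define pt where "pt = (\<lambda>t. proj_point (pluecker_coords N (\<lambda>j. w j + t *s u j)))"
  \<comment> \<open>\<open>f h\<close> is the linear form \<open>h\<close> restricted to the affine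
    part of the curve; its coefficient at \<open>N\<close> is the value of \<open>h\<close> at the
    point at infinity.\<close>
  define f where "f = (\<lambda>h :: 'm set \<Rightarrow> complex. \<Sum>S\<in>X. smult (h S) (pencil_poly N w u S))"
  have cardX: "card S = N" if "S \<in> X" for S using that by (simp add: X_def pluecker_indices_def)
  have polyf: "poly (f h) t = (\<Sum>S\<in>X. h S * pluecker_coords N (\<lambda>j. w j + t *s u j) S)" for h t
    unfolding f_def by (simp add: poly_sum poly_pencil_poly cardX)
  have leadf: "coeff (f h) N = (\<Sum>S\<in>X. h S * pluecker_coords N u S)" for h
    unfolding f_def by (simp add: coeff_sum lead_coeff_pencil_poly cardX)
  have degf: "degree (f h) \<le> N" for h
    unfolding f_def using finX degree_pencil_poly
    by (intro degree_sum_le order_trans[OF degree_smult_le]) auto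
  have hk: "\<exists>h. f h = monom 1 k" if k: "k \<le> N" for k
  proof -
    obtain h where h: "\<And>t. (\<Sum>S\<in>X. h S * pluecker_coords N (\<lambda>j. w j + t *s u j) S) = t ^ k"
      using pencil_functional[OF bij_betw_imp_inj_on[OF e] D k] unfolding X_def by blast
    have "poly (f h) = poly (monom 1 k)" by (rule ext) (simp add: polyf h poly_monom)
    then have "f h = monom 1 k" by (simp only: poly_eq_poly_eq_iff)
    then show ?thesis by blast
  qed
  have nz_t: "\<exists>S\<in>X. pluecker_coords N (\<lambda>j. w j + t *s u j) S \<noteq> 0" for t
  proof -
    obtain h where h: "f h = monom 1 0" using hk[of 0] by auto
    then have "(\<Sum>S\<in>X. h S * pluecker_coords N (\<lambda>j. w j + t *s u j) S) = 1"
      unfolding polyf[symmetric] by (simp add: poly_monom)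
    then show ?thesis by (metis (no_types, lifting) mult_zero_right sum.neutral zero_neq_one)
  qed
  have nz_inf: "\<exists>S\<in>X. pluecker_coords N u S \<noteq> 0"
  proof -
    obtain h where "f h = monom 1 N" using hk[of N] by auto
    then have "(\<Sum>S\<in>X. h S * pluecker_coords N u S) = 1" unfolding leadf[symmetric] by simp
    then show ?thesis by (metis (no_types, lifting) mult_zero_right sum.neutral zero_neq_one)
  qed
  have pl_inf: "pluecker N ((*v) (cmat J) ` W) = proj_point (pluecker_coords N u)"
  proof -
    have "inj_on ((*v) (cmat J)) W" by (rule inj_onI) (metis JJ neg_equal_iff_equal)
    then have "is_basis_of N u ((*v) (cmat J) ` W)" unfolding u_def by (rule is_basis_of_image[OF w])
    then show ?thesis using pluecker_eq nz_inf by blast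
  qed
  have pl_t: "pluecker N (sphere_plane I J t) = pt t" for t
  proof -
    define M where "M = mat 1 + mat t ** cmat J"
    have M: "M *v x = x + t *s (cmat J *v x)" for x
      by (simp add: M_def matrix_vector_mult_add_rdistrib matrix_vector_mul_assoc[symmetric] mat_vector)
    have "inj_on ((*v) M) W"
    proof (rule inj_onI)
      fix x y assume xy: "x \<in> W" "y \<in> W" "M *v x = M *v y"
      have "(x - y) + cmat J *v (t *s (x - y)) = M *v x - M *v y" unfolding M by (simp add: cvec_simps)
      then have "(x - y) + cmat J *v (t *s (x - y)) = 0" using xy by simp
      moreover have "x - y \<in> W" "t *s (x - y) \<in> W" using xy sW vec.subspace_diff vec.subspace_scale by blast+
      ultimately show "x = y" using indep(1)[of "x - y" "t *s (x - y)"] by simp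
    qed
    then have "is_basis_of N (\<lambda>j. M *v w j) ((*v) M ` W)" by (rule is_basis_of_image[OF w])
    moreover have "(*v) M ` W = sphere_plane I J t"
      unfolding sphere_plane_def[OF IJ] W_def by (simp add: M)
    ultimately have "is_basis_of N (\<lambda>j. w j + t *s u j) (sphere_plane I J t)"
      by (simp add: M u_def)
    then show ?thesis unfolding pt_def using pluecker_eq nz_t[of t] by blast
  qed
  have C: "pluecker N ` period_plane ` twistor_sphere I J = insert (proj_point (pluecker_coords N u)) (range pt)"
    unfolding period_planes_twistor_sphere[OF IJ] W_def[symmetric] by (simp add: pl_inf image_image pl_t)
  have out: "pluecker_coords N v S = 0" if "S \<notin> X" for v :: "nat \<Rightarrow> complex^'m" and S
    using that by (simp add: pluecker_coords_def X_def)
  have ps: "proj_point (pluecker_coords N v) \<in> proj_space X" if "\<exists>S\<in>X. pluecker_coords N v S \<noteq> 0"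
    for v :: "nat \<Rightarrow> complex^'m"
    unfolding proj_space_def using that out by blast
  have inj: "inj pt"
  proof (rule injI)
    fix t t' assume "pt t = pt t'"
    then obtain c where c: "\<And>S. pluecker_coords N (\<lambda>j. w j + t *s u j) S = c * pluecker_coords N (\<lambda>j. w j + t' *s u j) S"
      unfolding pt_def by (rule proj_point_eqD) (rule that)
    have fc: "poly (f h) t = c * poly (f h) t'" for h
      unfolding polyf c by (simp add: sum_distrib_left mult_ac)
    \<comment> \<open>The linear forms restricting to 1 and to \<open>t\<close> separate the
      points.\<close>
    obtain h0 h1 where "f h0 = monom 1 0" "f h1 = monom 1 1" using hk[of 0] hk[of 1] N1 by auto
    then show "t = t'" using fc[of h0] fc[of h1] by (simp add: poly_monom)
  qed
  \<comment> \<open>The Sylvester matrix has size \<open>2 N = CARD('m)\<close>, so its rows and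
    columns can be indexed by the coordinate type.\<close>
  have r: "bij_betw (inv_into {..<2 * N} e) UNIV {..<2 * N}" by (rule bij_betw_inv_into[OF e])
  define q where "q = (\<lambda>h. det (sylvester N (inv_into {..<2 * N} e) (f h)))"
  have "q \<in> polynomial_maps X"
    unfolding q_def
  proof (rule polynomial_maps_sylvester[OF N1 r])
    fix k
    have "(\<lambda>h. \<Sum>S\<in>X. h S * coeff (pencil_poly N w u S) k) \<in> polynomial_maps X"
      using finX by (intro polynomial_maps_sum polynomial_maps.mult polynomial_maps.coord polynomial_maps.const)
    then show "(\<lambda>h. coeff (f h) k) \<in> polynomial_maps X" by (simp add: f_def coeff_sum)
  qed
  moreover have "\<exists>h. q h \<noteq> 0"
  proof -
    \<comment> \<open>The difference of these forms restricts to \<open>t^N - 1\<close> and cuts out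
      the roots of unity, a case with nonzero discriminant.\<close>
    obtain h0 hN where h: "f h0 = monom 1 0" "f hN = monom 1 N" using hk[of 0] hk[of N] by auto
    have "f (\<lambda>S. hN S - h0 S) = f hN - f h0" by (simp add: f_def smult_diff_left sum_subtractf)
    also have "\<dots> = monom 1 N - 1" by (simp add: h)
    finally show ?thesis unfolding q_def using discriminant_monom[OF N1 r] by metis
  qed
  moreover have "finite (insert (proj_point (pluecker_coords N u)) (range pt) \<inter> hyperplane X h) \<and>
      card (insert (proj_point (pluecker_coords N u)) (range pt) \<inter> hyperplane X h) = N" if q: "q h \<noteq> 0" for h
  proof -
    note d = discriminant_nonzero[OF N1 r q[unfolded q_def] degf]
    \<comment> \<open>The leading coefficient does not vanish, so a general hyperplane misses the
      point at infinity and all its \<open>N\<close> intersection points are roots of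
      \<open>f h\<close>.\<close>
    have "proj_point (pluecker_coords N u) \<notin> hyperplane X h"
      using d(1) unfolding proj_point_in_hyperplane[OF ps[OF nz_inf]] leadf .
    moreover have "pt t \<in> hyperplane X h \<longleftrightarrow> poly (f h) t = 0" for t
      unfolding pt_def proj_point_in_hyperplane[OF ps[OF nz_t]] polyf ..
    ultimately have "insert (proj_point (pluecker_coords N u)) (range pt) \<inter> hyperplane X h = pt ` {t. poly (f h) t = 0}"
      by auto
    then show ?thesis using d inj by (simp add: card_image inj_on_subset[OF inj])
  qed
  moreover have "insert (proj_point (pluecker_coords N u)) (range pt) \<subseteq> proj_space X"
    unfolding pt_def using ps nz_inf nz_t by auto
  ultimately show ?thesis unfolding has_degree_def X_def[symmetric] C by blast
qed

theorem theorem1: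
  fixes n :: nat and \<Gamma> :: "(real^'m) set"
  assumes "n \<ge> 1" and "CARD('m) = 4 * n" and "full_lattice \<Gamma>"
  shows "(\<forall>I J :: real^'m^'m.
            I \<in> complex_structures \<longrightarrow> J \<in> complex_structures \<longrightarrow> I ** J = - (J ** I) \<longrightarrow>
              period_submanifold 1 (twistor_sphere I J) \<and>
              has_degree (pluecker_indices (2 * n))
                (pluecker (2 * n) ` period_plane ` twistor_sphere I J) (2 * n)) \<and>
         (\<forall>C \<in> components (complex_structures :: (real^'m^'m) set).
            \<forall>P \<in> C. \<forall>Q \<in> C. \<exists>Ss. generic_path \<Gamma> Ss \<and> path_connects Ss P Q)"
proof (intro conjI allI impI ballI)
  fix I J :: "real^'m^'m"
  assume IJ: "I \<in> complex_structures" "J \<in> complex_structures" "I ** J = - (J ** I)"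
  show "period_submanifold 1 (twistor_sphere I J)" by (rule period_submanifold_twistor_sphere[OF IJ])
  show "has_degree (pluecker_indices (2 * n))
      (pluecker (2 * n) ` period_plane ` twistor_sphere I J) (2 * n)"
    using assms(2) by (intro has_degree_twistor_sphere[OF IJ]) simp
next
  fix C and P Q :: "real^'m^'m"
  assume "C \<in> components complex_structures" "P \<in> C" "Q \<in> C"
  then show "\<exists>Ss. generic_path \<Gamma> Ss \<and> path_connects Ss P Q"
    by (rule generic_path_connected_components[OF assms(3,2)])
qed

end
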